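(* Fix $M_1\ge0$ and $\kappa\in\mathbb{R}$, let $\rho=\frac12+\kappa2^{-4/3}N^{-1/3}$ and $Q=(N+M_1(2N)^{2/3},N-M_1(2N)^{2/3})$. Let $\pi^{\mathrm{pp}}(Q)$ be the geodesic from the origin to $Q$ of the point-to-point half-space last passage percolation with diagonal parameter $\rho$, and $\pi^\rho(Q)$ the one of the stationary half-space last passage percolation with parameter $\rho$. Let $\mathcal{L}_M=\{(i,j): i-j=M(2N)^{2/3}\}$. Then there exist constants $C,c>0$ such that for all $M\ge M_1+9$ with $M=\mathcal{O}(N^{1/3}/\ln N)$, $$\mathbb{P}\big(\pi^{\mathrm{pp}}(Q)\cap\mathcal{L}_M=\emptyset\big)\ge\mathbb{P}\big(\pi^{\rho}(Q)\cap\mathcal{L}_M=\emptyset\big)\ge1-Ce^{-c(M-M_1)^3}$$ uniformly for all $N$ large enough.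
   Context: Half-space last passage percolation: given weights $\omega_{i,j}$ on $\{(i,j)\in\mathbb{Z}^2: i\ge j\ge0\}$, put $L(b)=\max_{\pi}\sum_{(i,j)\in\pi\setminus\{(0,0)\}}\omega_{i,j}$, the maximum being over up-right lattice paths in the half-space from $(0,0)$ to $b$; the maximizing path is called the geodesic to $b$. Non-integer quantities and points are rounded to integers by taking integer parts (so $\mathcal{L}_M$ is the lattice line $i-j=\lfloor M(2N)^{2/3}\rfloor$). $\exp(a)$ is the exponential law with rate $a$. Stationary model with parameter $\rho\in(0,1)$: independent weights $\omega_{0,0}=0$, $\omega_{i,i}\sim\exp(\rho)$ and $\omega_{i,0}\sim\exp(1-\rho)$ for $i\ge1$, $\omega_{i,j}\sim\exp(1)$ for $0<j<i$. Point-to-point model with diagonal parameter $\rho$: independent weights $\omega_{0,0}=0$, $\omega_{i,i}\sim\exp(\rho)$ and $\omega_{i,0}=0$ for $i\ge1$, $\omega_{i,j}\sim\exp(1)$ for $0<j<i$. *)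

theory Defs
  imports "HOL-Probability.Probability"
begin

type_synonym site = "int \<times> int"

definition half_space :: "site set" where
  "half_space = {(i, j). 0 \<le> j \<and> j \<le> i}"

definition up_right_step :: "site \<Rightarrow> site \<Rightarrow> bool" where
  "up_right_step p q \<longleftrightarrow> q = (fst p + 1, snd p) \<or> q = (fst p, snd p + 1)"

text \<open>A path is the list of the sites it visits, in order.\<close>

definition half_space_paths :: "site \<Rightarrow> site list set" where
  "half_space_paths b =
     {\<pi>. \<pi> \<noteq> [] \<and> hd \<pi> = (0, 0) \<and> last \<pi> = b \<and>
          set \<pi> \<subseteq> half_space \<and> successively up_right_step \<pi>}"

definition path_weight :: "(site \<Rightarrow> real) \<Rightarrow> site list \<Rightarrow> real" where
  "path_weight \<omega> \<pi> = (\<Sum>p \<in> set \<pi> - {(0, 0)}. \<omega> p)"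

definition lpp :: "(site \<Rightarrow> real) \<Rightarrow> site \<Rightarrow> real" where
  "lpp \<omega> b = Max (path_weight \<omega> ` half_space_paths b)"

text \<open>The maximizer is almost surely unique in both models below. On the null event where
  it is not, the value is unspecified, but it depends on \<open>\<omega>\<close> only through the set of
  maximizers, so that events about the geodesic remain measurable.\<close>

definition geodesic :: "(site \<Rightarrow> real) \<Rightarrow> site \<Rightarrow> site list" where
  "geodesic \<omega> b = (THE \<pi>. \<pi> \<in> half_space_paths b \<and> path_weight \<omega> \<pi> = lpp \<omega> b)"

definition exp_law :: "real \<Rightarrow> real measure" where
  "exp_law a = density lborel (exponential_density a)"

text \<open>Marginal laws of the weights (meaningful for \<open>0 < \<rho> < 1\<close>); \<open>return borel 0\<close> is the
  law of a weight that equals 0. The models are the joint laws of the independent weights.\<close>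

definition stationary_law :: "real \<Rightarrow> site \<Rightarrow> real measure" where
  "stationary_law \<rho> = (\<lambda>(i, j).
     if (i, j) = (0, 0) then return borel 0
     else if i = j then exp_law \<rho>
     else if j = 0 then exp_law (1 - \<rho>)
     else exp_law 1)"

definition point_to_point_law :: "real \<Rightarrow> site \<Rightarrow> real measure" where
  "point_to_point_law \<rho> = (\<lambda>(i, j).
     if (i, j) = (0, 0) then return borel 0
     else if i = j then exp_law \<rho>
     else if j = 0 then return borel 0
     else exp_law 1)"

definition stationary_model :: "real \<Rightarrow> (site \<Rightarrow> real) measure" where
  "stationary_model \<rho> = Pi\<^sub>M half_space (stationary_law \<rho>)"

definition point_to_point_model :: "real \<Rightarrow> (site \<Rightarrow> real) measure" where
  "point_to_point_model \<rho> = Pi\<^sub>M half_space (point_to_point_law \<rho>)"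

definition critical_rho :: "real \<Rightarrow> nat \<Rightarrow> real" where
  "critical_rho \<kappa> N = 1 / 2 + \<kappa> * 2 powr (- 4 / 3) * real N powr (- 1 / 3)"

definition endpoint :: "real \<Rightarrow> nat \<Rightarrow> site" where
  "endpoint M\<^sub>1 N = (\<lfloor>real N + M\<^sub>1 * (2 * real N) powr (2 / 3)\<rfloor>,
                   \<lfloor>real N - M\<^sub>1 * (2 * real N) powr (2 / 3)\<rfloor>)"

definition diagonal_line :: "real \<Rightarrow> nat \<Rightarrow> site set" where
  "diagonal_line M N = {(i, j). i - j = \<lfloor>M * (2 * real N) powr (2 / 3)\<rfloor>}"

definition avoids :: "site \<Rightarrow> site set \<Rightarrow> (site \<Rightarrow> real) \<Rightarrow> bool" where
  "avoids b A \<omega> \<longleftrightarrow> set (geodesic \<omega> b) \<inter> A = {}"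

end

theory Submission
  imports Defs
begin

text \<open>
  All weights are coupled as multiples of one i.i.d. field. Exchanging the excursions of two paths
  shows that increasing the bottom row, decreasing the diagonal, and moving the end point to the right
  only push a geodesic to the right; this gives the first inequality. It also reduces the second one to
  last passage percolation on a full quadrant with bottom rate \<open>1/2 - 2\<delta>\<close>, where
  \<open>\<delta>\<close> is a small multiple of \<open>M N^(- 1/3)\<close>, and bulk rate 1: if there no
  maximal path touches the diagonal or crosses the line, neither does the half-space geodesic cross the
  line. Burke's theorem and an exponential tilt of the bottom row give a closed formula for one
  exponential moment of the passage time with two boundaries, hence upper tails, and (with a negative
  exponent) lower tails. A path that touches the diagonal or the line pays a parabolic cost of order
  \<open>M^2 N^(1/3)\<close> on its way to the end point. Ottaviani's maximal inequality makes this
  uniform in the touching point, and with tilts of order \<open>M N^(- 1/3)\<close> the error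
  probabilities are of order \<open>exp(- c M^3)\<close>.
\<close>

section \<open>Burke's theorem for one column of exponential weights\<close>

text \<open>The obstacle is that an exact exponential moment exists only for a model with weights on
  both axes whose rates match those of the interior. Upper bounds for any other rectangle come from
  embedding it as the interior of such a model. Lower bounds need one boundary to be isolated: the
  second boundary is made too light for its paths to reach the desired value, so that the paths
  along the first one have to reach it. Let \<open>\<mu>\<close> be the distance between diagonal
  and line, and \<open>y\<close> the height of the end point. The end point is moved to offset
  \<open>\<mu> div 2\<close>, halfway between the two, so that after touching either of them a path
  has an excess of order \<open>\<mu>\<close> steps in one direction and loses order
  \<open>\<mu>^2 / y\<close>. The heavier bottom row lets the piece before the touching point gain
  only order \<open>\<delta> * \<mu> + \<delta>^2 * y\<close>. Taking \<open>\<delta>\<close> a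
  small multiple of \<open>\<mu> / y\<close> keeps this gain a fraction of the loss, while
  \<open>\<delta>^3 * y\<close>, the exponent in the lower tail of the whole passage time, is still
  proportional to \<open>\<mu>^3 / y^2\<close>, hence of order \<open>M^3\<close>.\<close>

lemma sets_exp_law [measurable_cong, simp]: "sets (exp_law r) = sets borel"
  and space_exp_law [simp]: "space (exp_law r) = UNIV"
  by (simp_all add: exp_law_def)

lemma prob_space_exp_law: "0 < r \<Longrightarrow> prob_space (exp_law r)"
  unfolding exp_law_def by (rule prob_space_exponential_density)

lemma nn_integral_exp_law:
  assumes "f \<in> borel_measurable borel"
  shows "(\<integral>\<^sup>+x. f x \<partial>exp_law r) = (\<integral>\<^sup>+x. ennreal (exponential_density r x) * f x \<partial>lborel)"
  unfolding exp_law_def using assms by (intro nn_integral_density) auto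

lemma nn_integral_lborel_shift:
  fixes f :: "real \<Rightarrow> ennreal"
  assumes [measurable]: "f \<in> borel_measurable borel"
  shows "(\<integral>\<^sup>+x. f (x + c) \<partial>lborel) = (\<integral>\<^sup>+x. f x \<partial>lborel)"
  using nn_integral_real_affine[of f 1 c] by (simp add: add.commute)

text \<open>The density of \<open>x - y\<close> for independent \<open>x\<close> of rate \<open>b\<close> and \<open>y\<close> of rate \<open>a\<close>.\<close>

definition gap_density :: "real \<Rightarrow> real \<Rightarrow> real \<Rightarrow> ennreal" where
  "gap_density a b d = ennreal (a * b / (a + b) * (if 0 \<le> d then exp (- b * d) else exp (a * d)))"

lemma measurable_gap_density [measurable]: "gap_density a b \<in> borel_measurable borel"
  unfolding gap_density_def by measurable

text \<open>The minimum \<open>w\<close> and the difference \<open>d\<close> of two independent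
  exponentials are independent, \<open>w\<close> has rate \<open>a + b\<close>, and the arguments of
  \<open>g\<close> on the right recover the pair from \<open>w\<close> and \<open>d\<close>.\<close>

lemma nn_integral_exp_law_pair:
  fixes g :: "real \<times> real \<Rightarrow> ennreal"
  assumes a: "0 < a" and b: "0 < b" and [measurable]: "g \<in> borel_measurable borel"
  shows "(\<integral>\<^sup>+x. \<integral>\<^sup>+y. g (x, y) \<partial>exp_law a \<partial>exp_law b) =
    (\<integral>\<^sup>+w. \<integral>\<^sup>+d. gap_density a b d * g (w + max 0 d, w + max 0 (- d)) \<partial>lborel \<partial>exp_law (a + b))"
proof -
  define h :: "real \<times> real \<Rightarrow> ennreal" where
    "h = (\<lambda>(x, y). ennreal (exponential_density b x) * (ennreal (exponential_density a y) * g (x, y)))"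
  have [measurable]: "h \<in> borel_measurable borel"
    unfolding h_def borel_prod[symmetric] by measurable
  have [measurable]: "g \<in> borel_measurable (borel \<Otimes>\<^sub>M borel)" "h \<in> borel_measurable (borel \<Otimes>\<^sub>M borel)"
    by (simp_all add: borel_prod)
  have "(\<integral>\<^sup>+x. \<integral>\<^sup>+y. g (x, y) \<partial>exp_law a \<partial>exp_law b) = (\<integral>\<^sup>+x. \<integral>\<^sup>+y. h (x, y) \<partial>lborel \<partial>lborel)"
    by (simp add: nn_integral_exp_law h_def nn_integral_cmult)
  also have "\<dots> = (\<integral>\<^sup>+y. \<integral>\<^sup>+x. h (x, y) \<partial>lborel \<partial>lborel)"
    by (rule lborel_pair.Fubini') simp
  also have "\<dots> = (\<integral>\<^sup>+y. \<integral>\<^sup>+d. h (d + y, y) \<partial>lborel \<partial>lborel)"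
    by (intro nn_integral_cong nn_integral_lborel_shift[symmetric]) measurable
  also have "\<dots> = (\<integral>\<^sup>+d. \<integral>\<^sup>+y. h (d + y, y) \<partial>lborel \<partial>lborel)"
    by (rule lborel_pair.Fubini') simp
  also have "\<dots> = (\<integral>\<^sup>+d. \<integral>\<^sup>+w. h (w + max 0 d, w + max 0 (- d)) \<partial>lborel \<partial>lborel)"
  proof (rule nn_integral_cong)
    \<comment> \<open>For a fixed difference, the shift by \<open>max 0 (- d)\<close> makes the
      integration variable the minimum of the pair.\<close>
    fix d :: real
    have "(\<integral>\<^sup>+y. h (d + (y + max 0 (- d)), y + max 0 (- d)) \<partial>lborel) = (\<integral>\<^sup>+y. h (d + y, y) \<partial>lborel)"
      by (rule nn_integral_lborel_shift) measurable
    moreover have "d + (y + max 0 (- d)) = y + max 0 d" for y :: real by auto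
    ultimately show "(\<integral>\<^sup>+y. h (d + y, y) \<partial>lborel) = (\<integral>\<^sup>+w. h (w + max 0 d, w + max 0 (- d)) \<partial>lborel)"
      by simp
  qed
  also have "\<dots> = (\<integral>\<^sup>+d. \<integral>\<^sup>+w. ennreal (exponential_density (a + b) w) * (gap_density a b d * g (w + max 0 d, w + max 0 (- d))) \<partial>lborel \<partial>lborel)"
  proof (intro nn_integral_cong)
    fix d w :: real
    have "exponential_density b (w + max 0 d) * exponential_density a (w + max 0 (- d)) =
      exponential_density (a + b) w * (a * b / (a + b) * (if 0 \<le> d then exp (- b * d) else exp (a * d)))"
      using a b by (auto simp: exponential_density_def max_def field_simps mult_exp_exp exp_minus)
    then show "h (w + max 0 d, w + max 0 (- d)) = ennreal (exponential_density (a + b) w) * (gap_density a b d * g (w + max 0 d, w + max 0 (- d)))"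
      unfolding h_def gap_density_def using a b
      by (simp add: mult.assoc[symmetric] ennreal_mult[symmetric] exponential_density_nonneg del: times_divide_eq_right)
  qed
  also have "\<dots> = (\<integral>\<^sup>+w. \<integral>\<^sup>+d. ennreal (exponential_density (a + b) w) * (gap_density a b d * g (w + max 0 d, w + max 0 (- d))) \<partial>lborel \<partial>lborel)"
    by (rule lborel_pair.Fubini') measurable
  also have "\<dots> = (\<integral>\<^sup>+w. \<integral>\<^sup>+d. gap_density a b d * g (w + max 0 d, w + max 0 (- d)) \<partial>lborel \<partial>exp_law (a + b))"
    by (subst nn_integral_exp_law, measurable) (simp add: nn_integral_cmult)
  finally show ?thesis .
qed

text \<open>Burke's property at one site: the outgoing increments keep the difference of the
  incoming ones and replace their minimum by the fresh weight, which has the law of the minimum and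
  is independent of the difference.\<close>

lemma burke_site:
  fixes g :: "real \<times> real \<Rightarrow> ennreal"
  assumes a: "0 < a" and b: "0 < b" and [measurable]: "g \<in> borel_measurable borel"
  shows "(\<integral>\<^sup>+x. \<integral>\<^sup>+y. \<integral>\<^sup>+w. g (w + max 0 (x - y), w + max 0 (y - x)) \<partial>exp_law (a + b) \<partial>exp_law a \<partial>exp_law b) =
    (\<integral>\<^sup>+x. \<integral>\<^sup>+y. g (x, y) \<partial>exp_law a \<partial>exp_law b)"
proof -
  interpret E: prob_space "exp_law (a + b)" using a b by (intro prob_space_exp_law) auto
  interpret P: pair_sigma_finite lborel "exp_law (a + b)" ..
  have [measurable]: "g \<in> borel_measurable (borel \<Otimes>\<^sub>M borel)"
    by (simp add: borel_prod)
  define G where "G = (\<lambda>(x, y). \<integral>\<^sup>+w. g (w + max 0 (x - y), w + max 0 (y - x)) \<partial>exp_law (a + b))"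
  have [measurable]: "G \<in> borel_measurable borel"
    unfolding G_def borel_prod[symmetric] by measurable
  have "(\<integral>\<^sup>+x. \<integral>\<^sup>+y. G (x, y) \<partial>exp_law a \<partial>exp_law b) =
     (\<integral>\<^sup>+w. \<integral>\<^sup>+d. gap_density a b d * G (w + max 0 d, w + max 0 (- d)) \<partial>lborel \<partial>exp_law (a + b))"
    by (rule nn_integral_exp_law_pair) (use a b in auto)
  also have "\<dots> = (\<integral>\<^sup>+w. \<integral>\<^sup>+d. gap_density a b d * (\<integral>\<^sup>+w. g (w + max 0 d, w + max 0 (- d)) \<partial>exp_law (a + b)) \<partial>lborel \<partial>exp_law (a + b))"
  proof -
    have "w + max 0 d - (w + max 0 (- d)) = d" "w + max 0 (- d) - (w + max 0 d) = - d" for w d :: real by auto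
    then show ?thesis by (simp add: G_def)
  qed
  also have "\<dots> = (\<integral>\<^sup>+d. gap_density a b d * (\<integral>\<^sup>+w. g (w + max 0 d, w + max 0 (- d)) \<partial>exp_law (a + b)) \<partial>lborel)"
    using E.emeasure_space_1 by simp
  also have "\<dots> = (\<integral>\<^sup>+d. \<integral>\<^sup>+w. gap_density a b d * g (w + max 0 d, w + max 0 (- d)) \<partial>exp_law (a + b) \<partial>lborel)"
    by (intro nn_integral_cong nn_integral_cmult[symmetric]) measurable
  also have "\<dots> = (\<integral>\<^sup>+w. \<integral>\<^sup>+d. gap_density a b d * g (w + max 0 d, w + max 0 (- d)) \<partial>lborel \<partial>exp_law (a + b))"
    by (rule P.Fubini'[symmetric]) measurable
  also have "\<dots> = (\<integral>\<^sup>+x. \<integral>\<^sup>+y. g (x, y) \<partial>exp_law a \<partial>exp_law b)"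
    by (rule nn_integral_exp_law_pair[symmetric]) (use a b in auto)
  finally show ?thesis by (simp add: G_def)
qed

lemma nn_integral_exp_law_tilt:
  assumes "0 < r" "t < r" and [measurable]: "f \<in> borel_measurable borel"
  shows "(\<integral>\<^sup>+x. ennreal (exp (t * x)) * f x \<partial>exp_law r) = ennreal (r / (r - t)) * (\<integral>\<^sup>+x. f x \<partial>exp_law (r - t))"
proof -
  have "(\<integral>\<^sup>+x. ennreal (exp (t * x)) * f x \<partial>exp_law r) =
    (\<integral>\<^sup>+x. ennreal (exponential_density r x) * (ennreal (exp (t * x)) * f x) \<partial>lborel)"
    by (rule nn_integral_exp_law) measurable
  also have "\<dots> = (\<integral>\<^sup>+x. ennreal (r / (r - t)) * (ennreal (exponential_density (r - t) x) * f x) \<partial>lborel)"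
  proof (intro nn_integral_cong)
    fix x
    have "exponential_density r x * exp (t * x) = r / (r - t) * exponential_density (r - t) x"
      using assms by (auto simp: exponential_density_def mult_exp_exp field_simps)
    then show "ennreal (exponential_density r x) * (ennreal (exp (t * x)) * f x) =
       ennreal (r / (r - t)) * (ennreal (exponential_density (r - t) x) * f x)"
      using assms
      by (simp add: mult.assoc[symmetric] ennreal_mult[symmetric] exponential_density_nonneg del: times_divide_eq_left)
  qed
  also have "\<dots> = ennreal (r / (r - t)) * (\<integral>\<^sup>+x. f x \<partial>exp_law (r - t))"
    by (subst nn_integral_cmult, measurable) (simp add: nn_integral_exp_law)
  finally show ?thesis .
qed

text \<open>For a nonpositive rate the density is nonpositive and the measure is null; covering this
  case frees the interpretation below from side conditions on \<open>r\<close>.\<close>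

lemma sigma_finite_exp_law: "sigma_finite_measure (exp_law r)"
proof (cases "0 < r")
  case True
  then interpret prob_space "exp_law r" by (rule prob_space_exp_law)
  show ?thesis by unfold_locales
next
  case False
  then have "exponential_density r x \<le> 0" for x
    by (auto simp: exponential_density_def mult_le_0_iff)
  then have "(\<lambda>x. ennreal (exponential_density r x)) = (\<lambda>x. 0)"
    by (simp add: ennreal_neg)
  then have "emeasure (exp_law r) UNIV = 0"
    by (simp add: exp_law_def emeasure_density)
  then interpret finite_measure "exp_law r"
    by (intro finite_measureI) simp
  show ?thesis by unfold_locales
qed

interpretation exp_law: sigma_finite_measure "exp_law r" for r
  by (rule sigma_finite_exp_law)

text \<open>The horizontal increments into a column with weights \<open>c\<close>, starting with \<open>x\<close>, and its vertical
  increments, when the previous column has the vertical increments \<open>v\<close>.\<close>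

primrec icol :: "real \<Rightarrow> (nat \<Rightarrow> real) \<Rightarrow> (nat \<Rightarrow> real) \<Rightarrow> nat \<Rightarrow> real" where
  "icol x v c 0 = x"
| "icol x v c (Suc j) = c (Suc j) + max 0 (icol x v c j - v (Suc j))"

definition jcol :: "real \<Rightarrow> (nat \<Rightarrow> real) \<Rightarrow> (nat \<Rightarrow> real) \<Rightarrow> nat \<Rightarrow> real" where
  "jcol x v c j = c j + max 0 (v j - icol x v c (j - 1))"

lemma icol_cong:
  assumes "\<And>i. 1 \<le> i \<Longrightarrow> i \<le> j \<Longrightarrow> v i = v' i" "\<And>i. 1 \<le> i \<Longrightarrow> i \<le> j \<Longrightarrow> c i = c' i"
  shows "icol x v c j = icol x v' c' j"
  using assms by (induction j) auto

lemma jcol_cong: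
  assumes "\<And>i. 1 \<le> i \<Longrightarrow> i \<le> j \<Longrightarrow> v i = v' i" "\<And>i. 1 \<le> i \<Longrightarrow> i \<le> j \<Longrightarrow> c i = c' i" "1 \<le> j"
  shows "jcol x v c j = jcol x v' c' j"
  using assms icol_cong[of "j - 1" v v' c c' x] by (auto simp: jcol_def)

abbreviation borel_vec :: "nat \<Rightarrow> (nat \<Rightarrow> real) measure" where
  "borel_vec n \<equiv> Pi\<^sub>M {1..n} (\<lambda>_. borel)"

abbreviation exp_vec :: "(nat \<Rightarrow> real) \<Rightarrow> nat \<Rightarrow> (nat \<Rightarrow> real) measure" where
  "exp_vec r n \<equiv> Pi\<^sub>M {1..n} (\<lambda>j. exp_law (r j))"

lemma sets_exp_vec [measurable_cong]: "sets (exp_vec r n) = sets (borel_vec n)"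
  by (intro sets_PiM_cong) auto

lemma sigma_finite_exp_vec: "sigma_finite_measure (exp_vec r n)"
proof -
  interpret product_sigma_finite "\<lambda>j. exp_law (r j)" by unfold_locales
  show ?thesis by (rule sigma_finite) simp
qed

lemma measurable_icol [measurable (raw)]:
  assumes [measurable]: "f \<in> borel_measurable N" "v \<in> measurable N (borel_vec n)" "c \<in> measurable N (borel_vec n)" and "k \<le> n"
  shows "(\<lambda>x. icol (f x) (v x) (c x) k) \<in> borel_measurable N"
  using assms(4)
proof (induction k)
  case (Suc k)
  have [measurable]: "(\<lambda>x. icol (f x) (v x) (c x) k) \<in> borel_measurable N" using Suc by auto
  have [measurable]: "(\<lambda>x. v x (Suc k)) \<in> borel_measurable N" "(\<lambda>x. c x (Suc k)) \<in> borel_measurable N"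
    using Suc.prems by auto
  show ?case by simp
qed simp

lemma measurable_restrict_jcol [measurable (raw)]:
  assumes [measurable]: "f \<in> borel_measurable N" "v \<in> measurable N (borel_vec n)" "c \<in> measurable N (borel_vec n)"
  shows "(\<lambda>x. \<lambda>j\<in>{1..n}. jcol (f x) (v x) (c x) j) \<in> measurable N (borel_vec n)"
proof (rule measurable_restrict)
  fix j assume j: "j \<in> {1..n}"
  have [measurable]: "(\<lambda>x. icol (f x) (v x) (c x) (j - 1)) \<in> borel_measurable N"
    by (rule measurable_icol[OF assms]) (use j in auto)
  show "(\<lambda>x. jcol (f x) (v x) (c x) j) \<in> borel_measurable N"
    using j unfolding jcol_def by measurable
qed

lemma nn_integral_exp_vec_Suc:
  assumes [measurable]: "f \<in> borel_measurable (borel_vec (Suc n))"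
  shows "(\<integral>\<^sup>+v. f v \<partial>exp_vec r (Suc n)) = (\<integral>\<^sup>+v. \<integral>\<^sup>+x. f (v(Suc n := x)) \<partial>exp_law (r (Suc n)) \<partial>exp_vec r n)"
proof -
  interpret product_sigma_finite "\<lambda>j. exp_law (r j)" by unfold_locales
  have eq: "{1..Suc n} = insert (Suc n) {1..n}" by auto
  have "f \<in> borel_measurable (exp_vec r (Suc n))" by measurable
  then show ?thesis unfolding eq
    by (intro product_nn_integral_insert) auto
qed

lemma measurable_upd_Suc [measurable (raw)]:
  assumes "f \<in> measurable N (borel_vec n)" "g \<in> borel_measurable N"
  shows "(\<lambda>x. (f x)(Suc n := g x)) \<in> measurable N (borel_vec (Suc n))"
  by (rule measurable_fun_upd[OF _ assms]) auto

lemma restrict_jcol_upd: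
  "(\<lambda>j\<in>{1..Suc n}. jcol x (v(Suc n := y)) (c(Suc n := w)) j) =
   (\<lambda>j\<in>{1..n}. jcol x v c j)(Suc n := w + max 0 (y - icol x v c n))"
proof
  fix j
  have 1: "icol x (v(Suc n := y)) (c(Suc n := w)) n = icol x v c n"
    by (rule icol_cong) auto
  have 2: "jcol x (v(Suc n := y)) (c(Suc n := w)) j = jcol x v c j" if "1 \<le> j" "j \<le> n"
    by (rule jcol_cong) (use that in auto)
  show "(\<lambda>j\<in>{1..Suc n}. jcol x (v(Suc n := y)) (c(Suc n := w)) j) j =
   ((\<lambda>j\<in>{1..n}. jcol x v c j)(Suc n := w + max 0 (y - icol x v c n))) j"
    using 1 2 by (auto simp: jcol_def restrict_def)
qed

lemma icol_upd_Suc: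
  "icol x (v(Suc n := y)) (c(Suc n := w)) (Suc n) = w + max 0 (icol x v c n - y)"
  using icol_cong[of n "v(Suc n := y)" v "c(Suc n := w)" c x] by simp

text \<open>Going up the column, each site consumes one horizontal and one vertical increment and
  emits a pair with the same law, so the output is again a family of independent exponentials. The
  rates may vary with the row because each site only needs its own sum
  \<open>r j + b\<close>.\<close>

lemma burke_column:
  assumes b: "0 < b" and r: "\<And>j. 1 \<le> j \<Longrightarrow> j \<le> n \<Longrightarrow> 0 < r j"
    and F[measurable]: "F \<in> borel_measurable (borel \<Otimes>\<^sub>M borel_vec n)"
  shows "(\<integral>\<^sup>+x. \<integral>\<^sup>+v. \<integral>\<^sup>+c. F (icol x v c n, \<lambda>j\<in>{1..n}. jcol x v c j)
      \<partial>exp_vec (\<lambda>j. r j + b) n \<partial>exp_vec r n \<partial>exp_law b) = (\<integral>\<^sup>+x. \<integral>\<^sup>+v. F (x, v) \<partial>exp_vec r n \<partial>exp_law b)"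
  using r F
proof (induction n arbitrary: F)
  case 0
  interpret P: product_sigma_finite "\<lambda>j. exp_law (r j)" by unfold_locales
  interpret P': product_sigma_finite "\<lambda>j. exp_law (r j + b)" by unfold_locales
  show ?case
    by (simp add: PiM_empty nn_integral_count_space_finite restrict_def)
next
  case (Suc n)
  note [measurable] = Suc.prems(2)
  let ?c = "\<lambda>j. r j + b"
  let ?S = "Suc n"
  let ?I = "\<lambda>x v y c. \<integral>\<^sup>+w. F (w + max 0 (icol x v c n - y), (\<lambda>j\<in>{1..n}. jcol x v c j)(?S := w + max 0 (y - icol x v c n)))
      \<partial>exp_law (?c ?S)"
  interpret A: sigma_finite_measure "exp_vec r n" by (rule sigma_finite_exp_vec)
  interpret C: sigma_finite_measure "exp_vec ?c n" by (rule sigma_finite_exp_vec)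
  interpret CS: sigma_finite_measure "exp_vec ?c ?S" by (rule sigma_finite_exp_vec)
  interpret CX: pair_sigma_finite "exp_vec ?c n" "exp_law (r ?S)" ..
  interpret XA: pair_sigma_finite "exp_law b" "exp_vec r n" ..
  let ?G = "\<lambda>x v c. F (icol x v c ?S, \<lambda>j\<in>{1..?S}. jcol x v c j)"
  \<comment> \<open>\<open>\<Phi>\<close> integrates out the top site, so that the induction
    hypothesis treats the sites below it and \<open>burke_site\<close> the top one.\<close>
  define \<Phi> where "\<Phi> = (\<lambda>(i, u). \<integral>\<^sup>+y. \<integral>\<^sup>+w. F (w + max 0 (i - y), u(?S := w + max 0 (y - i))) \<partial>exp_law (?c ?S) \<partial>exp_law (r ?S))"
  have \<Phi>_m[measurable]: "\<Phi> \<in> borel_measurable (borel \<Otimes>\<^sub>M borel_vec n)"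
    unfolding \<Phi>_def by measurable
  have "(\<integral>\<^sup>+x. \<integral>\<^sup>+v. \<integral>\<^sup>+c. ?G x v c
      \<partial>exp_vec ?c ?S \<partial>exp_vec r ?S \<partial>exp_law b) =
    (\<integral>\<^sup>+x. \<integral>\<^sup>+v. \<integral>\<^sup>+y. \<integral>\<^sup>+c. ?I x v y c \<partial>exp_vec ?c n \<partial>exp_law (r ?S) \<partial>exp_vec r n \<partial>exp_law b)"
  proof (rule nn_integral_cong)
    fix x
    have "(\<integral>\<^sup>+v. \<integral>\<^sup>+c. ?G x v c \<partial>exp_vec ?c ?S \<partial>exp_vec r ?S) =
      (\<integral>\<^sup>+v. \<integral>\<^sup>+y. \<integral>\<^sup>+c. ?G x (v(?S := y)) c
        \<partial>exp_vec ?c ?S \<partial>exp_law (r ?S) \<partial>exp_vec r n)"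
      by (rule nn_integral_exp_vec_Suc) measurable
    also have "\<dots> = (\<integral>\<^sup>+v. \<integral>\<^sup>+y. \<integral>\<^sup>+c. ?I x v y c \<partial>exp_vec ?c n \<partial>exp_law (r ?S) \<partial>exp_vec r n)"
    proof (rule nn_integral_cong, rule nn_integral_cong)
      fix v y assume "v \<in> space (exp_vec r n)"
      then have [measurable]: "v \<in> space (borel_vec n)" by (simp add: space_PiM)
      have "(\<integral>\<^sup>+c. ?G x (v(?S := y)) c \<partial>exp_vec ?c ?S) =
        (\<integral>\<^sup>+c. \<integral>\<^sup>+w. ?G x (v(?S := y)) (c(?S := w))
          \<partial>exp_law (?c ?S) \<partial>exp_vec ?c n)"
        by (rule nn_integral_exp_vec_Suc) measurable
      then show "(\<integral>\<^sup>+c. ?G x (v(?S := y)) c \<partial>exp_vec ?c ?S) =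
        (\<integral>\<^sup>+c. ?I x v y c \<partial>exp_vec ?c n)"
        unfolding icol_upd_Suc restrict_jcol_upd .
    qed
    finally show "(\<integral>\<^sup>+v. \<integral>\<^sup>+c. ?G x v c \<partial>exp_vec ?c ?S \<partial>exp_vec r ?S) =
      (\<integral>\<^sup>+v. \<integral>\<^sup>+y. \<integral>\<^sup>+c. ?I x v y c \<partial>exp_vec ?c n \<partial>exp_law (r ?S) \<partial>exp_vec r n)" .
  qed
  also have "\<dots> = (\<integral>\<^sup>+x. \<integral>\<^sup>+v. \<integral>\<^sup>+c. \<Phi> (icol x v c n, \<lambda>j\<in>{1..n}. jcol x v c j) \<partial>exp_vec ?c n \<partial>exp_vec r n \<partial>exp_law b)"
    unfolding \<Phi>_def prod.case
  proof (rule nn_integral_cong, rule nn_integral_cong)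
    fix x v assume "v \<in> space (exp_vec r n)"
    then have [measurable]: "v \<in> space (borel_vec n)" by (simp add: space_PiM)
    show "(\<integral>\<^sup>+y. \<integral>\<^sup>+c. ?I x v y c \<partial>exp_vec ?c n \<partial>exp_law (r ?S)) =
      (\<integral>\<^sup>+c. \<integral>\<^sup>+y. ?I x v y c \<partial>exp_law (r ?S) \<partial>exp_vec ?c n)"
      by (rule CX.Fubini') measurable
  qed
  also have "\<dots> = (\<integral>\<^sup>+x. \<integral>\<^sup>+v. \<Phi> (x, v) \<partial>exp_vec r n \<partial>exp_law b)"
    by (rule Suc.IH[OF _ \<Phi>_m]) (use Suc.prems(1) in auto)
  also have "\<dots> = (\<integral>\<^sup>+v. \<integral>\<^sup>+x. \<Phi> (x, v) \<partial>exp_law b \<partial>exp_vec r n)"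
    by (rule XA.Fubini'[symmetric]) measurable
  also have "\<dots> = (\<integral>\<^sup>+v. \<integral>\<^sup>+x. \<integral>\<^sup>+y. F (x, v(?S := y)) \<partial>exp_law (r ?S) \<partial>exp_law b \<partial>exp_vec r n)"
  proof (rule nn_integral_cong)
    fix v assume "v \<in> space (exp_vec r n)"
    then have [measurable]: "v \<in> space (borel_vec n)" by (simp add: space_PiM)
    show "(\<integral>\<^sup>+x. \<Phi> (x, v) \<partial>exp_law b) = (\<integral>\<^sup>+x. \<integral>\<^sup>+y. F (x, v(?S := y)) \<partial>exp_law (r ?S) \<partial>exp_law b)"
      using burke_site[of "r ?S" b "\<lambda>(x, y). F (x, v(?S := y))"] Suc.prems(1)[of ?S] b
      by (simp add: \<Phi>_def borel_prod[symmetric])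
  qed
  also have "\<dots> = (\<integral>\<^sup>+x. \<integral>\<^sup>+v. \<integral>\<^sup>+y. F (x, v(?S := y)) \<partial>exp_law (r ?S) \<partial>exp_vec r n \<partial>exp_law b)"
    by (rule XA.Fubini') measurable
  also have "\<dots> = (\<integral>\<^sup>+x. \<integral>\<^sup>+v. F (x, v) \<partial>exp_vec r ?S \<partial>exp_law b)"
    by (intro nn_integral_cong nn_integral_exp_vec_Suc[symmetric]) measurable
  finally show ?case .
qed

section \<open>Passage times and their exponential moments\<close>

fun passage :: "(nat \<Rightarrow> nat \<Rightarrow> real) \<Rightarrow> nat \<Rightarrow> nat \<Rightarrow> real" where
  "passage w 0 0 = w 0 0"
| "passage w (Suc m) 0 = passage w m 0 + w (Suc m) 0"
| "passage w 0 (Suc n) = passage w 0 n + w 0 (Suc n)"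
| "passage w (Suc m) (Suc n) = max (passage w m (Suc n)) (passage w (Suc m) n) + w (Suc m) (Suc n)"

lemma passage_cong:
  assumes "\<And>i j. i \<le> m \<Longrightarrow> j \<le> n \<Longrightarrow> w i j = w' i j"
  shows "passage w m n = passage w' m n"
  using assms by (induction w m n rule: passage.induct) auto

lemma measurable_passage:
  assumes "\<And>i j. i \<le> m \<Longrightarrow> j \<le> n \<Longrightarrow> (\<lambda>x. w x i j) \<in> borel_measurable N"
  shows "(\<lambda>x. passage (w x) m n) \<in> borel_measurable N"
  using assms
  by (induction "undefined :: nat \<Rightarrow> nat \<Rightarrow> real" m n rule: passage.induct)
    (auto intro!: borel_measurable_add borel_measurable_max)

definition vinc :: "(nat \<Rightarrow> nat \<Rightarrow> real) \<Rightarrow> nat \<Rightarrow> nat \<Rightarrow> real" where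
  "vinc w x j = passage w x j - passage w x (j - 1)"

text \<open>The recursions of the increments are the last passage recursion rewritten with
  \<open>max a b - a = max 0 (b - a)\<close>.\<close>

lemma icol_vinc: "icol (w (Suc x) 0) (vinc w x) (w (Suc x)) j = passage w (Suc x) j - passage w x j"
  by (induction j) (auto simp: vinc_def)

lemma jcol_vinc: "1 \<le> j \<Longrightarrow> jcol (w (Suc x) 0) (vinc w x) (w (Suc x)) j = vinc w (Suc x) j"
  unfolding jcol_def icol_vinc by (cases j) (auto simp: vinc_def)

lemma passage_eq_sum_vinc: "passage w x n = passage w x 0 + (\<Sum>j=1..n. vinc w x j)"
  by (induction n) (auto simp: vinc_def)

text \<open>Weights are random variables on an arbitrary space rather than coordinates of a product,
  so that many rescaled, shifted and reflected families can be read off one common field.\<close>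

definition exp_family :: "'a measure \<Rightarrow> ('i \<Rightarrow> 'a \<Rightarrow> real) \<Rightarrow> ('i \<Rightarrow> real) \<Rightarrow> 'i set \<Rightarrow> bool" where
  "exp_family M X c K \<longleftrightarrow> prob_space M \<and> prob_space.indep_vars M (\<lambda>_. borel) X K \<and>
     (\<forall>p\<in>K. 0 < c p \<and> distr M borel (X p) = exp_law (c p))"

context prob_space begin

lemma indep_vars_reindex:
  assumes "indep_vars (\<lambda>_. N) X K" "inj_on f L" "f ` L \<subseteq> K"
  shows "indep_vars (\<lambda>_. N) (\<lambda>l. X (f l)) L"
proof -
  have "indep_vars (\<lambda>l. Pi\<^sub>M {f l} (\<lambda>_. N)) (\<lambda>l \<omega>. restrict (\<lambda>i. X i \<omega>) {f l}) L"
    using assms by (intro indep_vars_restrict[OF assms(1)]) (auto simp: disjoint_family_on_def inj_on_def)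
  then have "indep_vars (\<lambda>_. N) (\<lambda>l \<omega>. (restrict (\<lambda>i. X i \<omega>) {f l}) (f l)) L"
    by (rule indep_vars_compose2) auto
  then show ?thesis by simp
qed

lemma distr_family:
  assumes "indep_vars (\<lambda>_. N) X K" "\<And>k. k \<in> K \<Longrightarrow> distr M N (X k) = L k"
  shows "distr M (Pi\<^sub>M K (\<lambda>_. N)) (\<lambda>\<omega>. \<lambda>k\<in>K. X k \<omega>) = Pi\<^sub>M K L"
proof (cases "K = {}")
  case True
  have "(\<lambda>\<omega>. \<lambda>k\<in>{}. X k \<omega>) = (\<lambda>\<omega>. \<lambda>_. undefined)" by (auto simp: restrict_def)
  then show ?thesis
    by (intro measure_eqI) (auto simp: True PiM_empty emeasure_distr emeasure_space_1 subset_singleton_iff vimage_def)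
next
  case False
  have "distr M (Pi\<^sub>M K (\<lambda>_. N)) (\<lambda>\<omega>. \<lambda>k\<in>K. X k \<omega>) = Pi\<^sub>M K (\<lambda>k. distr M N (X k))"
    using assms(1) False by (subst indep_vars_iff_distr_eq_PiM'[symmetric]) (auto simp: indep_vars_def)
  also have "\<dots> = Pi\<^sub>M K L"
    using assms(2) by (intro PiM_cong) auto
  finally show ?thesis .
qed

lemma nn_integral_indep_var:
  assumes ind: "indep_var S U T V" and [measurable]: "h \<in> borel_measurable (S \<Otimes>\<^sub>M T)"
  shows "(\<integral>\<^sup>+\<omega>. h (U \<omega>, V \<omega>) \<partial>M) = (\<integral>\<^sup>+\<omega>. \<integral>\<^sup>+v. h (U \<omega>, v) \<partial>distr M T V \<partial>M)"
proof -
  from ind have [measurable]: "U \<in> measurable M S" "V \<in> measurable M T"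
    by (auto dest: indep_var_rv1 indep_var_rv2)
  interpret V: prob_space "distr M T V" by (rule prob_space_distr) simp
  have "(\<integral>\<^sup>+\<omega>. h (U \<omega>, V \<omega>) \<partial>M) = (\<integral>\<^sup>+z. h z \<partial>distr M (S \<Otimes>\<^sub>M T) (\<lambda>\<omega>. (U \<omega>, V \<omega>)))"
    by (simp add: nn_integral_distr)
  also have "\<dots> = (\<integral>\<^sup>+z. h z \<partial>(distr M S U \<Otimes>\<^sub>M distr M T V))"
    using ind by (simp add: indep_var_distribution_eq)
  also have "\<dots> = (\<integral>\<^sup>+u. \<integral>\<^sup>+v. h (u, v) \<partial>distr M T V \<partial>distr M S U)"
    by (rule V.nn_integral_fst[symmetric]) measurable
  also have "\<dots> = (\<integral>\<^sup>+\<omega>. \<integral>\<^sup>+v. h (U \<omega>, v) \<partial>distr M T V \<partial>M)"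
    by (subst nn_integral_distr) auto
  finally show ?thesis .
qed

end

definition zero_corner :: "(nat \<Rightarrow> nat \<Rightarrow> real) \<Rightarrow> nat \<Rightarrow> nat \<Rightarrow> real" where
  "zero_corner w i j = (if i = 0 \<and> j = 0 then 0 else w i j)"

text \<open>Tilting the bottom row turns its rate \<open>b\<close> into \<open>b - t\<close>, and
  the interior rates are matched to the tilted rate instead of to \<open>b\<close>. Under the tilt
  Burke's theorem therefore applies: the vertical increments keep their law from column to column,
  and each column contributes the normalizing factor \<open>b / (b - t)\<close>.\<close>

lemma stationary_column:
  fixes X :: "nat \<times> nat \<Rightarrow> 'a \<Rightarrow> real"
  assumes X: "exp_family M X (\<lambda>(i, j). if j = 0 then b else if i = 0 then r j else r j + (b - t)) ({..m} \<times> {..n})"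
    and t: "t < b"
  defines "w \<equiv> \<lambda>\<omega>. zero_corner (\<lambda>i j. X (i, j) \<omega>)"
  assumes x: "x \<le> m" and F[measurable]: "F \<in> borel_measurable (borel_vec n)"
  shows "(\<integral>\<^sup>+\<omega>. ennreal (exp (t * passage (w \<omega>) x 0)) * F (\<lambda>j\<in>{1..n}. vinc (w \<omega>) x j) \<partial>M) =
    ennreal ((b / (b - t)) ^ x) * (\<integral>\<^sup>+v. F v \<partial>exp_vec r n)"
  using x F
proof (induction x arbitrary: F)
  case 0
  interpret prob_space M using X by (simp add: exp_family_def)
  note [measurable] = 0(2)
  let ?Z = "\<lambda>\<omega>. \<lambda>j\<in>{1..n}. X (0, j) \<omega>"
  have eq: "(\<lambda>j\<in>{1..n}. vinc (w \<omega>) 0 j) = ?Z \<omega>" for \<omega>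
  proof -
    have "vinc (w \<omega>) 0 j = X (0, j) \<omega>" if "1 \<le> j" for j
      using that by (cases j) (auto simp: vinc_def w_def zero_corner_def)
    then show ?thesis by (auto simp: restrict_def)
  qed
  have ind': "indep_vars (\<lambda>_. borel) (\<lambda>j. X (0, j)) {1..n}"
    by (rule indep_vars_reindex[of borel X "{..m} \<times> {..n}"]) (use X in \<open>auto simp: exp_family_def inj_on_def\<close>)
  have [measurable]: "?Z \<in> measurable M (borel_vec n)"
    using ind' by (intro measurable_restrict) (auto simp: indep_vars_def)
  have "(\<integral>\<^sup>+v. F v \<partial>exp_vec r n) = (\<integral>\<^sup>+v. F v \<partial>distr M (borel_vec n) ?Z)"
    by (subst distr_family[OF ind', of "\<lambda>j. exp_law (r j)"]) (use X in \<open>auto simp: exp_family_def\<close>)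
  also have "\<dots> = (\<integral>\<^sup>+\<omega>. F (?Z \<omega>) \<partial>M)"
    by (rule nn_integral_distr) measurable
  finally have *: "(\<integral>\<^sup>+v. F v \<partial>exp_vec r n) = (\<integral>\<^sup>+\<omega>. F (?Z \<omega>) \<partial>M)" .
  have "passage (w \<omega>) 0 0 = 0" for \<omega> by (simp add: w_def zero_corner_def)
  then show ?case
    unfolding eq * by (simp del: restrict_apply)
next
  case (Suc x)
  interpret prob_space M using X by (simp add: exp_family_def)
  note [measurable] = Suc.prems(2)
  have b: "0 < b" and r: "\<And>j. 1 \<le> j \<Longrightarrow> j \<le> n \<Longrightarrow> 0 < r j"
    using X by (force simp: exp_family_def)+
  have ind: "indep_vars (\<lambda>_. borel) X ({..m} \<times> {..n})" using X by (simp add: exp_family_def)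
  let ?C = "exp_vec (\<lambda>j. r j + (b - t)) n"
  let ?v = "\<lambda>x \<omega>. \<lambda>j\<in>{1..n}. vinc (w \<omega>) x j" and ?J = "\<lambda>i v c. \<lambda>j\<in>{1..n}. jcol i v c j"
  let ?A = "{..x} \<times> {..n}" and ?B = "{Suc x} \<times> {..n}" and ?L = "Pi\<^sub>M {..n} (\<lambda>_. borel :: real measure)"
  define W :: "(nat \<times> nat \<Rightarrow> real) \<Rightarrow> nat \<Rightarrow> nat \<Rightarrow> real" where "W = (\<lambda>y. zero_corner (\<lambda>i j. y (i, j)))"
  \<comment> \<open>Coordinate 0 holds the passage time along the bottom row and the coordinates
    \<open>1..n\<close> hold the vertical increments; \<open>fB\<close> stores the weights of the
    next column in the same format.\<close>
  define fA where "fA = (\<lambda>y. \<lambda>j\<in>{..n}. if j = 0 then passage (W y) x 0 else vinc (W y) x j)"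
  define fB where "fB = (\<lambda>y :: nat \<times> nat \<Rightarrow> real. \<lambda>j\<in>{..n}. y (Suc x, j))"
  have [measurable]: "(\<lambda>y. passage (W y) x j) \<in> borel_measurable (Pi\<^sub>M ?A (\<lambda>_. borel))" if "j \<le> n" for j
    unfolding W_def
  proof (rule measurable_passage)
    fix i k assume "i \<le> x" "k \<le> j"
    then show "(\<lambda>y. zero_corner (\<lambda>i j. y (i, j)) i k) \<in> borel_measurable (Pi\<^sub>M ?A (\<lambda>_. borel))"
      using that unfolding zero_corner_def
      by (cases "i = 0 \<and> k = 0") (auto intro!: measurable_component_singleton)
  qed
  have fA[measurable]: "fA \<in> measurable (Pi\<^sub>M ?A (\<lambda>_. borel)) ?L"
    unfolding fA_def vinc_def by (intro measurable_restrict) auto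
  have fB[measurable]: "fB \<in> measurable (Pi\<^sub>M ?B (\<lambda>_. borel)) ?L"
    unfolding fB_def by (intro measurable_restrict measurable_component_singleton) auto
  define U where "U = fA \<circ> (\<lambda>\<omega>. restrict (\<lambda>p. X p \<omega>) ?A)"
  define V where "V = fB \<circ> (\<lambda>\<omega>. restrict (\<lambda>p. X p \<omega>) ?B)"
  have UV: "indep_var ?L U ?L V"
    unfolding U_def V_def
    by (rule indep_var_compose[OF indep_var_restrict[OF ind] fA fB]) (use Suc.prems in auto)
  have U: "U \<omega> 0 = passage (w \<omega>) x 0" "restrict (U \<omega>) {1..n} = ?v x \<omega>" for \<omega>
  proof -
    have "passage (W (restrict (\<lambda>p. X p \<omega>) ?A)) x j = passage (w \<omega>) x j" if "j \<le> n" for j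
      by (rule passage_cong) (use that in \<open>auto simp: W_def w_def zero_corner_def\<close>)
    then show "U \<omega> 0 = passage (w \<omega>) x 0" "restrict (U \<omega>) {1..n} = ?v x \<omega>"
      unfolding U_def fA_def vinc_def comp_def by (auto intro!: restrict_ext)
  qed
  have V: "V = (\<lambda>\<omega>. \<lambda>j\<in>{..n}. X (Suc x, j) \<omega>)"
    by (auto simp: V_def fB_def fun_eq_iff)
  interpret L: product_sigma_finite "\<lambda>j. exp_law (if j = 0 then b else r j + (b - t))" by unfold_locales
  have law: "distr M ?L V = Pi\<^sub>M (insert 0 {1..n}) (\<lambda>j. exp_law (if j = 0 then b else r j + (b - t)))"
  proof -
    have "{..n} = insert 0 {1..n}" by auto
    moreover have "distr M ?L V = Pi\<^sub>M {..n} (\<lambda>j. exp_law (if j = 0 then b else r j + (b - t)))"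
      unfolding V
    proof (rule distr_family)
      show "indep_vars (\<lambda>_. borel) (\<lambda>j. X (Suc x, j)) {..n}"
        by (rule indep_vars_reindex[OF ind]) (use Suc.prems in \<open>auto simp: inj_on_def\<close>)
    qed (use X Suc.prems in \<open>auto simp: exp_family_def\<close>)
    ultimately show ?thesis by simp
  qed
  have C: "Pi\<^sub>M {1..n} (\<lambda>j. exp_law (if j = 0 then b else r j + (b - t))) = ?C"
    by (intro PiM_cong) auto
  interpret C: sigma_finite_measure ?C by (rule sigma_finite_exp_vec)
  interpret A: sigma_finite_measure "exp_vec r n" by (rule sigma_finite_exp_vec)
  interpret AX: pair_sigma_finite "exp_vec r n" "exp_law (b - t)" ..
  define h where "h = (\<lambda>z :: (nat \<Rightarrow> real) \<times> (nat \<Rightarrow> real). ennreal (exp (t * fst z 0)) *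
      (ennreal (exp (t * snd z 0)) * F (?J (snd z 0) (restrict (fst z) {1..n}) (restrict (snd z) {1..n}))))"
  have [measurable]: "(\<lambda>z. restrict (fst z) {1..n}) \<in> measurable (?L \<Otimes>\<^sub>M ?L) (borel_vec n)"
    "(\<lambda>z. restrict (snd z) {1..n}) \<in> measurable (?L \<Otimes>\<^sub>M ?L) (borel_vec n)"
    by (rule measurable_compose[OF measurable_fst measurable_restrict_subset] measurable_compose[OF measurable_snd measurable_restrict_subset]; auto)+
  have [measurable]: "h \<in> borel_measurable (?L \<Otimes>\<^sub>M ?L)"
    unfolding h_def by measurable
  define G where "G = (\<lambda>v. \<integral>\<^sup>+i. ennreal (exp (t * i)) * (\<integral>\<^sup>+c. F (?J i v c) \<partial>?C) \<partial>exp_law b)"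
  have Gm[measurable]: "G \<in> borel_measurable (borel_vec n)"
    unfolding G_def by measurable
  have step: "ennreal (exp (t * passage (w \<omega>) (Suc x) 0)) * F (?v (Suc x) \<omega>) = h (U \<omega>, V \<omega>)" for \<omega>
  proof -
    have "?v (Suc x) \<omega> = ?J (X (Suc x, 0) \<omega>) (?v x \<omega>) (restrict (V \<omega>) {1..n})"
    proof (rule restrict_ext)
      fix j assume j: "j \<in> {1..n}"
      have "vinc (w \<omega>) (Suc x) j = jcol (w \<omega> (Suc x) 0) (vinc (w \<omega>) x) (w \<omega> (Suc x)) j"
        using j by (intro jcol_vinc[symmetric]) auto
      also have "w \<omega> (Suc x) 0 = X (Suc x, 0) \<omega>" by (simp add: w_def zero_corner_def)
      also have "jcol (X (Suc x, 0) \<omega>) (vinc (w \<omega>) x) (w \<omega> (Suc x)) j =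
          jcol (X (Suc x, 0) \<omega>) (?v x \<omega>) (restrict (V \<omega>) {1..n}) j"
        using j by (intro jcol_cong) (auto simp: V w_def zero_corner_def)
      finally show "vinc (w \<omega>) (Suc x) j = jcol (X (Suc x, 0) \<omega>) (?v x \<omega>) (restrict (V \<omega>) {1..n}) j" .
    qed
    moreover have "V \<omega> 0 = X (Suc x, 0) \<omega>" by (simp add: V)
    ultimately show ?thesis unfolding h_def fst_conv snd_conv U
      by (simp add: ring_distribs exp_add ennreal_mult mult.assoc w_def zero_corner_def)
  qed
  have inner: "(\<integral>\<^sup>+v. h (U \<omega>, v) \<partial>distr M ?L V) = ennreal (exp (t * passage (w \<omega>) x 0)) * G (?v x \<omega>)" for \<omega>
  proof -
    let ?e = "ennreal (exp (t * passage (w \<omega>) x 0))"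
    define v where "v = ?v x \<omega>"
    let ?g = "\<lambda>i. ?e * (ennreal (exp (t * i)) * (\<integral>\<^sup>+c. F (?J i v c) \<partial>?C))"
    have [measurable]: "v \<in> space (borel_vec n)" by (simp add: space_PiM v_def)
    have m: "(\<lambda>c. F (?J i v c)) \<in> borel_measurable ?C" for i by measurable
    have Um: "U \<omega> \<in> space ?L" by (simp add: U_def fA_def space_PiM)
    have "(\<integral>\<^sup>+v. h (U \<omega>, v) \<partial>distr M ?L V) = (\<integral>\<^sup>+i. \<integral>\<^sup>+c. h (U \<omega>, c(0 := i)) \<partial>?C \<partial>exp_law b)"
    proof -
      have "(\<lambda>v. h (U \<omega>, v)) \<in> borel_measurable (distr M ?L V)" using Um by simp
      from L.product_nn_integral_insert_rev[OF _ _ this[unfolded law]] show ?thesis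
        unfolding law C by simp
    qed
    also have "\<dots> = (\<integral>\<^sup>+i. ?g i \<partial>exp_law b)"
    proof (rule nn_integral_cong)
      fix i
      have "restrict (c(0 := i)) {1..n} = c" if "c \<in> space ?C" for c
        using that by (auto simp: space_PiM PiE_def extensional_def)
      then have "(\<integral>\<^sup>+c. h (U \<omega>, c(0 := i)) \<partial>?C) = (\<integral>\<^sup>+c. ?e * (ennreal (exp (t * i)) * F (?J i v c)) \<partial>?C)"
        unfolding h_def v_def by (intro nn_integral_cong) (simp only: U fst_conv snd_conv fun_upd_same)
      also have "\<dots> = ?g i"
        by (simp only: nn_integral_cmult borel_measurable_times_ennreal borel_measurable_const m)
      finally show "(\<integral>\<^sup>+c. h (U \<omega>, c(0 := i)) \<partial>?C) = ?g i" .
    qed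
    also have "\<dots> = ?e * G v"
      unfolding G_def by (rule nn_integral_cmult) measurable
    also note v_def
    finally show ?thesis .
  qed
  have "(\<integral>\<^sup>+\<omega>. ennreal (exp (t * passage (w \<omega>) (Suc x) 0)) * F (?v (Suc x) \<omega>) \<partial>M) =
    (\<integral>\<^sup>+\<omega>. h (U \<omega>, V \<omega>) \<partial>M)" by (simp only: step)
  also have "\<dots> = (\<integral>\<^sup>+\<omega>. ennreal (exp (t * passage (w \<omega>) x 0)) * G (?v x \<omega>) \<partial>M)"
    unfolding inner[symmetric] by (rule nn_integral_indep_var[OF UV]) measurable
  also have "\<dots> = ennreal ((b / (b - t)) ^ x) * (\<integral>\<^sup>+v. G v \<partial>exp_vec r n)"
    using Suc.prems by (intro Suc.IH Gm) auto
  also have "(\<integral>\<^sup>+v. G v \<partial>exp_vec r n) = (\<integral>\<^sup>+v. ennreal (b / (b - t)) * (\<integral>\<^sup>+i. \<integral>\<^sup>+c. F (?J i v c) \<partial>?C \<partial>exp_law (b - t)) \<partial>exp_vec r n)"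
  proof (rule nn_integral_cong)
    fix v assume "v \<in> space (exp_vec r n)"
    then have [measurable]: "v \<in> space (borel_vec n)" by (simp add: space_PiM)
    show "G v = ennreal (b / (b - t)) * (\<integral>\<^sup>+i. \<integral>\<^sup>+c. F (?J i v c) \<partial>?C \<partial>exp_law (b - t))"
      unfolding G_def using b t by (intro nn_integral_exp_law_tilt) measurable
  qed
  also have "\<dots> = ennreal (b / (b - t)) * (\<integral>\<^sup>+v. \<integral>\<^sup>+i. \<integral>\<^sup>+c. F (?J i v c) \<partial>?C \<partial>exp_law (b - t) \<partial>exp_vec r n)"
    by (rule nn_integral_cmult) measurable
  also have "(\<integral>\<^sup>+v. \<integral>\<^sup>+i. \<integral>\<^sup>+c. F (?J i v c) \<partial>?C \<partial>exp_law (b - t) \<partial>exp_vec r n) =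
    (\<integral>\<^sup>+i. \<integral>\<^sup>+v. \<integral>\<^sup>+c. F (?J i v c) \<partial>?C \<partial>exp_vec r n \<partial>exp_law (b - t))"
    by (rule AX.Fubini'[symmetric]) measurable
  also have "\<dots> = (\<integral>\<^sup>+i. \<integral>\<^sup>+v. F v \<partial>exp_vec r n \<partial>exp_law (b - t))"
  proof -
    have "(\<lambda>z. F (snd z)) \<in> borel_measurable (borel \<Otimes>\<^sub>M borel_vec n)" by measurable
    from burke_column[OF _ r this, of "b - t"] t show ?thesis
      unfolding snd_conv by simp
  qed
  also have "\<dots> = (\<integral>\<^sup>+v. F v \<partial>exp_vec r n)"
  proof -
    interpret E: prob_space "exp_law (b - t)" using t by (intro prob_space_exp_law) auto
    show ?thesis using E.emeasure_space_1 by simp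
  qed
  finally have *: "(\<integral>\<^sup>+\<omega>. ennreal (exp (t * passage (w \<omega>) (Suc x) 0)) * F (?v (Suc x) \<omega>) \<partial>M) =
    ennreal ((b / (b - t)) ^ x) * (ennreal (b / (b - t)) * (\<integral>\<^sup>+v. F v \<partial>exp_vec r n))" .
  have "ennreal ((b / (b - t)) ^ Suc x) = ennreal ((b / (b - t)) ^ x) * ennreal (b / (b - t))"
    using b t by (subst ennreal_mult[symmetric]) (auto simp: mult.commute)
  then show ?case unfolding * by (simp only: mult.assoc)
qed

section \<open>Deterministic properties of passage times: reversal, superadditivity, paths\<close>

lemma passage_row_Suc: "passage w (Suc m) 0 = w 0 0 + passage (\<lambda>i j. w (Suc i) j) m 0"
  by (induction m) auto

lemma passage_col_Suc: "passage w 0 (Suc n) = w 0 0 + passage (\<lambda>i j. w i (Suc j)) 0 n"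
  by (induction n) auto

text \<open>The defining recursion looks at the last step; reversal and the separation of the two
  boundaries need the first one.\<close>

lemma passage_first_step:
  "passage w (Suc m) (Suc n) =
    w 0 0 + max (passage (\<lambda>i j. w (Suc i) j) m (Suc n)) (passage (\<lambda>i j. w i (Suc j)) (Suc m) n)"
proof (induction w m n rule: passage.induct)
  case (2 w m)
  then show ?case unfolding passage.simps(4)[of w "Suc m"] passage_row_Suc[of w "Suc m"] by (simp add: max_def)
next
  case (3 w n)
  then show ?case unfolding passage.simps(4)[of w 0 "Suc n"] passage_col_Suc[of w "Suc n"] by (simp add: max_def)
next
  case (4 w m n)
  then show ?case unfolding passage.simps(4)[of w "Suc m" "Suc n"] by (simp add: max_def)
qed (simp add: max_def)

lemma passage_rev: "passage (\<lambda>i j. w (m - i) (n - j)) m n = passage w m n"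
\<comment> \<open>The cut-down rectangle has a shifted environment, so the predicate quantifies over
  all environments and only the two side lengths drive the induction.\<close>
proof (induction w m n rule: passage.induct[where P = "\<lambda>_ m n. \<forall>w. passage (\<lambda>i j. w (m - i) (n - j)) m n = passage w m n", THEN spec])
  case (1 w)
  then show ?case by simp
next
  case (2 _ m)
  show ?case
  proof
    fix w
    show "passage (\<lambda>i j. w (Suc m - i) (0 - j)) (Suc m) 0 = passage w (Suc m) 0"
      using 2[rule_format, of "\<lambda>i j. w (Suc i) j"] unfolding passage_row_Suc[of w]
      by (simp add: Suc_diff_le cong: passage_cong)
  qed
next
  case (3 _ n)
  show ?case
  proof
    fix w
    show "passage (\<lambda>i j. w (0 - i) (Suc n - j)) 0 (Suc n) = passage w 0 (Suc n)"
      using 3[rule_format, of "\<lambda>i j. w i (Suc j)"] unfolding passage_col_Suc[of w]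
      by (simp add: Suc_diff_le cong: passage_cong)
  qed
next
  case (4 _ m n)
  show ?case
  proof
    fix w
    show "passage (\<lambda>i j. w (Suc m - i) (Suc n - j)) (Suc m) (Suc n) = passage w (Suc m) (Suc n)"
      using 4(1)[rule_format, of "\<lambda>i j. w (Suc i) j"] 4(2)[rule_format, of "\<lambda>i j. w i (Suc j)"]
      unfolding passage_first_step[of w] passage.simps(4)[of "\<lambda>i j. w (Suc m - i) (Suc n - j)"]
      by (simp add: Suc_diff_le del: passage.simps cong: passage_cong)
  qed
qed

lemma passage_transpose: "passage (\<lambda>i j. w j i) n m = passage w m n"
  by (induction w m n rule: passage.induct) (auto simp: max.commute)

text \<open>The paths are joined by a step to the right, so the two pieces use disjoint sets of
  columns and hence independent weights.\<close>

lemma passage_superadd: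
  "passage w m n + passage (\<lambda>i j. w (Suc (m + i)) (n + j)) m' n' \<le> passage w (Suc (m + m')) (n + n')"
proof (induction "\<lambda>i j. w (Suc (m + i)) (n + j)" m' n' rule: passage.induct)
  case 1
  then show ?case by (cases n) auto
next
  case (2 m')
  then show ?case by (cases n) auto
next
  case (3 n')
  then show ?case by auto
next
  case (4 m' n')
  then show ?case by auto
qed

lemma passage_mono:
  assumes "\<And>i j. i \<le> m \<Longrightarrow> j \<le> n \<Longrightarrow> w i j \<le> w' i j"
  shows "passage w m n \<le> passage w' m n"
  using assms by (induction w m n rule: passage.induct) (auto intro!: add_mono max.mono simp del: max.bounded_iff)

lemma passage_shift_le:
  assumes "\<And>i j. i \<le> Suc m \<Longrightarrow> j \<le> Suc n \<Longrightarrow> 0 \<le> w i j"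
  shows "passage (\<lambda>i j. w (Suc i) (Suc j)) m n \<le> passage w (Suc m) (Suc n)"
  using passage_superadd[of w 0 1 m n] assms[of 0 0] assms[of 0 1] by simp

text \<open>A path is encoded by its abscissa \<open>f k\<close> at each antidiagonal level
  \<open>k\<close>; the ordinate is \<open>k - f k\<close>. The relative position of two paths at a
  level is then a comparison of two numbers.\<close>

definition lattice_path :: "(nat \<Rightarrow> nat) \<Rightarrow> nat \<Rightarrow> nat \<Rightarrow> bool" where
  "lattice_path f m n \<longleftrightarrow> f 0 = 0 \<and> f (m + n) = m \<and> (\<forall>k<m + n. f (Suc k) = f k \<or> f (Suc k) = Suc (f k))"

lemma lattice_path_le: "lattice_path f m n \<Longrightarrow> k \<le> m + n \<Longrightarrow> f k \<le> k"
proof (induction k)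
  case (Suc k)
  then have "f k \<le> k" "f (Suc k) = f k \<or> f (Suc k) = Suc (f k)" by (auto simp: lattice_path_def)
  then show ?case by auto
qed (auto simp: lattice_path_def)

lemma sum_lattice_path_le_passage:
  assumes "lattice_path f m n"
  shows "(\<Sum>k\<le>m + n. w (f k) (k - f k)) \<le> passage w m n"
  using assms
proof (induction w m n rule: passage.induct)
  case (1 w)
  then show ?case by (simp add: lattice_path_def)
next
  case (2 w m)
  have "f m \<le> m" "f (Suc m) = f m \<or> f (Suc m) = Suc (f m)" "f (Suc m) = Suc m"
    using 2(2) lattice_path_le[OF 2(2), of m] by (auto simp: lattice_path_def)
  then have "f m = m" by auto
  then have "lattice_path f m 0" using 2(2) by (auto simp: lattice_path_def)
  from 2(1)[OF this] \<open>f (Suc m) = Suc m\<close> show ?case by simp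
next
  case (3 w n)
  have "f (Suc n) = f n \<or> f (Suc n) = Suc (f n)" "f (Suc n) = 0"
    using 3(2) by (auto simp: lattice_path_def)
  then have "f n = 0" by auto
  then have "lattice_path f 0 n" using 3(2) by (auto simp: lattice_path_def)
  from 3(1)[OF this] \<open>f (Suc n) = 0\<close> show ?case by simp
next
  case (4 w m n)
  have last: "f (Suc (Suc (m + n))) = Suc m" using 4(3) by (auto simp: lattice_path_def)
  have "f (Suc (Suc (m + n))) = f (Suc (m + n)) \<or> f (Suc (Suc (m + n))) = Suc (f (Suc (m + n)))"
    using 4(3) by (auto simp: lattice_path_def)
  then consider "f (Suc (m + n)) = Suc m" | "f (Suc (m + n)) = m" using last by auto
  then show ?case
  proof cases
    case 1
    then have "lattice_path f (Suc m) n" using 4(3) by (auto simp: lattice_path_def)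
    from 4(2)[OF this] last show ?thesis by simp
  next
    case 2
    then have "lattice_path f m (Suc n)" using 4(3) by (auto simp: lattice_path_def)
    from 4(1)[OF this] last show ?thesis by simp
  qed
qed

lemma passage_attained: "\<exists>f. lattice_path f m n \<and> (\<Sum>k\<le>m + n. w (f k) (k - f k)) = passage w m n"
proof -
  have ext: "\<exists>f. lattice_path f m' n' \<and> (\<Sum>k\<le>m' + n'. w (f k) (k - f k)) = passage w m n + w m' n'"
    if f: "lattice_path f m n" "(\<Sum>k\<le>m + n. w (f k) (k - f k)) = passage w m n"
      and m': "m' + n' = Suc (m + n)" "m' = m \<or> m' = Suc m" for w f m n m' n'
  proof (intro exI conjI)
    show "lattice_path (f(Suc (m + n) := m')) m' n'"
      using f(1) m' by (auto simp: lattice_path_def less_Suc_eq)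
    have "(\<Sum>k\<le>m + n. w ((f(Suc (m + n) := m')) k) (k - (f(Suc (m + n) := m')) k)) = passage w m n"
      unfolding f(2)[symmetric] by (intro sum.cong) auto
    moreover have "Suc (m + n) - m' = n'" using m' by auto
    ultimately show "(\<Sum>k\<le>m' + n'. w ((f(Suc (m + n) := m')) k) (k - (f(Suc (m + n) := m')) k)) = passage w m n + w m' n'"
      unfolding m'(1) by simp
  qed
  show ?thesis
  proof (induction w m n rule: passage.induct)
    case (1 w)
    have "lattice_path (\<lambda>_. 0) 0 0" by (simp add: lattice_path_def)
    then show ?case by (intro exI[of _ "\<lambda>_. 0"]) simp
  next
    case (2 w m)
    then obtain f where "lattice_path f m 0" "(\<Sum>k\<le>m + 0. w (f k) (k - f k)) = passage w m 0" by blast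
    from ext[OF this, of "Suc m" 0] show ?case by simp
  next
    case (3 w n)
    then obtain f where "lattice_path f 0 n" "(\<Sum>k\<le>0 + n. w (f k) (k - f k)) = passage w 0 n" by blast
    from ext[OF this, of 0 "Suc n"] show ?case by simp
  next
    case (4 w m n)
    show ?case
    proof (cases "passage w m (Suc n) \<le> passage w (Suc m) n")
      case True
      obtain f where "lattice_path f (Suc m) n" "(\<Sum>k\<le>Suc m + n. w (f k) (k - f k)) = passage w (Suc m) n"
        using 4 by blast
      from ext[OF this, of "Suc m" "Suc n"] True show ?thesis by (simp add: max_def)
    next
      case False
      obtain f where "lattice_path f m (Suc n)" "(\<Sum>k\<le>m + Suc n. w (f k) (k - f k)) = passage w m (Suc n)"
        using 4 by blast
      from ext[OF this, of "Suc m" "Suc n"] False show ?thesis by (simp add: max_def)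
    qed
  qed
qed

text \<open>The passage time is the bottom row plus the vertical increments of the last column.
  Under the tilt of the bottom row these increments are independent exponentials, so the moment
  factorizes.\<close>

lemma exp_moment_boundary:
  assumes X: "exp_family M X (\<lambda>(i, j). if j = 0 then b else if i = 0 then r j else r j + (b - t)) ({..m} \<times> {..n})"
    and t: "t < b" "\<And>j. 1 \<le> j \<Longrightarrow> j \<le> n \<Longrightarrow> t < r j"
  shows "(\<integral>\<^sup>+\<omega>. ennreal (exp (t * passage (zero_corner (\<lambda>i j. X (i, j) \<omega>)) m n)) \<partial>M) =
    ennreal ((b / (b - t)) ^ m * (\<Prod>j=1..n. r j / (r j - t)))"
proof -
  have b: "0 < b" and r: "\<And>j. 1 \<le> j \<Longrightarrow> j \<le> n \<Longrightarrow> 0 < r j \<and> t < r j"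
    using X t(2) by (force simp: exp_family_def)+
  interpret P: product_sigma_finite "\<lambda>j. exp_law (r j)" by unfold_locales
  define w where "w = (\<lambda>\<omega>. zero_corner (\<lambda>i j. X (i, j) \<omega>))"
  define F where "F = (\<lambda>v :: nat \<Rightarrow> real. \<Prod>j\<in>{1..n}. ennreal (exp (t * v j)))"
  have Fm: "F \<in> borel_measurable (borel_vec n)" unfolding F_def by measurable
  have "exp (t * passage (w \<omega>) m n) = exp (t * passage (w \<omega>) m 0) * (\<Prod>j\<in>{1..n}. exp (t * vinc (w \<omega>) m j))" for \<omega>
    by (simp add: passage_eq_sum_vinc[of "w \<omega>" m n] ring_distribs exp_add sum_distrib_left exp_sum)
  then have "(\<integral>\<^sup>+\<omega>. ennreal (exp (t * passage (w \<omega>) m n)) \<partial>M) =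
    (\<integral>\<^sup>+\<omega>. ennreal (exp (t * passage (w \<omega>) m 0)) * F (\<lambda>j\<in>{1..n}. vinc (w \<omega>) m j) \<partial>M)"
    by (simp add: F_def ennreal_mult prod_ennreal prod_nonneg)
  also have "\<dots> = ennreal ((b / (b - t)) ^ m) * (\<integral>\<^sup>+v. F v \<partial>exp_vec r n)"
    unfolding w_def by (rule stationary_column[OF X t(1) order.refl Fm])
  also have "(\<integral>\<^sup>+v. F v \<partial>exp_vec r n) = (\<Prod>j\<in>{1..n}. \<integral>\<^sup>+x. ennreal (exp (t * x)) \<partial>exp_law (r j))"
    unfolding F_def by (rule P.product_nn_integral_prod) (auto simp: measurable_cong_sets[OF sets_exp_law refl])
  also have "\<dots> = (\<Prod>j\<in>{1..n}. ennreal (r j / (r j - t)))"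
  proof (rule prod.cong[OF refl])
    fix j assume j: "j \<in> {1..n}"
    then interpret E: prob_space "exp_law (r j - t)" using r by (intro prob_space_exp_law) auto
    show "(\<integral>\<^sup>+x. ennreal (exp (t * x)) \<partial>exp_law (r j)) = ennreal (r j / (r j - t))"
      using nn_integral_exp_law_tilt[of "r j" t "\<lambda>_. 1"] r[of j] j E.emeasure_space_1 by simp
  qed
  also have "\<dots> = ennreal (\<Prod>j=1..n. r j / (r j - t))"
    using r by (intro prod_ennreal) (auto intro!: divide_nonneg_nonneg less_imp_le)
  finally show ?thesis
    using b t(1) r unfolding w_def
    by (subst ennreal_mult) (auto intro!: divide_nonneg_nonneg prod_nonneg simp: less_imp_le)
qed

section \<open>Independent exponential families and the moment bound without boundary\<close>

lemma exp_family_PiM: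
  assumes "\<And>p. p \<in> K \<Longrightarrow> 0 < c p" "K \<noteq> {}"
  shows "exp_family (Pi\<^sub>M K (\<lambda>p. exp_law (c p))) (\<lambda>p \<omega>. \<omega> p) c K"
proof -
  let ?P = "Pi\<^sub>M K (\<lambda>p. exp_law (c p))"
  have ps: "\<And>p. p \<in> K \<Longrightarrow> prob_space (exp_law (c p))" by (intro prob_space_exp_law assms)
  interpret prob_space ?P by (intro prob_space_PiM ps)
  have d: "distr ?P borel (\<lambda>\<omega>. \<omega> p) = exp_law (c p)" if "p \<in> K" for p
  proof -
    have "distr ?P borel (\<lambda>\<omega>. \<omega> p) = distr ?P (exp_law (c p)) (\<lambda>\<omega>. \<omega> p)"
      by (intro distr_cong) auto
    also have "\<dots> = exp_law (c p)" by (rule distr_PiM_component[OF ps that])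
    finally show ?thesis .
  qed
  have "indep_vars (\<lambda>_. borel) (\<lambda>p \<omega>. \<omega> p) K"
  proof (subst indep_vars_iff_distr_eq_PiM'[OF assms(2)])
    show "random_variable borel (\<lambda>\<omega>. \<omega> p)" if "p \<in> K" for p
      using that measurable_component_singleton[of p K "\<lambda>p. exp_law (c p)"] by (simp cong: measurable_cong_sets)
    have "distr ?P (Pi\<^sub>M K (\<lambda>_. borel)) (\<lambda>\<omega>. \<lambda>p\<in>K. \<omega> p) =
      distr ?P ?P (\<lambda>\<omega>. \<omega>)"
      by (intro distr_cong) (auto simp: space_PiM PiE_def extensional_restrict intro!: sets_PiM_cong)
    also have "\<dots> = Pi\<^sub>M K (\<lambda>p. distr ?P borel (\<lambda>\<omega>. \<omega> p))"
      unfolding distr_id by (intro PiM_cong) (auto simp: d)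
    finally show "distr ?P (Pi\<^sub>M K (\<lambda>_. borel)) (\<lambda>\<omega>. \<lambda>p\<in>K. \<omega> p) =
      Pi\<^sub>M K (\<lambda>p. distr ?P borel (\<lambda>\<omega>. \<omega> p))" .
  qed
  then show ?thesis
    using assms d by (auto simp: exp_family_def prob_space_axioms)
qed

lemma exp_family_reindex:
  assumes "exp_family M X c K" "inj_on f L" "f ` L \<subseteq> K" "\<And>l. l \<in> L \<Longrightarrow> c (f l) = d l"
  shows "exp_family M (\<lambda>l. X (f l)) d L"
proof -
  interpret prob_space M using assms(1) by (simp add: exp_family_def)
  show ?thesis
    using assms(1,3,4) indep_vars_reindex[OF _ assms(2,3), of borel X]
    unfolding exp_family_def by (metis image_subset_iff)
qed

lemma exp_family_measurable: "exp_family M X c K \<Longrightarrow> p \<in> K \<Longrightarrow> X p \<in> borel_measurable M"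
  by (auto simp: exp_family_def prob_space.indep_vars_def)

lemma exp_family_AE_nonneg:
  assumes "exp_family M X c K" "countable K"
  shows "AE \<omega> in M. \<forall>p\<in>K. 0 \<le> X p \<omega>"
proof -
  have "AE \<omega> in M. 0 \<le> X p \<omega>" if "p \<in> K" for p
  proof -
    have [measurable]: "X p \<in> borel_measurable M" by (rule exp_family_measurable[OF assms(1) that])
    have "AE x in exp_law (c p). 0 \<le> x"
      unfolding exp_law_def by (subst AE_density) (auto simp: exponential_density_def)
    also have "exp_law (c p) = distr M borel (X p)" using assms that by (simp add: exp_family_def)
    finally show ?thesis by (subst (asm) AE_distr_iff) auto
  qed
  then show ?thesis using assms(2) by (simp add: AE_ball_countable)
qed

lemma measurable_exp_passage:
  assumes "exp_family M X c ({..m} \<times> {..n})"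
  shows "(\<lambda>\<omega>. passage (\<lambda>i j. X (i, j) \<omega>) m n) \<in> borel_measurable M"
  by (rule measurable_passage) (auto intro!: exp_family_measurable[OF assms])

lemma exp_family_passage_law:
  assumes X: "exp_family M X c ({..m} \<times> {..n})" and Y: "exp_family N Y c ({..m} \<times> {..n})"
  shows "distr M borel (\<lambda>\<omega>. passage (\<lambda>i j. X (i, j) \<omega>) m n) = distr N borel (\<lambda>\<omega>. passage (\<lambda>i j. Y (i, j) \<omega>) m n)"
proof -
  let ?K = "{..m} \<times> {..n}" and ?f = "\<lambda>y. passage (\<lambda>i j. y (i, j)) m n"
  let ?law = "distr (Pi\<^sub>M ?K (\<lambda>p. exp_law (c p))) borel ?f"
  have *: "distr M borel (\<lambda>\<omega>. passage (\<lambda>i j. X (i, j) \<omega>) m n) = ?law"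
    if X: "exp_family M X c ({..m} \<times> {..n})" for M :: "'z measure" and X
  proof -
    interpret prob_space M using X by (simp add: exp_family_def)
    have "Pi\<^sub>M ?K (\<lambda>p. exp_law (c p)) = distr M (Pi\<^sub>M ?K (\<lambda>_. borel)) (\<lambda>\<omega>. \<lambda>p\<in>?K. X p \<omega>)"
      using X by (intro distr_family[symmetric]) (auto simp: exp_family_def)
    then have "?law = distr (distr M (Pi\<^sub>M ?K (\<lambda>_. borel)) (\<lambda>\<omega>. \<lambda>p\<in>?K. X p \<omega>)) borel ?f"
      by simp
    also have "\<dots> = distr M borel (\<lambda>\<omega>. passage (\<lambda>i j. (\<lambda>p\<in>?K. X p \<omega>) (i, j)) m n)"
      using exp_family_measurable[OF X]
      by (subst distr_distr) (auto intro!: measurable_passage measurable_component_singleton measurable_restrict simp: comp_def)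
    also have "\<dots> = distr M borel (\<lambda>\<omega>. passage (\<lambda>i j. X (i, j) \<omega>) m n)"
      by (intro distr_cong refl passage_cong) auto
    finally show ?thesis ..
  qed
  show ?thesis using *[OF X] *[OF Y] by simp
qed

text \<open>The rectangle is the interior of a boundary model with bottom rate \<open>z\<close> and
  left rates \<open>r j - z + t\<close>, chosen so that the interior rates become
  \<open>r j\<close>. Adding the nonnegative boundary only increases the passage time, and
  \<open>z\<close> remains free for optimization.\<close>

lemma passage_exp_moment_le:
  assumes X: "exp_family M X (\<lambda>(i, j). r j) ({..m} \<times> {..n})"
    and t: "0 < t" "t < z" and z: "\<And>j. j \<le> n \<Longrightarrow> z < r j"
  shows "(\<integral>\<^sup>+\<omega>. ennreal (exp (t * passage (\<lambda>i j. X (i, j) \<omega>) m n)) \<partial>M) \<le>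
    ennreal ((z / (z - t)) ^ Suc m * (\<Prod>j\<le>n. (r j - z + t) / (r j - z)))"
proof -
  let ?K = "{..Suc m} \<times> {..Suc n}"
  define c where "c = (\<lambda>(i :: nat, j). if j = 0 then z else if i = 0 then r (j - 1) - z + t else r (j - 1) - z + t + (z - t))"
  let ?N = "Pi\<^sub>M ?K (\<lambda>p. exp_law (c p))"
  have Y: "exp_family ?N (\<lambda>p \<omega>. \<omega> p) c ?K"
  proof (rule exp_family_PiM)
    fix p :: "nat \<times> nat" assume p: "p \<in> ?K"
    obtain i j where ij: "p = (i, j)" by (cases p)
    show "0 < c p"
    proof (cases j)
      case (Suc k)
      then have "z < r k" using p ij by (intro z) auto
      then show ?thesis using t Suc by (auto simp: ij c_def)
    qed (use t in \<open>auto simp: ij c_def\<close>)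
  qed auto
  have Y': "exp_family ?N (\<lambda>p \<omega>. \<omega> (case p of (i, j) \<Rightarrow> (Suc i, Suc j))) (\<lambda>(i, j). r j) ({..m} \<times> {..n})"
    by (rule exp_family_reindex[OF Y]) (auto simp: inj_on_def c_def)
  have "(\<integral>\<^sup>+\<omega>. ennreal (exp (t * passage (\<lambda>i j. X (i, j) \<omega>) m n)) \<partial>M) =
    (\<integral>\<^sup>+x. ennreal (exp (t * x)) \<partial>distr M borel (\<lambda>\<omega>. passage (\<lambda>i j. X (i, j) \<omega>) m n))"
    by (subst nn_integral_distr) (auto intro!: measurable_exp_passage[OF X])
  also have "\<dots> = (\<integral>\<^sup>+x. ennreal (exp (t * x)) \<partial>distr ?N borel (\<lambda>\<omega>. passage (\<lambda>i j. \<omega> (Suc i, Suc j)) m n))"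
    using exp_family_passage_law[OF X Y'] by simp
  also have "\<dots> = (\<integral>\<^sup>+\<omega>. ennreal (exp (t * passage (\<lambda>i j. \<omega> (Suc i, Suc j)) m n)) \<partial>?N)"
    using measurable_exp_passage[OF Y'] by (subst nn_integral_distr) auto
  also have "\<dots> \<le> (\<integral>\<^sup>+\<omega>. ennreal (exp (t * passage (zero_corner (\<lambda>i j. \<omega> (i, j))) (Suc m) (Suc n))) \<partial>?N)"
  proof (rule nn_integral_mono_AE)
    show "AE \<omega> in ?N. ennreal (exp (t * passage (\<lambda>i j. \<omega> (Suc i, Suc j)) m n)) \<le>
       ennreal (exp (t * passage (zero_corner (\<lambda>i j. \<omega> (i, j))) (Suc m) (Suc n)))"
      using exp_family_AE_nonneg[OF Y countable_finite[OF finite_cartesian_product[OF finite_atMost finite_atMost]]]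
    proof eventually_elim
      case (elim \<omega>)
      have "passage (\<lambda>i j. zero_corner (\<lambda>i j. \<omega> (i, j)) (Suc i) (Suc j)) m n \<le> passage (zero_corner (\<lambda>i j. \<omega> (i, j))) (Suc m) (Suc n)"
        using elim by (intro passage_shift_le) (auto simp: zero_corner_def)
      then have "passage (\<lambda>i j. \<omega> (Suc i, Suc j)) m n \<le> passage (zero_corner (\<lambda>i j. \<omega> (i, j))) (Suc m) (Suc n)"
        by (simp add: zero_corner_def)
      then show ?case using t by simp
    qed
  qed
  also have "\<dots> = ennreal ((z / (z - t)) ^ Suc m * (\<Prod>j=1..Suc n. (r (j - 1) - z + t) / (r (j - 1) - z + t - t)))"
  proof (unfold c_def, rule exp_moment_boundary[OF Y[unfolded c_def] t(2)])
    show "t < r (j - 1) - z + t" if "1 \<le> j" "j \<le> Suc n" for j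
      using z[of "j - 1"] that by simp
  qed
  also have "(\<Prod>j=1..Suc n. (r (j - 1) - z + t) / (r (j - 1) - z + t - t)) = (\<Prod>j\<le>n. (r j - z + t) / (r j - z))"
    by (rule prod.reindex_bij_witness[of _ Suc "\<lambda>j. j - 1"]) auto
  finally show ?thesis .
qed

section \<open>Tail bounds for passage times\<close>

text \<open>The logarithm is twice the inverse hyperbolic tangent, an odd function. The missing
  quadratic term makes the errors per diagonal step cubic in the tilt, and this yields the cube in
  the final exponent.\<close>

lemma ln_artanh_bounds:
  fixes v :: real
  assumes "0 \<le> v" "v \<le> 1/2"
  shows "2 * v + 2 * v ^ 3 / 3 \<le> ln ((1 + v) / (1 - v))" (is ?lo) "ln ((1 + v) / (1 - v)) \<le> 2 * v + v ^ 3" (is ?up)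
proof -
  let ?g = "\<lambda>u :: real. ln ((1 + u) / (1 - u))"
  have der: "(?g has_real_derivative 2 / (1 - u\<^sup>2)) (at u)" if "0 \<le> u" "u \<le> 1/2" for u :: real
  proof -
    have nz: "1 - u \<noteq> 0" "1 + u \<noteq> 0" and pos: "0 < (1 + u) / (1 - u)" using that by auto
    have eq: "1 - u\<^sup>2 = (1 - u) * (1 + u)" by (simp add: power2_eq_square algebra_simps)
    have "(?g has_real_derivative
        ((1 * (1 - u) - (1 + u) * (- 1)) / ((1 - u) * (1 - u))) / ((1 + u) / (1 - u))) (at u)"
      using nz pos by (auto intro!: derivative_eq_intros simp: algebra_simps)
    also have "((1 * (1 - u) - (1 + u) * (- 1)) / ((1 - u) * (1 - u))) / ((1 + u) / (1 - u)) = 2 / (1 - u\<^sup>2)"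
      unfolding eq using nz by (simp add: divide_simps)
    finally show ?thesis .
  qed
  have "?g 0 - (2 * 0 + 2 * 0 ^ 3 / 3) \<le> ?g v - (2 * v + 2 * v ^ 3 / 3)"
  proof (rule DERIV_nonneg_imp_nondecreasing[OF assms(1)])
    fix u assume u: "0 \<le> u" "u \<le> v"
    then have "u \<le> 1/2" using assms by simp
    then have u2: "u\<^sup>2 \<le> 1/4" using u power_mono[of u "1/2" 2] by (simp add: power2_eq_square)
    have "1 - u ^ 4 \<le> 1" by simp
    then have "(1 + u\<^sup>2) * (1 - u\<^sup>2) \<le> 1" by (simp add: algebra_simps flip: power_add)
    then have "2 + 2 * u\<^sup>2 \<le> 2 / (1 - u\<^sup>2)"
      using u2 by (simp add: field_simps)
    moreover have "((\<lambda>u. ?g u - (2 * u + 2 * u ^ 3 / 3)) has_real_derivative 2 / (1 - u\<^sup>2) - (2 + 2 * u\<^sup>2)) (at u)"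
      by (intro DERIV_diff der u \<open>u \<le> 1/2\<close>) (auto intro!: derivative_eq_intros simp: power2_eq_square)
    ultimately show "\<exists>y. ((\<lambda>u. ?g u - (2 * u + 2 * u ^ 3 / 3)) has_real_derivative y) (at u) \<and> 0 \<le> y"
      by (intro exI[of _ "2 / (1 - u\<^sup>2) - (2 + 2 * u\<^sup>2)"]) auto
  qed
  then show ?lo by simp
  have "2 * 0 + 0 ^ 3 - ?g 0 \<le> 2 * v + v ^ 3 - ?g v"
  proof (rule DERIV_nonneg_imp_nondecreasing[OF assms(1)])
    fix u assume u: "0 \<le> u" "u \<le> v"
    then have "u \<le> 1/2" using assms by simp
    then have u2: "u\<^sup>2 \<le> 1/4" using u power_mono[of u "1/2" 2] by (simp add: power2_eq_square)
    have "u\<^sup>2 * (3 * u\<^sup>2) \<le> u\<^sup>2 * 1" using u2 by (intro mult_left_mono) auto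
    then have "2 \<le> (2 + 3 * u\<^sup>2) * (1 - u\<^sup>2)"
      by (simp add: algebra_simps)
    then have "2 / (1 - u\<^sup>2) \<le> 2 + 3 * u\<^sup>2"
      using u2 by (simp add: field_simps)
    moreover have "((\<lambda>u. 2 * u + u ^ 3 - ?g u) has_real_derivative (2 + 3 * u\<^sup>2) - 2 / (1 - u\<^sup>2)) (at u)"
      by (intro DERIV_diff der u \<open>u \<le> 1/2\<close>) (auto intro!: derivative_eq_intros simp: power2_eq_square)
    ultimately show "\<exists>y. ((\<lambda>u. 2 * u + u ^ 3 - ?g u) has_real_derivative y) (at u) \<and> 0 \<le> y"
      by (intro exI[of _ "(2 + 3 * u\<^sup>2) - 2 / (1 - u\<^sup>2)"]) auto
  qed
  then show ?up by simp
qed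

lemma (in prob_space) prob_ge_exp_moment:
  assumes "Z \<in> borel_measurable M" "0 < t" "(\<integral>\<^sup>+\<omega>. ennreal (exp (t * Z \<omega>)) \<partial>M) \<le> ennreal K" "0 \<le> K"
  shows "\<P>(\<omega> in M. v \<le> Z \<omega>) \<le> K * exp (- t * v)"
proof -
  have "emeasure M {\<omega> \<in> space M. v \<le> Z \<omega>} \<le> ennreal (exp (- t * v)) * (\<integral>\<^sup>+\<omega>. ennreal (exp (t * Z \<omega>)) * indicator (space M) \<omega> \<partial>M)"
    using assms by (intro Chernoff_ineq_nn_integral_ge) auto
  also have "(\<integral>\<^sup>+\<omega>. ennreal (exp (t * Z \<omega>)) * indicator (space M) \<omega> \<partial>M) = (\<integral>\<^sup>+\<omega>. ennreal (exp (t * Z \<omega>)) \<partial>M)"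
    by (intro nn_integral_cong) auto
  also have "ennreal (exp (- t * v)) * \<dots> \<le> ennreal (exp (- t * v)) * ennreal K"
    by (intro mult_left_mono assms) auto
  also have "\<dots> = ennreal (K * exp (- t * v))"
    using assms by (simp add: ennreal_mult mult.commute)
  finally show ?thesis
    using assms by (simp add: emeasure_eq_measure)
qed

lemma passage_zero_corner_Suc:
  "passage (zero_corner w) (Suc m) (Suc n) =
    max (passage (\<lambda>i j. w (Suc i) j) m (Suc n)) (passage (\<lambda>i j. w j (Suc i)) n (Suc m))"
proof -
  have "zero_corner w (Suc i) = w (Suc i)" for i by (simp add: zero_corner_def fun_eq_iff)
  moreover have "zero_corner w i (Suc j) = w i (Suc j)" for i j by (simp add: zero_corner_def)
  ultimately show ?thesis
    unfolding passage_first_step[of "zero_corner w"]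
    using passage_transpose[of "\<lambda>i j. w i (Suc j)" n "Suc m"] by (simp add: zero_corner_def[of w 0 0])
qed

lemma prob_passage_eq:
  assumes "exp_family M X c ({..m} \<times> {..n})" "exp_family N Y c ({..m} \<times> {..n})" "S \<in> sets borel"
  shows "\<P>(\<omega> in M. passage (\<lambda>i j. X (i, j) \<omega>) m n \<in> S) = \<P>(\<omega> in N. passage (\<lambda>i j. Y (i, j) \<omega>) m n \<in> S)"
proof -
  have "measure (distr M borel (\<lambda>\<omega>. passage (\<lambda>i j. X (i, j) \<omega>) m n)) S = measure (distr N borel (\<lambda>\<omega>. passage (\<lambda>i j. Y (i, j) \<omega>) m n)) S"
    by (simp add: exp_family_passage_law[OF assms(1,2)])
  then show ?thesis
    using assms measurable_exp_passage[OF assms(1)] measurable_exp_passage[OF assms(2)]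
    by (simp add: measure_distr vimage_def Int_def conj_commute)
qed

lemma power_le_exp_mult:
  fixes a :: real assumes "0 \<le> a" "a \<le> exp u" shows "a ^ n \<le> exp (real n * u)"
  using power_mono[OF assms(2,1), of n] by (simp add: exp_of_nat_mult)

text \<open>In the model with bottom rate \<open>b\<close> and left rate \<open>a\<close> the negative exponential moment bounds the
  lower tail, and a path uses only one of the two boundaries.\<close>

lemma prob_two_boundaries:
  assumes X: "exp_family M X (\<lambda>(i, j). if j = 0 then b else 1) ({..m} \<times> {..Suc n})"
    and Y: "exp_family N Y (\<lambda>(i, j). if j = 0 then a else 1) ({..n} \<times> {..Suc m})"
    and ab: "0 < a" "0 < b" "0 < u" "a + b = 1 - u"
    and K: "(b / (b + u)) ^ Suc m * (a / (a + u)) ^ Suc n \<le> K"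
  shows "1 \<le> K * exp (u * v) + \<P>(\<omega> in M. v < passage (\<lambda>i j. X (i, j) \<omega>) m (Suc n))
    + \<P>(\<omega> in N. v < passage (\<lambda>i j. Y (i, j) \<omega>) n (Suc m))"
proof -
  let ?K = "{..Suc m} \<times> {..Suc n}"
  \<comment> \<open>The interior rate \<open>a + (b - - u)\<close> equals 1; the double minus is the
    exponent \<open>t = - u\<close> of the moment formula.\<close>
  define c where "c = (\<lambda>(i :: nat, j :: nat). if j = 0 then b else if i = 0 then a else a + (b - - u))"
  let ?P = "Pi\<^sub>M ?K (\<lambda>p. exp_law (c p))"
  have Z: "exp_family ?P (\<lambda>p \<omega>. \<omega> p) c ?K"
    by (rule exp_family_PiM) (use ab in \<open>auto simp: c_def\<close>)
  interpret P: prob_space ?P using Z by (simp add: exp_family_def)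
  define H where "H = (\<lambda>\<omega> :: nat \<times> nat \<Rightarrow> real. passage (zero_corner (\<lambda>i j. \<omega> (i, j))) (Suc m) (Suc n))"
  have Hm: "H \<in> borel_measurable ?P" unfolding H_def
  proof (rule measurable_passage)
    fix i j :: nat assume "i \<le> Suc m" "j \<le> Suc n"
    then have "(\<lambda>\<omega>. \<omega> (i, j)) \<in> borel_measurable ?P"
      by (intro exp_family_measurable[OF Z]) auto
    then show "(\<lambda>x. zero_corner (\<lambda>i j. x (i, j)) i j) \<in> borel_measurable ?P"
      by (auto simp: zero_corner_def)
  qed
  have X': "exp_family ?P (\<lambda>p \<omega>. \<omega> (case p of (i, j) \<Rightarrow> (Suc i, j))) (\<lambda>(i, j). if j = 0 then b else 1) ({..m} \<times> {..Suc n})"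
    by (rule exp_family_reindex[OF Z]) (use ab in \<open>auto simp: inj_on_def c_def\<close>)
  have Y': "exp_family ?P (\<lambda>p \<omega>. \<omega> (case p of (i, j) \<Rightarrow> (j, Suc i))) (\<lambda>(i, j). if j = 0 then a else 1) ({..n} \<times> {..Suc m})"
    by (rule exp_family_reindex[OF Z]) (use ab in \<open>auto simp: inj_on_def c_def\<close>)
  have "(\<integral>\<^sup>+\<omega>. ennreal (exp (- u * H \<omega>)) \<partial>?P) = ennreal ((b / (b - - u)) ^ Suc m * (\<Prod>j=1..Suc n. a / (a - - u)))"
    unfolding H_def c_def by (rule exp_moment_boundary[OF Z[unfolded c_def]]) (use ab in auto)
  also have "\<dots> \<le> ennreal K"
    using K by (simp only: prod_constant card_atLeastAtMost diff_Suc_1 diff_minus_eq_add ennreal_leI)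
  finally have mom: "(\<integral>\<^sup>+\<omega>. ennreal (exp (- u * H \<omega>)) \<partial>?P) \<le> ennreal K" .
  have "0 \<le> (b / (b + u)) ^ Suc m * (a / (a + u)) ^ Suc n" using ab by simp
  then have "0 \<le> K" using K by (rule order.trans)
  then have 0: "\<P>(\<omega> in ?P. H \<omega> \<le> v) \<le> K * exp (u * v)"
    using P.prob_ge_exp_moment[of "\<lambda>\<omega>. - H \<omega>" u K "- v"] Hm ab(3) mom by simp
  let ?X = "{\<omega> \<in> space ?P. v < passage (\<lambda>i j. \<omega> (Suc i, j)) m (Suc n)}"
  let ?Y = "{\<omega> \<in> space ?P. v < passage (\<lambda>i j. \<omega> (j, Suc i)) n (Suc m)}"
  have "1 = P.prob ({\<omega> \<in> space ?P. H \<omega> \<le> v} \<union> ?X \<union> ?Y)"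
    unfolding P.prob_space[symmetric]
    by (rule arg_cong[of _ _ P.prob]) (auto simp: H_def passage_zero_corner_Suc simp del: passage.simps)
  also have "\<dots> \<le> \<P>(\<omega> in ?P. H \<omega> \<le> v) + P.prob ?X + P.prob ?Y"
    using Hm[unfolded borel_measurable_iff_le] measurable_exp_passage[OF X', unfolded borel_measurable_iff_greater]
      measurable_exp_passage[OF Y', unfolded borel_measurable_iff_greater]
    by (intro order.trans[OF measure_Un_le] add_mono order.refl sets.Un) auto
  also have "P.prob ?X = \<P>(\<omega> in M. v < passage (\<lambda>i j. X (i, j) \<omega>) m (Suc n))"
    using prob_passage_eq[OF X X', of "{v<..}"] by simp
  also have "P.prob ?Y = \<P>(\<omega> in N. v < passage (\<lambda>i j. Y (i, j) \<omega>) n (Suc m))"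
    using prob_passage_eq[OF Y Y', of "{v<..}"] by simp
  finally show ?thesis using 0 by simp
qed

text \<open>With equal rates on both boundaries the two kinds of paths are equally likely to be
  large, so each gets at least half of the probability left by the moment bound. The correction
  \<open>1 / s\<close> makes that bound equal to \<open>exp (- 2)\<close>, whatever \<open>k\<close>
  is.\<close>

lemma prob_passage_square_ge:
  assumes X: "exp_family M X (\<lambda>(i, j). if j = 0 then 1/2 - s else 1) ({..k} \<times> {..Suc k})"
    and s: "0 < s" "s \<le> 1/4"
  shows "1/4 \<le> \<P>(\<omega> in M. 4 * real (Suc k) - 1 / s < passage (\<lambda>i j. X (i, j) \<omega>) k (Suc k))"
proof -
  define q where "q = (1/2 - s) / (1/2 - s + 2 * s)"
  have q: "0 \<le> q" "q \<le> exp (- (4 * s))"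
  proof -
    show "0 \<le> q" using s by (auto simp: q_def)
    have "q = exp (- ln ((1 + 2 * s) / (1 - 2 * s)))"
      using s by (simp add: q_def exp_minus divide_simps) (simp add: algebra_simps)
    also have "\<dots> \<le> exp (- (4 * s))"
    proof -
      have "0 \<le> 2 * (2 * s) ^ 3 / 3" using s by simp
      then have "4 * s \<le> ln ((1 + 2 * s) / (1 - 2 * s))"
        using ln_artanh_bounds(1)[of "2 * s"] s by linarith
      then show ?thesis by simp
    qed
    finally show "q \<le> exp (- (4 * s))" .
  qed
  have "q ^ Suc k * q ^ Suc k \<le> exp (real (Suc k) * - (4 * s)) * exp (real (Suc k) * - (4 * s))"
    using q by (intro mult_mono power_le_exp_mult) auto
  from prob_two_boundaries[OF X X _ _ _ _ this[unfolded q_def], of "4 * real (Suc k) - 1 / s"] s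
  have "1 \<le> exp (real (Suc k) * - (4 * s)) * exp (real (Suc k) * - (4 * s)) * exp (2 * s * (4 * real (Suc k) - 1 / s))
    + 2 * \<P>(\<omega> in M. 4 * real (Suc k) - 1 / s < passage (\<lambda>i j. X (i, j) \<omega>) k (Suc k))"
    by simp
  also have "exp (real (Suc k) * - (4 * s)) * exp (real (Suc k) * - (4 * s)) * exp (2 * s * (4 * real (Suc k) - 1 / s)) = exp (- 2)"
    using s by (simp add: mult_exp_exp algebra_simps)
  also have "exp (- 2) \<le> (1/2 :: real)"
    using exp_ge_add_one_self[of 2] by (simp add: exp_minus field_simps)
  finally show ?thesis by simp
qed

text \<open>Proof by elimination: a left boundary of rate \<open>1/2 + d\<close> is added. The model
  with both boundaries exceeds the level with high probability, the paths along the left boundary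
  rarely do, so the paths along the bottom row must.\<close>

lemma prob_passage_le:
  assumes X: "exp_family M X (\<lambda>(i, j). if j = 0 then 1/2 - 2 * d else 1) ({..x'} \<times> {..y})"
    and d: "0 < d" "d \<le> 1/8" and y: "1 \<le> y" "y \<le> Suc x'"
  shows "\<P>(\<omega> in M. passage (\<lambda>i j. X (i, j) \<omega>) x' y \<le> 2 * real (Suc x' + y) + 20 * d\<^sup>2 * real y)
    \<le> 3 * exp (- 12 * d ^ 3 * real y)"
proof -
  interpret M: prob_space M using X by (simp add: exp_family_def)
  \<comment> \<open>Per diagonal step, the exponential moments with tilt \<open>d\<close> correspond
    to \<open>4 + 34 * d^2\<close> for both boundaries together and to \<open>4 + 8 * d^2\<close>
    for the left one alone. The coefficient 20 lies in between, with margins 14 and 12, which become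
    the exponents below.\<close>
  define v where "v = 2 * real (Suc x' + y) + 20 * d\<^sup>2 * real y"
  obtain y' where y': "y = Suc y'" using y by (cases y) auto
  let ?x = "Suc x'"
  let ?k = "exp (real (?x - y) * (- 2 * d)) * exp (real y * (- 4 * d - 34 * d ^ 3))" and ?l = "exp (real (?x - y) * (2 * d)) * exp (real y * (4 * d + 8 * d ^ 3))"
  let ?K = "{..y'} \<times> {..?x}"
  define c where "c = (\<lambda>(i :: nat, j :: nat). if j = 0 then 1/2 + d else 1)"
  let ?N = "Pi\<^sub>M ?K (\<lambda>p. exp_law (c p))"
  have Y: "exp_family ?N (\<lambda>p \<omega>. \<omega> p) (\<lambda>(i, j). if j = 0 then 1/2 + d else 1) ?K"
    unfolding c_def[symmetric] by (rule exp_family_PiM) (use d in \<open>auto simp: c_def\<close>)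
  interpret N: prob_space ?N using Y by (simp add: exp_family_def)
  have xy: "real ?x = real y + real (?x - y)" using y by simp
  have art1: "ln ((1 + 2 * d) / (1 - 2 * d)) \<le> 4 * d + 8 * d ^ 3"
    using ln_artanh_bounds(2)[of "2 * d"] d by (simp add: power_mult_distrib)
  have art2: "8 * d + 42 * d ^ 3 \<le> ln ((1 + 4 * d) / (1 - 4 * d))"
  proof -
    have "8 * d + 128 * d ^ 3 / 3 \<le> ln ((1 + 4 * d) / (1 - 4 * d))"
      using ln_artanh_bounds(1)[of "4 * d"] d by (simp add: power_mult_distrib)
    moreover have "0 < d ^ 3" using d by simp
    ultimately show ?thesis by linarith
  qed
  define a where "a = (1/2 - 2 * d) / (1/2 - 2 * d + d)"
  define e where "e = (1/2 + d) / (1/2 + d + d)"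
  have a0: "0 \<le> a" "0 \<le> e" using d by (auto simp: a_def e_def)
  have a: "a \<le> exp (- 2 * d)"
  proof -
    have "a \<le> 1 + - 2 * d" using d by (simp add: a_def field_simps)
    then show ?thesis using exp_ge_add_one_self[of "- 2 * d"] by linarith
  qed
  have ae: "a * e \<le> exp (- 4 * d - 34 * d ^ 3)"
  proof -
    have "a = (1 - 4 * d) / (1 - 2 * d)" "e = (1 + 2 * d) / (1 + 4 * d)"
      using d by (auto simp: a_def e_def divide_simps) (auto simp: algebra_simps)
    then have "a * e = exp (ln ((1 + 2 * d) / (1 - 2 * d)) - ln ((1 + 4 * d) / (1 - 4 * d)))"
      using d by (simp add: exp_diff)
    also have "\<dots> \<le> exp (- 4 * d - 34 * d ^ 3)"
      using art1 art2 by simp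
    finally show ?thesis .
  qed
  have "a ^ Suc x' * e ^ Suc y' = a ^ (?x - y) * (a * e) ^ y"
  proof -
    have "a ^ ?x = a ^ (?x - y) * a ^ y" using y by (simp only: power_add[symmetric] le_add_diff_inverse2)
    then show ?thesis by (simp only: y' power_mult_distrib mult.assoc)
  qed
  also have "\<dots> \<le> ?k"
    using a0 a ae by (intro mult_mono power_le_exp_mult) auto
  finally have K: "a ^ Suc x' * e ^ Suc y' \<le> ?k" .
  have 1: "1 \<le> ?k * exp (d * v)
    + \<P>(\<omega> in M. v < passage (\<lambda>i j. X (i, j) \<omega>) x' (Suc y'))
    + \<P>(\<omega> in ?N. v < passage (\<lambda>i j. \<omega> (i, j)) y' ?x)"
    by (rule prob_two_boundaries[OF X[unfolded y'] Y _ _ _ _ K[unfolded a_def e_def]]) (use d in auto)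
  have "?k * exp (d * v) = exp (- 14 * d ^ 3 * real y)"
    unfolding mult_exp_exp v_def of_nat_add xy by (simp add: algebra_simps power2_eq_square power3_eq_cube)
  also have "\<dots> \<le> exp (- 12 * d ^ 3 * real y)"
    using d by (simp add: mult_right_mono)
  finally have 2: "?k * exp (d * v) \<le> exp (- 12 * d ^ 3 * real y)" .
  define f where "f = 1 / (1 - 2 * d)"
  define g where "g = 1 + 2 * d"
  \<comment> \<open>With \<open>z = 1/2\<close> and \<open>t = d\<close> the boundary row
    contributes the factor 2 and every other row the factor \<open>g\<close>.\<close>
  let ?r = "\<lambda>j. ((if j = 0 then 1/2 + d else 1) - 1/2 + d) / ((if j = 0 then 1/2 + d else 1) - 1/2)"
  have "(\<integral>\<^sup>+\<omega>. ennreal (exp (d * passage (\<lambda>i j. \<omega> (i, j)) y' ?x)) \<partial>?N) \<le>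
    ennreal ((1/2 / (1/2 - d)) ^ Suc y' * (\<Prod>j\<le>?x. ?r j))"
    using d by (intro passage_exp_moment_le[OF Y, of d "1/2", unfolded prod.case]) auto
  also have "(1/2 / (1/2 - d)) ^ Suc y' * (\<Prod>j\<le>?x. ?r j) = 2 * (g ^ (?x - y) * (g * f) ^ y)"
  proof -
    have "(\<Prod>j\<le>?x. ?r j) = 2 * g ^ ?x"
    proof -
      have F: "((1/2 + d) - 1/2 + d) / ((1/2 + d) - 1/2) = 2" "(1 - 1/2 + d) / (1 - 1/2) = g"
        using d by (simp_all add: g_def field_simps)
      show ?thesis
        unfolding prod.atMost_Suc_shift
        by (simp only: F if_True if_False nat.distinct(2) simp_thms prod_constant card_atMost)
    qed
    moreover have "1/2 / (1/2 - d) = f" using d by (simp add: f_def field_simps)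
    moreover have "g ^ ?x = g ^ (?x - y) * g ^ y" using y by (simp only: power_add[symmetric] le_add_diff_inverse2)
    ultimately show ?thesis by (simp only: y' power_mult_distrib mult_ac)
  qed
  also have "ennreal \<dots> \<le> ennreal (2 * ?l)"
  proof (intro ennreal_leI mult_mono power_le_exp_mult)
    show "g \<le> exp (2 * d)" unfolding g_def by (rule exp_ge_add_one_self)
    have "g * f = exp (ln ((1 + 2 * d) / (1 - 2 * d)))" using d by (simp add: g_def f_def)
    also have "\<dots> \<le> exp (4 * d + 8 * d ^ 3)" using art1 by simp
    finally show "g * f \<le> exp (4 * d + 8 * d ^ 3)" .
  qed (use d in \<open>auto simp: g_def f_def\<close>)
  finally have mom: "(\<integral>\<^sup>+\<omega>. ennreal (exp (d * passage (\<lambda>i j. \<omega> (i, j)) y' ?x)) \<partial>?N) \<le>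
    ennreal (2 * ?l)" .
  have "\<P>(\<omega> in ?N. v < passage (\<lambda>i j. \<omega> (i, j)) y' ?x) \<le> \<P>(\<omega> in ?N. v \<le> passage (\<lambda>i j. \<omega> (i, j)) y' ?x)"
    using measurable_exp_passage[OF Y] by (intro N.finite_measure_mono) (auto simp: borel_measurable_iff_ge)
  also have "\<dots> \<le> (2 * ?l) * exp (- d * v)"
    by (rule N.prob_ge_exp_moment[OF _ _ mom]) (use d measurable_exp_passage[OF Y] in auto)
  also have "\<dots> = 2 * (?l * exp (- d * v))" by simp
  also have "\<dots> = 2 * exp (- 12 * d ^ 3 * real y)"
    unfolding mult_exp_exp v_def of_nat_add xy by (simp add: algebra_simps power2_eq_square power3_eq_cube)
  finally have 3: "\<P>(\<omega> in ?N. v < passage (\<lambda>i j. \<omega> (i, j)) y' ?x) \<le> 2 * exp (- 12 * d ^ 3 * real y)" .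
  have "\<P>(\<omega> in M. passage (\<lambda>i j. X (i, j) \<omega>) x' y \<le> v) = M.prob (space M - {\<omega> \<in> space M. v < passage (\<lambda>i j. X (i, j) \<omega>) x' y})"
    by (rule arg_cong[of _ _ M.prob]) auto
  also have "\<dots> = 1 - \<P>(\<omega> in M. v < passage (\<lambda>i j. X (i, j) \<omega>) x' y)"
    using measurable_exp_passage[OF X] by (intro M.prob_compl) (simp add: borel_measurable_iff_greater)
  finally show ?thesis using 1 2 3 by (simp add: v_def y' del: passage.simps)
qed

text \<open>Ottaviani's maximal inequality along a diagonal: from the first point \<open>(a + dx, a + dy)\<close>
  at which the passage time is large one continues to \<open>(n + dx, n + dy)\<close> through fresh weights.\<close>

lemma prob_diagonal_maximal:
  assumes X: "exp_family M X (\<lambda>(i, j). if j = 0 \<or> j = n + dy then 1/2 - s else 1) ({..n + dx} \<times> {..n + dy})"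
    and s: "0 < s" "s \<le> 1/4" and dy: "1 \<le> dy"
  shows "\<P>(\<omega> in M. \<exists>a<n. h + 4 * real a < passage (\<lambda>i j. X (i, j) \<omega>) (a + dx) (a + dy))
    \<le> 4 * \<P>(\<omega> in M. h + 4 * real n - 1 / s < passage (\<lambda>i j. X (i, j) \<omega>) (n + dx) (n + dy))"
proof -
  interpret prob_space M using X by (simp add: exp_family_def)
  let ?K = "{..n + dx} \<times> {..n + dy}"
  let ?A = "\<lambda>a. {..a + dx} \<times> {..n + dy}" and ?B = "\<lambda>a. {Suc (a + dx)..n + dx} \<times> {..n + dy}"
  let ?x = "\<lambda>\<omega> p. X p \<omega>" and ?r = "\<lambda>K \<omega>. restrict (\<lambda>p. X p \<omega>) K"
  let ?SA = "\<lambda>a. Pi\<^sub>M (?A a) (\<lambda>_. borel :: real measure)" and ?SB = "\<lambda>a. Pi\<^sub>M (?B a) (\<lambda>_. borel :: real measure)"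
  have ind: "indep_vars (\<lambda>_. borel) X ?K" using X by (simp add: exp_family_def)
  define T where "T = (\<lambda>(y :: nat \<times> nat \<Rightarrow> real) a. passage (\<lambda>i j. y (i, j)) (a + dx) (a + dy))"
  define U where "U = (\<lambda>(y :: nat \<times> nat \<Rightarrow> real) a. passage (\<lambda>i j. y (Suc (a + dx + i), a + dy + j)) (n - a - 1) (n - a))"
  define E where "E = (\<lambda>a. {\<omega> \<in> space M. h + 4 * real a < T (?x \<omega>) a})"
  define G where "G = (\<lambda>a. {\<omega> \<in> space M. 4 * real (n - a) - 1 / s < U (?x \<omega>) a})"
  define R where "R = {\<omega> \<in> space M. h + 4 * real n - 1 / s < T (?x \<omega>) n}"
  define SA where "SA = (\<lambda>a. {y \<in> space (?SA a). h + 4 * real a < T y a \<and> (\<forall>b<a. \<not> h + 4 * real b < T y b)})"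
  define SB where "SB = (\<lambda>a. {y \<in> space (?SB a). 4 * real (n - a) - 1 / s < U y a})"
  have Xm: "X p \<in> borel_measurable M" if "p \<in> ?K" for p by (rule exp_family_measurable[OF X that])
  have Tm: "(\<lambda>\<omega>. T (?x \<omega>) a) \<in> borel_measurable M" if "a \<le> n" for a
    unfolding T_def using that by (intro measurable_passage Xm) auto
  have Um: "(\<lambda>\<omega>. U (?x \<omega>) a) \<in> borel_measurable M" if "a < n" for a
    unfolding U_def using that by (intro measurable_passage Xm) auto
  have TmA: "(\<lambda>y. T y b) \<in> borel_measurable (?SA a)" if "b \<le> a" "a < n" for a b
    unfolding T_def using that by (intro measurable_passage measurable_component_singleton) auto
  have UmB: "(\<lambda>y. U y a) \<in> borel_measurable (?SB a)" if "a < n" for a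
    unfolding U_def using that by (intro measurable_passage measurable_component_singleton) auto
  have E_sets: "E a \<in> events" if "a \<le> n" for a
    unfolding E_def using Tm[OF that] by (simp add: borel_measurable_iff_greater)
  have G_sets: "G a \<in> events" if "a < n" for a
    unfolding G_def using Um[OF that] by (simp add: borel_measurable_iff_greater)
  have R_sets: "R \<in> events"
    unfolding R_def using Tm[of n] by (simp add: borel_measurable_iff_greater)
  have SA_sets: "SA a \<in> sets (?SA a)" if "a < n" for a
  proof -
    have "SA a = {y \<in> space (?SA a). h + 4 * real a < T y a} -
        (\<Union>b\<in>{..<a}. {y \<in> space (?SA a). h + 4 * real b < T y b})"
      by (auto simp: SA_def)
    also have "\<dots> \<in> sets (?SA a)"
      using TmA[of _ a, unfolded borel_measurable_iff_greater] that
      by (intro sets.Diff sets.finite_UN) auto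
    finally show ?thesis .
  qed
  have SB_sets: "SB a \<in> sets (?SB a)" if "a < n" for a
    unfolding SB_def using UmB[OF that] by (simp add: borel_measurable_iff_greater)
  have D_eq: "disjointed E a = ?r (?A a) -` SA a \<inter> space M" if "a < n" for a
  proof -
    have "T (?r (?A a) \<omega>) b = T (?x \<omega>) b" if "b \<le> a" for \<omega> b
      unfolding T_def using that \<open>a < n\<close> by (intro passage_cong) auto
    moreover have "?r (?A a) \<omega> \<in> space (?SA a)" for \<omega>
      by (simp add: space_PiM)
    ultimately show ?thesis
      unfolding disjointed_def E_def SA_def by auto
  qed
  have G_eq: "G a = ?r (?B a) -` SB a \<inter> space M" if "a < n" for a
  proof -
    have "U (?r (?B a) \<omega>) a = U (?x \<omega>) a" for \<omega>
      unfolding U_def using that by (intro passage_cong) auto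
    moreover have "?r (?B a) \<omega> \<in> space (?SB a)" for \<omega>
      by (simp add: space_PiM)
    ultimately show ?thesis
      unfolding G_def SB_def by auto
  qed
  have D_sets: "disjointed E a \<in> events" if "a < n" for a
    unfolding disjointed_def using E_sets that by (intro sets.Diff sets.finite_UN) auto
  \<comment> \<open>The event of the first exceedance at \<open>a\<close> depends only on columns up
    to \<open>a + dx\<close>, the event \<open>G a\<close> only on later columns.\<close>
  have indep: "prob (disjointed E a \<inter> G a) = prob (disjointed E a) * prob (G a)" if "a < n" for a
  proof -
    have iv: "indep_var (?SA a) (?r (?A a)) (?SB a) (?r (?B a))"
      by (rule indep_var_restrict[OF ind]) (use that in auto)
    have "disjointed E a \<inter> G a = (\<lambda>\<omega>. (?r (?A a) \<omega>, ?r (?B a) \<omega>)) -` (SA a \<times> SB a) \<inter> space M"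
      unfolding D_eq[OF that] G_eq[OF that] by auto
    then show ?thesis
      using indep_varD[OF iv SA_sets[OF that] SB_sets[OF that]] D_eq[OF that] G_eq[OF that] by simp
  qed
  \<comment> \<open>Read backwards, the fresh piece starts in row \<open>n + dy\<close>, whose rate
    \<open>1/2 - s\<close> supplies the boundary needed for a lower bound; this is what the heavy
    last row is for. As \<open>1 \<le> dy\<close>, the heavy row 0 lies outside the piece.\<close>
  have G_prob: "1/4 \<le> prob (G a)" if a: "a < n" for a
  proof -
    define k where "k = n - a - 1"
    have k: "n - a = Suc k" using a by (simp add: k_def)
    define f where "f = (\<lambda>(i, j). (Suc (a + dx + (k - i)), a + dy + (Suc k - j)))"
    have "exp_family M (\<lambda>l. X (f l)) (\<lambda>(i, j). if j = 0 then 1/2 - s else 1) ({..k} \<times> {..Suc k})"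
      by (rule exp_family_reindex[OF X]) (use k a dy in \<open>auto simp: f_def inj_on_def\<close>)
    from prob_passage_square_ge[OF this s]
    have *: "1/4 \<le> \<P>(\<omega> in M. 4 * real (Suc k) - 1 / s < passage (\<lambda>i j. X (f (i, j)) \<omega>) k (Suc k))" .
    have eq: "passage (\<lambda>i j. X (f (i, j)) \<omega>) k (Suc k) = U (?x \<omega>) a" for \<omega>
      using passage_rev[of "\<lambda>i j. X (Suc (a + dx + i), a + dy + j) \<omega>" k "Suc k"]
      unfolding U_def f_def prod.case k by (simp del: passage.simps add: k)
    show ?thesis using * unfolding G_def k eq .
  qed
  have sub: "E a \<inter> G a \<subseteq> R" if a: "a < n" for a
  proof
    fix \<omega> assume w: "\<omega> \<in> E a \<inter> G a"
    have "T (?x \<omega>) a + U (?x \<omega>) a \<le> T (?x \<omega>) n"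
      unfolding T_def U_def
      using passage_superadd[of "\<lambda>i j. X (i, j) \<omega>" "a + dx" "a + dy" "n - a - 1" "n - a"] a
      by (simp add: add.commute[of dx] add.commute[of dy])
    then show "\<omega> \<in> R"
      using w a by (auto simp: E_def G_def R_def of_nat_diff)
  qed
  have "prob (\<Union>a\<in>{0..<n}. E a) = prob (\<Union>a\<in>{0..<n}. disjointed E a)"
    by (simp add: finite_UN_disjointed_eq)
  also have "\<dots> = (\<Sum>a\<in>{0..<n}. prob (disjointed E a))"
    using D_sets disjoint_family_disjointed[of E]
    by (intro finite_measure_finite_Union) (auto simp: disjoint_family_on_def)
  also have "\<dots> \<le> (\<Sum>a\<in>{0..<n}. 4 * prob (disjointed E a \<inter> G a))"
  proof (rule sum_mono)
    fix a assume "a \<in> {0..<n}"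
    then have a: "a < n" by simp
    have "prob (disjointed E a) * (1/4) \<le> prob (disjointed E a) * prob (G a)"
      using G_prob[OF a] by (intro mult_left_mono) auto
    then show "prob (disjointed E a) \<le> 4 * prob (disjointed E a \<inter> G a)"
      using indep[OF a] by simp
  qed
  also have "\<dots> = 4 * prob (\<Union>a\<in>{0..<n}. disjointed E a \<inter> G a)"
  proof -
    have "disjoint_family_on (\<lambda>a. disjointed E a \<inter> G a) {0..<n}"
      using disjoint_family_disjointed[of E] by (auto simp: disjoint_family_on_def)
    then have "prob (\<Union>a\<in>{0..<n}. disjointed E a \<inter> G a) = (\<Sum>a\<in>{0..<n}. prob (disjointed E a \<inter> G a))"
      using D_sets G_sets by (intro finite_measure_finite_Union) auto
    then show ?thesis by (simp add: sum_distrib_left)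
  qed
  also have "\<dots> \<le> 4 * prob R"
  proof (intro mult_left_mono finite_measure_mono R_sets)
    have "disjointed E a \<subseteq> E a" for a by (auto simp: disjointed_def)
    then show "(\<Union>a\<in>{0..<n}. disjointed E a \<inter> G a) \<subseteq> R" using sub by fastforce
  qed simp
  also have "(\<Union>a\<in>{0..<n}. E a) = {\<omega> \<in> space M. \<exists>a<n. h + 4 * real a < passage (\<lambda>i j. X (i, j) \<omega>) (a + dx) (a + dy)}"
    by (auto simp: E_def T_def)
  finally show ?thesis by (simp add: R_def T_def)
qed

text \<open>A Chernoff bound at the end of the diagonal with tilt \<open>s\<close> and
  \<open>z = 1/2 - 2 * s\<close>. Each heavy row contributes a factor 2, the maximal inequality a
  factor 4, and its loss \<open>1 / s\<close> in the level costs only \<open>exp 1\<close>.\<close>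

lemma prob_diagonal_moment:
  assumes X: "exp_family M X (\<lambda>(i, j). if j = 0 \<or> j = n + dy then 1/2 - s else 1) ({..n + dx} \<times> {..n + dy})"
    and s: "0 < s" "s \<le> 1/12" and dy: "1 \<le> dy"
  shows "\<P>(\<omega> in M. \<exists>a<n. h + 4 * real a < passage (\<lambda>i j. X (i, j) \<omega>) (a + dx) (a + dy))
    \<le> 16 * (((1 - 4 * s) / (1 - 6 * s)) ^ (n + dx + 1) * ((1 + 6 * s) / (1 + 4 * s)) ^ (n + dy - 1) * exp (1 - s * h - 4 * s * real n))"
proof -
  interpret prob_space M using X by (simp add: exp_family_def)
  define F where "F = (1 - 4 * s) / (1 - 6 * s)"
  define G where "G = (1 + 6 * s) / (1 + 4 * s)"
  define Z where "Z = (\<lambda>\<omega>. passage (\<lambda>i j. X (i, j) \<omega>) (n + dx) (n + dy))"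
  define v where "v = h + 4 * real n - 1 / s"
  have FG: "0 \<le> F" "0 \<le> G" using s by (auto simp: F_def G_def)
  have Zm: "Z \<in> borel_measurable M" unfolding Z_def by (rule measurable_exp_passage[OF X])
  let ?r = "\<lambda>j. ((if j = 0 \<or> j = n + dy then 1/2 - s else 1) - (1/2 - 2 * s) + s) / ((if j = 0 \<or> j = n + dy then 1/2 - s else 1) - (1/2 - 2 * s))"
  let ?g = "\<lambda>j. if j = 0 \<or> j = n + dy then 2 else G"
  have "(\<integral>\<^sup>+\<omega>. ennreal (exp (s * Z \<omega>)) \<partial>M) \<le>
    ennreal (((1/2 - 2 * s) / (1/2 - 2 * s - s)) ^ Suc (n + dx) *
      (\<Prod>j\<le>n + dy. ?r j))"
    unfolding Z_def using s by (intro passage_exp_moment_le[OF X, of s "1/2 - 2 * s", unfolded prod.case]) auto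
  also have "(1/2 - 2 * s) / (1/2 - 2 * s - s) = F"
    using s by (simp add: F_def divide_simps) (simp add: algebra_simps)
  also have "(\<Prod>j\<le>n + dy. ?r j) = (\<Prod>j\<le>n + dy. ?g j)"
  proof (rule prod.cong[OF refl])
    fix j
    have "(1/2 - s - (1/2 - 2 * s) + s) / (1/2 - s - (1/2 - 2 * s)) = 2" using s by simp
    moreover have "(1 - (1/2 - 2 * s) + s) / (1 - (1/2 - 2 * s)) = G"
      using s by (simp add: G_def divide_simps) (simp add: algebra_simps)
    ultimately show "?r j = ?g j"
      by (simp only: if_distrib split: if_split) simp
  qed
  also have "(\<Prod>j\<le>n + dy. ?g j) = 4 * G ^ (n + dy - 1)"
  proof -
    have "{..n + dy} = insert 0 (insert (n + dy) {1..<n + dy})" using dy by auto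
    then have "(\<Prod>j\<le>n + dy. ?g j) = 2 * (2 * (\<Prod>j\<in>{1..<n + dy}. ?g j))"
      using dy by simp
    also have "(\<Prod>j\<in>{1..<n + dy}. ?g j) = (\<Prod>j\<in>{1..<n + dy}. G)"
      by (intro prod.cong) auto
    finally show ?thesis by simp
  qed
  finally have mom: "(\<integral>\<^sup>+\<omega>. ennreal (exp (s * Z \<omega>)) \<partial>M) \<le> ennreal (F ^ Suc (n + dx) * (4 * G ^ (n + dy - 1)))" .
  have "\<P>(\<omega> in M. v \<le> Z \<omega>) \<le> F ^ Suc (n + dx) * (4 * G ^ (n + dy - 1)) * exp (- s * v)"
    by (rule prob_ge_exp_moment[OF Zm s(1) mom]) (use FG in simp)
  also have "exp (- s * v) = exp (1 - s * h - 4 * s * real n)"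
    using s by (simp add: v_def algebra_simps)
  finally have 1: "\<P>(\<omega> in M. v \<le> Z \<omega>) \<le> 4 * (F ^ (n + dx + 1) * G ^ (n + dy - 1) * exp (1 - s * h - 4 * s * real n))"
    by (simp add: mult_ac)
  have "\<P>(\<omega> in M. \<exists>a<n. h + 4 * real a < passage (\<lambda>i j. X (i, j) \<omega>) (a + dx) (a + dy)) \<le>
    4 * \<P>(\<omega> in M. v < Z \<omega>)"
    unfolding v_def Z_def by (rule prob_diagonal_maximal[OF X]) (use s dy in auto)
  also have "\<dots> \<le> 4 * \<P>(\<omega> in M. v \<le> Z \<omega>)"
    using Zm by (intro mult_left_mono finite_measure_mono) (auto simp: borel_measurable_iff_ge)
  finally show ?thesis using 1 by (simp add: F_def G_def)
qed

text \<open>The logarithm of the product of the two factors is odd in \<open>s\<close>, so a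
  diagonal step has only a cubic error. A vertical step alone keeps the term
  \<open>- 8 * s^2\<close>, which is the origin of the parabolic cost.\<close>

lemma tilt_bounds:
  fixes s :: real
  assumes s: "0 < s" "s \<le> 1/12"
  shows "(1 - 4 * s) / (1 - 6 * s) \<le> exp (2 * s + 24 * s\<^sup>2)"
    and "(1 + 6 * s) / (1 + 4 * s) \<le> exp (2 * s - 8 * s\<^sup>2 + 32 * s ^ 3)"
    and "(1 - 4 * s) / (1 - 6 * s) * ((1 + 6 * s) / (1 + 4 * s)) \<le> exp (4 * s + 216 * s ^ 3)"
proof -
  have "0 \<le> s\<^sup>2 * (1 - 12 * s)" using s by simp
  then have "(1 - 4 * s) / (1 - 6 * s) \<le> 1 + (2 * s + 24 * s\<^sup>2)"
    using s by (simp add: divide_simps) (simp add: algebra_simps power2_eq_square)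
  then show "(1 - 4 * s) / (1 - 6 * s) \<le> exp (2 * s + 24 * s\<^sup>2)"
    using exp_ge_add_one_self[of "2 * s + 24 * s\<^sup>2"] by linarith
  have "0 \<le> s ^ 4" by simp
  then have "(1 + 6 * s) / (1 + 4 * s) \<le> 1 + (2 * s - 8 * s\<^sup>2 + 32 * s ^ 3)"
    using s by (simp add: divide_simps) (simp add: algebra_simps power2_eq_square power3_eq_cube power4_eq_xxxx)
  then show "(1 + 6 * s) / (1 + 4 * s) \<le> exp (2 * s - 8 * s\<^sup>2 + 32 * s ^ 3)"
    using exp_ge_add_one_self[of "2 * s - 8 * s\<^sup>2 + 32 * s ^ 3"] by linarith
  have "(1 - 4 * s) / (1 - 6 * s) * ((1 + 6 * s) / (1 + 4 * s)) =
    exp (ln ((1 + 6 * s) / (1 - 6 * s)) - ln ((1 + 4 * s) / (1 - 4 * s)))"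
    using s by (simp add: exp_diff divide_simps)
  also have "\<dots> \<le> exp (4 * s + 216 * s ^ 3)"
  proof -
    have "ln ((1 + 6 * s) / (1 - 6 * s)) \<le> 12 * s + 216 * s ^ 3"
      using ln_artanh_bounds(2)[of "6 * s"] s by (simp add: power_mult_distrib)
    moreover have "8 * s + 128 * s ^ 3 / 3 \<le> ln ((1 + 4 * s) / (1 - 4 * s))"
      using ln_artanh_bounds(1)[of "4 * s"] s by (simp add: power_mult_distrib)
    moreover have "0 < s ^ 3" using s by simp
    ultimately show ?thesis unfolding exp_le_cancel_iff by linarith
  qed
  finally show "(1 - 4 * s) / (1 - 6 * s) * ((1 + 6 * s) / (1 + 4 * s)) \<le> exp (4 * s + 216 * s ^ 3)" .
qed

text \<open>Meant for the piece of a path before it touches the diagonal or the line: it stays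
  within \<open>A\<close> of the linear value, 2 per unit of each coordinate. The hypothesis
  \<open>h\<close> limits the errors of the tilt to half of the allowance \<open>A\<close>.\<close>

lemma prob_diagonal_above:
  assumes X: "exp_family M X (\<lambda>(i, j). if j = 0 \<or> j = n + 1 then 1/2 - s else 1) ({..n + dx} \<times> {..n + 1})"
    and s: "0 < s" "s \<le> 1/12" and h: "216 * s\<^sup>2 * real n + 24 * s * real (dx + 1) \<le> A / 2"
  shows "\<P>(\<omega> in M. \<exists>a<n. 2 * real (dx + 1) + A + 4 * real a < passage (\<lambda>i j. X (i, j) \<omega>) (a + dx) (a + 1))
    \<le> 16 * exp (1 - s * A / 2)"
proof -
  define F where "F = (1 - 4 * s) / (1 - 6 * s)"
  define G where "G = (1 + 6 * s) / (1 + 4 * s)"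
  have FG: "0 \<le> F" "0 \<le> G" using s by (auto simp: F_def G_def)
  note b = tilt_bounds[OF s, folded F_def G_def]
  let ?u = "exp (real n * (4 * s + 216 * s ^ 3)) * exp (real (dx + 1) * (2 * s + 24 * s\<^sup>2))" and ?v = "exp (1 - s * (2 * real (dx + 1) + A) - 4 * s * real n)"
  have "F ^ (n + dx + 1) * G ^ (n + 1 - 1) = (F * G) ^ n * F ^ (dx + 1)"
    by (simp add: power_add power_mult_distrib)
  also have "\<dots> \<le> ?u"
    using FG b by (intro mult_mono power_le_exp_mult) auto
  finally have "F ^ (n + dx + 1) * G ^ (n + 1 - 1) * ?v \<le>
    ?u * ?v"
    by (intro mult_right_mono) auto
  also have "\<dots> = exp (1 - s * A + s * (216 * s\<^sup>2 * real n + 24 * s * real (dx + 1)))"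
    unfolding mult_exp_exp by (simp add: algebra_simps power2_eq_square power3_eq_cube)
  also have "\<dots> \<le> exp (1 - s * A / 2)"
  proof -
    have "s * (216 * s\<^sup>2 * real n + 24 * s * real (dx + 1)) \<le> s * (A / 2)"
      using h s by (intro mult_left_mono) auto
    then show ?thesis unfolding exp_le_cancel_iff by linarith
  qed
  finally show ?thesis
    using prob_diagonal_moment[OF X s, of "2 * real (dx + 1) + A"] unfolding F_def G_def by simp
qed

text \<open>Meant for the piece after touching: an excess of \<open>d\<close> steps in one direction
  pushes the passage time below the linear value. Of the gain \<open>8 * s^2 * d\<close> in the
  exponent, one \<open>s^2 * d\<close> pays for lowering the level by \<open>s * d\<close>, one for
  the cubic errors along the diagonal (as \<open>216 * s * n\<close> is at most \<open>d\<close>),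
  and at most three for the cubic errors of the excess; three remain.\<close>

lemma prob_diagonal_below:
  assumes X: "exp_family M X (\<lambda>(i, j). if j = 0 \<or> j = n + d then 1/2 - s else 1) ({..n} \<times> {..n + d})"
    and s: "0 < s" "s \<le> 1/12" and d: "1 \<le> d" "216 * s * real n \<le> real d"
  shows "\<P>(\<omega> in M. \<exists>a<n. 2 * real d - s * real d + 4 * real a < passage (\<lambda>i j. X (i, j) \<omega>) a (a + d))
    \<le> 16 * exp (2 - 3 * s\<^sup>2 * real d)"
proof -
  define F where "F = (1 - 4 * s) / (1 - 6 * s)"
  define G where "G = (1 + 6 * s) / (1 + 4 * s)"
  have FG: "0 \<le> F" "0 \<le> G" using s by (auto simp: F_def G_def)
  note b = tilt_bounds[OF s, folded F_def G_def]
  let ?u = "exp (real n * (4 * s + 216 * s ^ 3)) * exp (2 * s + 24 * s\<^sup>2) * exp (real (d - 1) * (2 * s - 8 * s\<^sup>2 + 32 * s ^ 3))"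
    and ?v = "exp (1 - s * (2 * real d - s * real d) - 4 * s * real n)"
  have "n + d - 1 = n + (d - 1)" using d by simp
  then have "F ^ (n + 0 + 1) * G ^ (n + d - 1) = (F * G) ^ n * F * G ^ (d - 1)"
    by (simp add: power_add power_mult_distrib)
  also have "\<dots> \<le> ?u"
    using FG b by (intro mult_mono power_le_exp_mult) auto
  finally have "F ^ (n + 0 + 1) * G ^ (n + d - 1) * ?v \<le>
    ?u * ?v"
    by (intro mult_right_mono) auto
  also have "\<dots> = exp (1 + s\<^sup>2 * (216 * s * real n) - 7 * s\<^sup>2 * real d + 32 * s\<^sup>2 + 32 * s ^ 3 * real d - 32 * s ^ 3)"
    unfolding mult_exp_exp using d by (simp add: of_nat_diff algebra_simps power2_eq_square power3_eq_cube)
  also have "\<dots> \<le> exp (2 - 3 * s\<^sup>2 * real d)"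
  proof -
    have "s\<^sup>2 * (216 * s * real n) \<le> s\<^sup>2 * real d" using d by (intro mult_left_mono) auto
    moreover have "32 * s ^ 3 * real d \<le> 3 * s\<^sup>2 * real d"
    proof -
      have "(32 * s\<^sup>2 * real d) * s \<le> (32 * s\<^sup>2 * real d) * (1 / 12)" using s by (intro mult_left_mono) auto
      moreover have "0 \<le> s\<^sup>2 * real d" by simp
      ultimately show ?thesis by (simp add: power2_eq_square power3_eq_cube mult_ac)
    qed
    moreover have "32 * s\<^sup>2 \<le> 1"
      using power_mono[OF s(2), of 2] s by (simp add: power2_eq_square)
    moreover have "0 < s ^ 3" using s by simp
    ultimately show ?thesis unfolding exp_le_cancel_iff by linarith
  qed
  finally show ?thesis
    using prob_diagonal_moment[of M X n d s 0 "2 * real d - s * real d"] X s d unfolding F_def G_def by simp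
qed

section \<open>Exchanging path excursions\<close>

definition path_sum :: "(nat \<Rightarrow> nat \<Rightarrow> real) \<Rightarrow> (nat \<Rightarrow> nat) \<Rightarrow> nat \<Rightarrow> real" where
  "path_sum w f L = (\<Sum>k=1..L. w (f k) (k - f k))"

lemma lattice_path_mono:
  assumes "lattice_path f m n" "k \<le> l" "l \<le> m + n"
  shows "f k \<le> f l" "f l \<le> f k + (l - k)"
proof -
  have "f k \<le> f l \<and> f l \<le> f k + (l - k)"
    using assms(2,3)
  proof (induction l rule: dec_induct)
    case (step l)
    have "f (Suc l) = f l \<or> f (Suc l) = Suc (f l)" using assms(1) step by (auto simp: lattice_path_def)
    then show ?case using step by auto
  qed simp
  then show "f k \<le> f l" "f l \<le> f k + (l - k)" by auto
qed

lemma lattice_path_le_end: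
  assumes "lattice_path f m n" "k \<le> m + n"
  shows "f k \<le> m" "k - f k \<le> n"
  using lattice_path_mono[OF assms(1) assms(2)] lattice_path_le[OF assms] assms
  by (auto simp: lattice_path_def)

lemma lattice_path_Suc:
  "lattice_path f m n \<Longrightarrow> k < m + n \<Longrightarrow> f (Suc k) = f k \<or> f (Suc k) = Suc (f k)"
  by (auto simp: lattice_path_def)

definition splice :: "nat \<Rightarrow> nat \<Rightarrow> (nat \<Rightarrow> nat) \<Rightarrow> (nat \<Rightarrow> nat) \<Rightarrow> nat \<Rightarrow> nat" where
  "splice l r f g k = (if l \<le> k \<and> k \<le> r then f k else g k)"

lemma lattice_path_splice:
  assumes f: "lattice_path f m n" and g: "lattice_path g m' n'" and lr: "l \<le> r" "r \<le> m + n" "r \<le> m' + n'"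
    and eq: "f l = g l" "f r = g r"
  shows "lattice_path (splice l r f g) m' n'"
  unfolding lattice_path_def
proof (intro conjI allI impI)
  show "splice l r f g 0 = 0" using f g by (auto simp: splice_def lattice_path_def)
  show "splice l r f g (m' + n') = m'"
    using f g lr eq by (auto simp: splice_def lattice_path_def)
  fix k assume k: "k < m' + n'"
  consider "Suc k < l" | "Suc k = l" | "l \<le> k" "Suc k \<le> r" | "k = r" | "r < k" by linarith
  then show "splice l r f g (Suc k) = splice l r f g k \<or> splice l r f g (Suc k) = Suc (splice l r f g k)"
    using lattice_path_Suc[OF f, of k] lattice_path_Suc[OF g k] lr eq
    by cases (auto simp: splice_def)
qed

lemma path_sum_splice:
  assumes eq: "f l = g l" "f r = g r" and "r \<le> L"
  shows "path_sum w (splice l r f g) L = path_sum w g L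
    + (\<Sum>k\<in>{l<..<r}. w (f k) (k - f k)) - (\<Sum>k\<in>{l<..<r}. w (g k) (k - g k))"
proof -
  have I: "{l<..<r} \<subseteq> {1..L}" using assms by auto
  have "path_sum w h L = (\<Sum>k\<in>{1..L} - {l<..<r}. w (h k) (k - h k)) + (\<Sum>k\<in>{l<..<r}. w (h k) (k - h k))" for h
    unfolding path_sum_def by (rule sum.subset_diff[OF I]) simp
  moreover have "(\<Sum>k\<in>{1..L} - {l<..<r}. w (splice l r f g k) (k - splice l r f g k)) = (\<Sum>k\<in>{1..L} - {l<..<r}. w (g k) (k - g k))"
    using eq by (intro sum.cong) (auto simp: splice_def not_less le_less)
  moreover have "(\<Sum>k\<in>{l<..<r}. w (splice l r f g k) (k - splice l r f g k)) = (\<Sum>k\<in>{l<..<r}. w (f k) (k - f k))"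
    by (intro sum.cong) (auto simp: splice_def)
  ultimately show ?thesis by simp
qed

definition half_space_path :: "(nat \<Rightarrow> nat) \<Rightarrow> nat \<Rightarrow> nat \<Rightarrow> bool" where
  "half_space_path f m n \<longleftrightarrow> lattice_path f m n \<and> (\<forall>k\<le>m + n. k \<le> 2 * f k)"

definition heaviest :: "(nat \<Rightarrow> nat \<Rightarrow> real) \<Rightarrow> (nat \<Rightarrow> nat) \<Rightarrow> nat \<Rightarrow> nat \<Rightarrow> bool" where
  "heaviest w f m n \<longleftrightarrow> half_space_path f m n \<and>
     (\<forall>h. half_space_path h m n \<longrightarrow> path_sum w h (m + n) \<le> path_sum w f (m + n))"

text \<open>If \<open>f\<close> is to the right of \<open>g\<close> at level \<open>p\<close>, exchange the excursion of \<open>f\<close> around \<open>p\<close> with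
  the corresponding piece of \<open>g\<close>: in the environment \<open>w2\<close>, which is larger off the diagonal and
  smaller off the bottom row, this can only increase the weight of \<open>g\<close>.\<close>

lemma exchange_excursion:
  assumes heaviest: "heaviest w1 f m n" and half_g: "half_space_path g m' n" and m: "m \<le> m'"
    and w: "\<And>i j. j < i \<Longrightarrow> w1 i j \<le> w2 i j" "\<And>i j. 1 \<le> j \<Longrightarrow> j \<le> i \<Longrightarrow> w2 i j \<le> w1 i j"
    and p: "p \<le> m + n" "g p < f p"
  shows "\<exists>h. half_space_path h m' n \<and> h p = f p \<and> path_sum w2 g (m' + n) \<le> path_sum w2 h (m' + n)"
proof -
  have f: "lattice_path f m n" "\<And>k. k \<le> m + n \<Longrightarrow> k \<le> 2 * f k"
    and max: "\<And>h. half_space_path h m n \<Longrightarrow> path_sum w1 h (m + n) \<le> path_sum w1 f (m + n)"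
    using heaviest by (auto simp: heaviest_def half_space_path_def)
  have g: "lattice_path g m' n" "\<And>k. k \<le> m' + n \<Longrightarrow> k \<le> 2 * g k"
    using half_g by (auto simp: half_space_path_def)
  \<comment> \<open>The excursion of \<open>f\<close> to the right of \<open>g\<close> around
    \<open>p\<close> takes place between \<open>l\<close> and \<open>r\<close>. Unit steps force the
    two paths to meet at both levels.\<close>
  define l where "l = Max {k. k \<le> p \<and> f k \<le> g k}"
  define r where "r = (LEAST k. p \<le> k \<and> f k \<le> g k)"
  \<comment> \<open>At level \<open>m + n\<close> the path \<open>g\<close> has height at most
    \<open>n\<close>, hence abscissa at least \<open>m\<close>. So the excursion closes even if
    \<open>g\<close> ends further to the right.\<close>
  have end_le: "f (m + n) \<le> g (m + n)"
  proof -
    have "m + n - g (m + n) \<le> n" using m by (intro lattice_path_le_end[OF g(1)]) auto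
    then show ?thesis using f(1) by (simp add: lattice_path_def)
  qed
  have fin: "finite {k. k \<le> p \<and> f k \<le> g k}" by simp
  have ne: "0 \<in> {k. k \<le> p \<and> f k \<le> g k}" using f(1) g(1) by (auto simp: lattice_path_def)
  have l: "l \<le> p" "f l \<le> g l" using Max_in[OF fin] ne unfolding l_def by blast+
  have l_max: "g k < f k" if "l < k" "k \<le> p" for k
    using Max_ge[OF fin, of k] that unfolding l_def by (metis (mono_tags, lifting) linorder_not_le mem_Collect_eq)
  have r: "p \<le> r" "f r \<le> g r" and r_le: "r \<le> m + n"
    using LeastI[of "\<lambda>k. p \<le> k \<and> f k \<le> g k" "m + n"] Least_le[of "\<lambda>k. p \<le> k \<and> f k \<le> g k" "m + n"] end_le p
    unfolding r_def by auto
  have r_min: "g k < f k" if "p \<le> k" "k < r" for k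
    using not_less_Least[of k "\<lambda>k. p \<le> k \<and> f k \<le> g k"] that unfolding r_def by auto
  have lpr: "l < p" "p < r" using l r p by (auto simp: le_less)
  have between: "g k < f k" if "l < k" "k < r" for k
    using l_max[of k] r_min[of k] that by (cases "k \<le> p") auto
  have fl: "f l = g l"
  proof -
    have "g (Suc l) < f (Suc l)" using lpr by (intro between) auto
    moreover have "f (Suc l) \<le> Suc (f l)" using lattice_path_Suc[OF f(1), of l] lpr p by auto
    moreover have "g l \<le> g (Suc l)" using lattice_path_Suc[OF g(1), of l] lpr p m by auto
    ultimately show ?thesis using l by linarith
  qed
  have fr: "f r = g r"
  proof -
    obtain r' where r': "r = Suc r'" using lpr by (cases r) auto
    have "g r' < f r'" using lpr r' by (intro between) auto
    moreover have "f r' \<le> f r" using lattice_path_Suc[OF f(1), of r'] r' r_le by auto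
    moreover have "g r \<le> Suc (g r')" using lattice_path_Suc[OF g(1), of r'] r' r_le m by auto
    ultimately show ?thesis using r by linarith
  qed
  have r_le': "r \<le> m' + n" using r_le m by simp
  have lr: "l \<le> r" using lpr by simp
  let ?S = "\<lambda>w f. \<Sum>k\<in>{l<..<r}. w (f k) (k - f k)"
  have "path_sum w1 (splice l r g f) (m + n) \<le> path_sum w1 f (m + n)"
  proof (rule max, unfold half_space_path_def, intro conjI allI impI)
    show "lattice_path (splice l r g f) m n"
      using fl fr by (intro lattice_path_splice[OF g(1) f(1) lr r_le' r_le]) auto
    show "k \<le> 2 * splice l r g f k" if "k \<le> m + n" for k
      using f(2)[of k] g(2)[of k] that m by (auto simp: splice_def)
  qed
  then have 1: "?S w1 g \<le> ?S w1 f"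
    using path_sum_splice[of g l f r "m + n" w1] fl fr r_le by simp
  \<comment> \<open>During the excursion \<open>g\<close> is strictly left of \<open>f\<close>, so
    \<open>g\<close> is off the bottom row and \<open>f\<close> is off the diagonal. There the two
    environments are comparable in the required directions.\<close>
  have 2: "?S w2 g \<le> ?S w1 g"
  proof (rule sum_mono)
    fix k assume k: "k \<in> {l<..<r}"
    have "g k < f k" "f k \<le> k" "k \<le> 2 * g k"
      using between[of k] lattice_path_le[OF f(1), of k] g(2)[of k] k r_le m by auto
    then show "w2 (g k) (k - g k) \<le> w1 (g k) (k - g k)" by (intro w(2)) auto
  qed
  have 3: "?S w1 f \<le> ?S w2 f"
  proof (rule sum_mono)
    fix k assume k: "k \<in> {l<..<r}"
    have "g k < f k" "k \<le> 2 * g k"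
      using between[of k] g(2)[of k] k r_le m by auto
    then show "w1 (f k) (k - f k) \<le> w2 (f k) (k - f k)" by (intro w(1)) auto
  qed
  show ?thesis
  proof (unfold half_space_path_def, intro exI[of _ "splice l r f g"] conjI allI impI)
    show "lattice_path (splice l r f g) m' n"
      by (rule lattice_path_splice[OF f(1) g(1) lr r_le r_le' fl fr])
    show "k \<le> 2 * splice l r f g k" if "k \<le> m' + n" for k
      using f(2)[of k] g(2)[of k] that r_le by (auto simp: splice_def)
    show "splice l r f g p = f p" using lpr by (simp add: splice_def)
    show "path_sum w2 g (m' + n) \<le> path_sum w2 (splice l r f g) (m' + n)"
      using path_sum_splice[of f l g r "m' + n" w2] fl fr r_le' 1 2 3 by simp
  qed
qed

text \<open>The site at level \<open>k\<close> belongs to both pieces, hence the additional weight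
  on the left. The first piece starts at \<open>(1, 0)\<close> and the second is read backwards from
  \<open>(m, n)\<close>, so each is a passage time from a fixed corner to a moving site, as the
  maximal inequality requires.\<close>

lemma path_sum_split:
  assumes g: "lattice_path g m n" and g1: "g 1 = 1" and k: "1 \<le> k" "k \<le> m + n"
  shows "path_sum w g (m + n) + w (g k) (k - g k) \<le>
    passage (\<lambda>i j. w (Suc i) j) (g k - 1) (k - g k) + passage (\<lambda>i j. w (m - i) (n - j)) (m - g k) (n - (k - g k))"
proof -
  let ?w = "\<lambda>l. w (g l) (l - g l)"
  define L where "L = m + n"
  have g_ge: "1 \<le> g l" if "1 \<le> l" "l \<le> L" for l
    using lattice_path_mono(1)[OF g that(1)] that g1 by (simp add: L_def)
  note gle = lattice_path_le[OF g, folded L_def] and gend = lattice_path_le_end[OF g, folded L_def]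
  define \<phi> where "\<phi> = (\<lambda>l. g (Suc l) - 1)"
  have \<phi>: "lattice_path \<phi> (g k - 1) (k - g k)"
    unfolding lattice_path_def
  proof (intro conjI allI impI)
    show "\<phi> 0 = 0" using g1 by (simp add: \<phi>_def)
    have "g k \<le> k" "1 \<le> g k" using k gle[of k] g_ge[of k] by (auto simp: L_def)
    then have "Suc (g k - 1 + (k - g k)) = k" by simp
    then show "\<phi> (g k - 1 + (k - g k)) = g k - 1" by (simp add: \<phi>_def)
    fix l assume "l < g k - 1 + (k - g k)"
    then have "Suc l < k" using \<open>g k \<le> k\<close> \<open>1 \<le> g k\<close> by simp
    then show "\<phi> (Suc l) = \<phi> l \<or> \<phi> (Suc l) = Suc (\<phi> l)"
      using lattice_path_Suc[OF g, of "Suc l"] g_ge[of "Suc l"] k by (auto simp: \<phi>_def L_def)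
  qed
  have gk: "g k \<le> k" "1 \<le> g k" "g k \<le> m" "k - g k \<le> n" using k gle[of k] g_ge[of k] gend[of k] by (auto simp: L_def)
  have 1: "(\<Sum>l=1..k. ?w l) \<le> passage (\<lambda>i j. w (Suc i) j) (g k - 1) (k - g k)"
  proof -
    have "(\<Sum>l=1..k. ?w l) = (\<Sum>l\<le>g k - 1 + (k - g k). w (Suc (\<phi> l)) (l - \<phi> l))"
    proof (rule sum.reindex_bij_witness[of _ Suc "\<lambda>l. l - 1"])
      fix l assume l: "l \<in> {1..k}"
      then have "1 \<le> g l" "g l \<le> l" using g_ge[of l] gle[of l] k by (auto simp: L_def)
      then show "w (Suc (\<phi> (l - 1))) (l - 1 - \<phi> (l - 1)) = ?w l"
        using l by (simp add: \<phi>_def)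
    qed (use gk in auto)
    also have "\<dots> \<le> passage (\<lambda>i j. w (Suc i) j) (g k - 1) (k - g k)"
      by (rule sum_lattice_path_le_passage[OF \<phi>])
    finally show ?thesis .
  qed
  define \<psi> where "\<psi> = (\<lambda>l. m - g (L - l))"
  have len: "m - g k + (n - (k - g k)) = L - k" using gk k by (simp add: L_def)
  have \<psi>: "lattice_path \<psi> (m - g k) (n - (k - g k))"
    unfolding lattice_path_def len
  proof (intro conjI allI impI)
    show "\<psi> 0 = 0" using g by (simp add: \<psi>_def lattice_path_def L_def)
    show "\<psi> (L - k) = m - g k" using k by (simp add: \<psi>_def L_def)
    fix l assume "l < L - k"
    then have l: "L - l = Suc (L - Suc l)" "L - Suc l < m + n" using k by (auto simp: L_def)
    then show "\<psi> (Suc l) = \<psi> l \<or> \<psi> (Suc l) = Suc (\<psi> l)"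
      using lattice_path_Suc[OF g l(2)] gend(1)[of "L - l"] unfolding \<psi>_def l(1) by (auto simp: L_def)
  qed
  have 2: "(\<Sum>l=k..L. ?w l) \<le> passage (\<lambda>i j. w (m - i) (n - j)) (m - g k) (n - (k - g k))"
  proof -
    have "(\<Sum>l=k..L. ?w l) = (\<Sum>l\<le>m - g k + (n - (k - g k)). w (m - \<psi> l) (n - (l - \<psi> l)))"
      unfolding len
    proof (rule sum.reindex_bij_witness[of _ "\<lambda>l. L - l" "\<lambda>l. L - l"])
      fix l assume l: "l \<in> {k..L}"
      then have "g l \<le> m" "g l \<le> l" "l - g l \<le> n" using gend[of l] gle[of l] by auto
      then have "m - \<psi> (L - l) = g l" "n - (L - l - \<psi> (L - l)) = l - g l"
        using l by (auto simp: \<psi>_def L_def)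
      then show "w (m - \<psi> (L - l)) (n - (L - l - \<psi> (L - l))) = ?w l" by simp
    qed (use k in \<open>auto simp: L_def\<close>)
    also have "\<dots> \<le> passage (\<lambda>i j. w (m - i) (n - j)) (m - g k) (n - (k - g k))"
      by (rule sum_lattice_path_le_passage[OF \<psi>])
    finally show ?thesis .
  qed
  have "path_sum w g (m + n) + ?w k = (\<Sum>l=1..k. ?w l) + (\<Sum>l=k..L. ?w l)"
  proof -
    have "{1..L} = {1..k} \<union> {Suc k..L}" using k by (auto simp: L_def)
    then have "(\<Sum>l=1..L. ?w l) = (\<Sum>l=1..k. ?w l) + (\<Sum>l=Suc k..L. ?w l)"
      by (simp add: sum.union_disjoint)
    moreover have "(\<Sum>l=k..L. ?w l) = ?w k + (\<Sum>l=Suc k..L. ?w l)"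
      using k by (simp add: sum.atLeast_Suc_atMost L_def)
    ultimately show ?thesis by (simp add: path_sum_def L_def)
  qed
  then show ?thesis using 1 2 by simp
qed

lemma path_sum_attained:
  assumes "1 \<le> m"
  shows "\<exists>g. lattice_path g m n \<and> g 1 = 1 \<and> path_sum w g (m + n) = passage (\<lambda>i j. w (Suc i) j) (m - 1) n"
proof -
  obtain \<phi> where \<phi>: "lattice_path \<phi> (m - 1) n" "(\<Sum>k\<le>m - 1 + n. w (Suc (\<phi> k)) (k - \<phi> k)) = passage (\<lambda>i j. w (Suc i) j) (m - 1) n"
    using passage_attained[of "m - 1" n "\<lambda>i j. w (Suc i) j"] by blast
  define g where "g = (\<lambda>k. case k of 0 \<Rightarrow> 0 | Suc k \<Rightarrow> Suc (\<phi> k))"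
  have "lattice_path g m n"
    unfolding lattice_path_def
  proof (intro conjI allI impI)
    show "g 0 = 0" by (simp add: g_def)
    have "m + n = Suc (m - 1 + n)" using assms by simp
    then have "g (m + n) = Suc (\<phi> (m - 1 + n))" by (simp only: g_def nat.case)
    then show "g (m + n) = m" using \<phi>(1) assms by (simp add: lattice_path_def)
    fix k assume k: "k < m + n"
    show "g (Suc k) = g k \<or> g (Suc k) = Suc (g k)"
    proof (cases k)
      case 0
      then show ?thesis using \<phi>(1) by (simp add: g_def lattice_path_def)
    next
      case (Suc l)
      then show ?thesis using lattice_path_Suc[OF \<phi>(1), of l] k by (simp add: g_def)
    qed
  qed
  moreover have "g 1 = 1" using \<phi>(1) by (simp add: g_def lattice_path_def)
  moreover have "path_sum w g (m + n) = (\<Sum>k\<le>m - 1 + n. w (Suc (\<phi> k)) (k - \<phi> k))"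
    unfolding path_sum_def
    by (rule sum.reindex_bij_witness[of _ Suc "\<lambda>k. k - 1"]) (use assms in \<open>auto simp: g_def split: nat.splits\<close>)
  ultimately show ?thesis using \<phi>(2) by auto
qed

text \<open>For nonnegative weights this excludes that a maximal path from \<open>(1, 0)\<close>
  visits a site \<open>(a + h - 1, a)\<close>, that is, the offset \<open>h - 1\<close> at positive
  height. A path coming back from offset \<open>h\<close> must enter that line by an up step. The
  abscissa \<open>a + h - 2\<close> is relative to the start \<open>(1, 0)\<close>, and the visited
  site is counted in both passage times.\<close>

definition no_crossing :: "(nat \<Rightarrow> nat \<Rightarrow> real) \<Rightarrow> nat \<Rightarrow> nat \<Rightarrow> nat \<Rightarrow> bool" where
  "no_crossing w m n h \<longleftrightarrow> (\<forall>a. 1 \<le> a \<and> a \<le> n \<and> a + h - 1 \<le> m \<longrightarrow>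
     passage (\<lambda>i j. w (Suc i) j) (a + h - 2) a + passage (\<lambda>i j. w (m - i) (n - j)) (m - (a + h - 1)) (n - a)
     < passage (\<lambda>i j. w (Suc i) j) (m - 1) n)"

text \<open>The offset \<open>2 * g l - l\<close> changes by one per step; the first step to offset
  \<open>h - 1\<close> would go up, hence end at positive height on the forbidden line.\<close>

lemma stays_right:
  assumes g: "lattice_path g m n" "g 1 = 1" and max: "passage (\<lambda>i j. w (Suc i) j) (m - 1) n \<le> path_sum w g (m + n)"
    and w: "\<And>i j. 0 \<le> w i j" and nc: "no_crossing w m n h"
    and k: "1 \<le> k" "k + h \<le> 2 * g k" "k \<le> l" "l \<le> m + n"
  shows "l + h \<le> 2 * g l"
  using k(3,4)
proof (induction l rule: dec_induct)
  case base
  show ?case using k by simp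
next
  case (step l)
  then have l: "l + h \<le> 2 * g l" "l < m + n" by auto
  show ?case
  proof (rule ccontr)
    assume "\<not> Suc l + h \<le> 2 * g (Suc l)"
    then have eq: "2 * g (Suc l) = l + h" "g (Suc l) = g l"
      using lattice_path_Suc[OF g(1) l(2)] l(1) by auto
    define a where "a = Suc l - g (Suc l)"
    have a: "1 \<le> a" "g (Suc l) = a + h - 1"
      using eq lattice_path_le[OF g(1), of l] l by (auto simp: a_def)
    have "a + h - 1 - 1 = a + h - 2" by simp
    then have "path_sum w g (m + n) + w (a + h - 1) a \<le> passage (\<lambda>i j. w (Suc i) j) (a + h - 2) a
        + passage (\<lambda>i j. w (m - i) (n - j)) (m - (a + h - 1)) (n - a)"
      using path_sum_split[OF g, of "Suc l" w, folded a_def, unfolded a(2)] l(2) by simp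
    moreover have "a + h - 1 \<le> m" "a \<le> n"
      using lattice_path_le_end[OF g(1), of "Suc l", folded a_def, unfolded a(2)] l(2) by auto
    ultimately show False
      using nc a(1) max w[of "a + h - 1" a] unfolding no_crossing_def by fastforce
  qed
qed

text \<open>With parameter 1, a quadrant maximizer never returns to the diagonal, so it is a
  half-space path and can be compared with \<open>f\<close>. With parameter \<open>\<mu>\<close>, it
  never reaches offset \<open>\<mu>\<close>, since it could not return to its end point left of the
  line. If \<open>f\<close> hit the line, exchanging an excursion would produce a maximizer that
  does.\<close>

lemma no_hit:
  assumes heaviest: "heaviest w1 f m n"
    and m': "m \<le> m'" "n < m'" "m' + 1 < n + \<mu>"
    and w: "\<And>i j. j < i \<Longrightarrow> w1 i j \<le> w2 i j" "\<And>i j. 1 \<le> j \<Longrightarrow> j \<le> i \<Longrightarrow> w2 i j \<le> w1 i j" "\<And>i j. 0 \<le> w2 i j"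
    and nc: "no_crossing w2 m' n \<mu>" "no_crossing w2 m' n 1"
    and p: "p \<le> m + n"
  shows "2 * f p \<noteq> p + \<mu>"
proof
  assume hit: "2 * f p = p + \<mu>"
  \<comment> \<open>Stated for every maximal path, as it is applied both to the chosen
    \<open>g\<close> and to the path \<open>h\<close> produced by the exchange.\<close>
  have left: "2 * g k < k + \<mu>"
    if g: "lattice_path g m' n" "g 1 = 1" "passage (\<lambda>i j. w2 (Suc i) j) (m' - 1) n \<le> path_sum w2 g (m' + n)"
      and k: "k \<le> m' + n" for g k
  proof (rule ccontr)
    assume not: "\<not> 2 * g k < k + \<mu>"
    moreover have "g 0 = 0" "g (m' + n) = m'" using g(1) by (auto simp: lattice_path_def)
    ultimately have "1 \<le> k" using m' by (cases k) auto
    from stays_right[where g = g and k = k and l = "m' + n", OF g w(3) nc(1) this] not k \<open>g (m' + n) = m'\<close> m'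
    show False by simp
  qed
  obtain g where g: "lattice_path g m' n" "g 1 = 1" "path_sum w2 g (m' + n) = passage (\<lambda>i j. w2 (Suc i) j) (m' - 1) n"
    using path_sum_attained[of m' n w2] m' by auto
  have g_half: "k \<le> 2 * g k" if "k \<le> m' + n" for k
    using stays_right[OF g(1,2) _ w(3) nc(2), of 1 k] g that by (cases "k = 0") auto
  have "2 * g p < p + \<mu>" using left[OF g(1,2), of p] g(3) p m' by simp
  then have "g p < f p" using hit by simp
  moreover have "half_space_path g m' n" using g(1) g_half by (simp add: half_space_path_def)
  ultimately obtain h where "half_space_path h m' n" and h': "h p = f p"
      "path_sum w2 g (m' + n) \<le> path_sum w2 h (m' + n)"
    using exchange_excursion[OF heaviest _ m'(1) w(1,2) p] by blast
  then have h: "lattice_path h m' n" "\<And>k. k \<le> m' + n \<Longrightarrow> k \<le> 2 * h k"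
    by (auto simp: half_space_path_def)
  have "1 \<le> m' + n" using m' by simp
  then have "h 1 = 1" using h(2)[of 1] lattice_path_le[OF h(1), of 1] by simp
  from left[OF h(1) this, of p] h' g(3) p m' hit show False by simp
qed

section \<open>Geodesics of the half-space models\<close>

definition path_sites :: "(nat \<Rightarrow> nat) \<Rightarrow> nat \<Rightarrow> site list" where
  "path_sites f L = map (\<lambda>k. (int (f k), int (k - f k))) [0..<Suc L]"

lemma set_path_sites: "set (path_sites f L) = (\<lambda>k. (int (f k), int (k - f k))) ` {..L}"
  by (auto simp: path_sites_def simp del: upt_Suc)

lemma path_sites_in_half_space_paths:
  assumes "half_space_path f m n"
  shows "path_sites f (m + n) \<in> half_space_paths (int m, int n)"
  unfolding half_space_paths_def
proof (intro CollectI conjI)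
  have f: "lattice_path f m n" "\<And>k. k \<le> m + n \<Longrightarrow> k \<le> 2 * f k"
    using assms by (auto simp: half_space_path_def)
  let ?p = "path_sites f (m + n)"
  show "?p \<noteq> []" by (simp add: path_sites_def)
  show "hd ?p = (0, 0)" using f(1) by (simp add: path_sites_def hd_map lattice_path_def del: upt_Suc)
  show "last ?p = (int m, int n)" using f(1) by (simp add: path_sites_def lattice_path_def)
  show "set ?p \<subseteq> half_space"
  proof -
    have "int (k - f k) \<le> int (f k)" if "k \<le> m + n" for k
      using f(2)[OF that] by simp
    then show ?thesis by (auto simp: set_path_sites half_space_def)
  qed
  show "successively up_right_step ?p"
    unfolding successively_conv_nth
  proof (intro allI impI)
    fix k assume "Suc k < length ?p"
    then have k: "k < m + n" by (simp add: path_sites_def del: upt_Suc)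
    have "?p ! k = (int (f k), int (k - f k))" "?p ! Suc k = (int (f (Suc k)), int (Suc k - f (Suc k)))"
      using k by (simp_all add: path_sites_def del: upt_Suc)
    then show "up_right_step (?p ! k) (?p ! Suc k)"
      using lattice_path_Suc[OF f(1) k] lattice_path_le[OF f(1), of k] k
      by (auto simp: up_right_step_def)
  qed
qed

lemma half_space_pathsE:
  assumes "\<pi> \<in> half_space_paths (int m, int n)"
  obtains f where "half_space_path f m n" "\<pi> = path_sites f (m + n)"
proof -
  have ne: "\<pi> \<noteq> []" and hd: "hd \<pi> = (0, 0)" and last: "last \<pi> = (int m, int n)"
    and sub: "set \<pi> \<subseteq> half_space" and succ: "successively up_right_step \<pi>"
    using assms by (auto simp: half_space_paths_def)
  have step: "up_right_step (\<pi> ! k) (\<pi> ! Suc k)" if "Suc k < length \<pi>" for k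
    using succ that by (auto simp: successively_conv_nth)
  have half: "0 \<le> snd (\<pi> ! k) \<and> snd (\<pi> ! k) \<le> fst (\<pi> ! k)" if "k < length \<pi>" for k
    using sub nth_mem[OF that] by (auto simp: half_space_def)
  have level: "fst (\<pi> ! k) + snd (\<pi> ! k) = int k" if "k < length \<pi>" for k
    using that
  proof (induction k)
    case 0
    then show ?case using hd ne by (simp add: hd_conv_nth)
  next
    case (Suc k)
    then show ?case using step[of k] by (auto simp: up_right_step_def)
  qed
  have len: "length \<pi> = Suc (m + n)"
  proof -
    have "\<pi> ! (length \<pi> - 1) = (int m, int n)" using last ne by (simp add: last_conv_nth)
    then have "int m + int n = int (length \<pi> - 1)" using level[of "length \<pi> - 1"] ne by simp
    then have "m + n = length \<pi> - 1" by linarith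
    then show ?thesis using ne by (cases \<pi>) auto
  qed
  define f where "f = (\<lambda>k. nat (fst (\<pi> ! k)))"
  have nth: "\<pi> ! k = (int (f k), int (k - f k))" and f_half: "k \<le> 2 * f k" if "k \<le> m + n" for k
    using half[of k] level[of k] that len unfolding f_def by (auto simp: prod_eq_iff)
  have "lattice_path f m n"
    unfolding lattice_path_def
  proof (intro conjI allI impI)
    show "f 0 = 0" using hd ne by (simp add: f_def hd_conv_nth)
    show "f (m + n) = m" using last ne len by (simp add: f_def last_conv_nth)
    fix k assume "k < m + n"
    then show "f (Suc k) = f k \<or> f (Suc k) = Suc (f k)"
      using step[of k] half[of k] len by (auto simp: up_right_step_def f_def nat_add_distrib)
  qed
  moreover have "\<pi> = path_sites f (m + n)"
    by (rule nth_equalityI) (auto simp: len path_sites_def nth simp del: upt_Suc)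
  ultimately show ?thesis using f_half by (intro that[of f]) (auto simp: half_space_path_def)
qed

lemma path_weight_path_sites:
  assumes f: "lattice_path f m n"
  shows "path_weight \<omega> (path_sites f (m + n)) = path_sum (\<lambda>i j. \<omega> (int i, int j)) f (m + n)"
proof -
  let ?s = "\<lambda>k. (int (f k), int (k - f k))"
  have inj: "inj_on ?s {..m + n}"
  proof (rule inj_onI)
    fix k l assume "k \<in> {..m + n}" "l \<in> {..m + n}" "?s k = ?s l"
    moreover from this have "f k \<le> k" "f l \<le> l" using lattice_path_le[OF f] by auto
    ultimately show "k = l" by auto
  qed
  have "set (path_sites f (m + n)) - {(0, 0)} = ?s ` {1..m + n}"
  proof -
    have "{..m + n} = insert 0 {1..m + n}" by auto
    moreover have "?s 0 = (0, 0)" using f by (simp add: lattice_path_def)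
    moreover have "(0, 0) \<notin> ?s ` {1..m + n}" by auto
    ultimately show ?thesis unfolding set_path_sites by auto
  qed
  then show ?thesis
    unfolding path_weight_def path_sum_def
    using inj by (simp add: sum.reindex inj_on_subset)
qed

lemma finite_half_space_paths: "finite (half_space_paths (int m, int n))"
proof (rule finite_subset)
  let ?S = "{xs. set xs \<subseteq> {0..int m} \<times> {0..int n} \<and> length xs = Suc (m + n)}"
  show "half_space_paths (int m, int n) \<subseteq> ?S"
  proof
    fix \<pi> assume "\<pi> \<in> half_space_paths (int m, int n)"
    then obtain f where f: "lattice_path f m n" "\<pi> = path_sites f (m + n)"
      by (auto elim!: half_space_pathsE simp: half_space_path_def)
    then show "\<pi> \<in> ?S"
      using lattice_path_le_end[OF f(1)] by (auto simp: set_path_sites path_sites_def simp del: upt_Suc)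
  qed
  show "finite ?S" by (intro finite_lists_length_eq) simp
qed

lemma half_space_paths_nonempty:
  assumes "n \<le> m"
  shows "half_space_paths (int m, int n) \<noteq> {}"
proof -
  have "path_sites (\<lambda>k. min k m) (m + n) \<in> half_space_paths (int m, int n)"
    using assms by (intro path_sites_in_half_space_paths) (auto simp: half_space_path_def lattice_path_def)
  then show ?thesis by auto
qed

definition maximizers :: "(site \<Rightarrow> real) \<Rightarrow> site \<Rightarrow> site list set" where
  "maximizers \<omega> b = {\<pi> \<in> half_space_paths b. path_weight \<omega> \<pi> = lpp \<omega> b}"

lemma geodesic_in_maximizers:
  assumes "inj_on (path_weight \<omega>) (half_space_paths (int m, int n))" "n \<le> m"
  shows "maximizers \<omega> (int m, int n) = {geodesic \<omega> (int m, int n)}"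
proof -
  let ?b = "(int m, int n)"
  let ?P = "half_space_paths ?b"
  have "lpp \<omega> ?b \<in> path_weight \<omega> ` ?P"
    unfolding lpp_def using half_space_paths_nonempty[OF assms(2)] finite_half_space_paths[of m n]
    by (intro Max_in) auto
  then obtain \<pi> where \<pi>: "\<pi> \<in> ?P" "path_weight \<omega> \<pi> = lpp \<omega> ?b" by auto
  have uniq: "\<pi>' = \<pi>" if "\<pi>' \<in> ?P" "path_weight \<omega> \<pi>' = lpp \<omega> ?b" for \<pi>'
    by (rule inj_onD[OF assms(1)]) (use that \<pi> in auto)
  have "geodesic \<omega> ?b = \<pi>"
    unfolding geodesic_def
  proof (rule the_equality)
    show "\<pi> \<in> ?P \<and> path_weight \<omega> \<pi> = lpp \<omega> ?b" using \<pi> by simp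
    show "\<pi>' = \<pi>" if "\<pi>' \<in> ?P \<and> path_weight \<omega> \<pi>' = lpp \<omega> ?b" for \<pi>'
      using that uniq by simp
  qed
  moreover have "maximizers \<omega> ?b = {\<pi>}"
    unfolding maximizers_def using \<pi> uniq by blast
  ultimately show ?thesis by simp
qed

lemma path_weight_le_lpp: "\<pi> \<in> half_space_paths (int m, int n) \<Longrightarrow> path_weight \<omega> \<pi> \<le> lpp \<omega> (int m, int n)"
  unfolding lpp_def using finite_half_space_paths[of m n] by (intro Max_ge) auto

lemma geodesicE:
  assumes "inj_on (path_weight \<omega>) (half_space_paths (int m, int n))" "n \<le> m"
  obtains f where "geodesic \<omega> (int m, int n) = path_sites f (m + n)" "heaviest (\<lambda>i j. \<omega> (int i, int j)) f m n"
proof -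
  let ?b = "(int m, int n)"
  have "geodesic \<omega> ?b \<in> maximizers \<omega> ?b"
    using geodesic_in_maximizers[OF assms] by simp
  then have g: "geodesic \<omega> ?b \<in> half_space_paths ?b"
      "path_weight \<omega> (geodesic \<omega> ?b) = lpp \<omega> ?b"
    by (auto simp: maximizers_def)
  from g(1) obtain f where f: "half_space_path f m n" "geodesic \<omega> ?b = path_sites f (m + n)"
    by (rule half_space_pathsE)
  have "path_sum (\<lambda>i j. \<omega> (int i, int j)) h (m + n) \<le> path_sum (\<lambda>i j. \<omega> (int i, int j)) f (m + n)"
    if h: "half_space_path h m n" for h
    using path_weight_le_lpp[OF path_sites_in_half_space_paths[OF h], of \<omega>] g(2) f h
    by (simp add: path_weight_path_sites half_space_path_def)
  then show thesis using that f by (simp add: heaviest_def)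
qed

abbreviation offset_line :: "nat \<Rightarrow> site set" where
  "offset_line \<mu> \<equiv> {(i, j). i - j = int \<mu>}"

lemma avoids_path_sites:
  assumes "geodesic \<omega> b = path_sites f L" "lattice_path f m n" "L = m + n"
  shows "avoids b (offset_line \<mu>) \<omega> \<longleftrightarrow> (\<forall>k\<le>L. 2 * f k \<noteq> k + \<mu>)"
proof -
  have "int (f k) - int (k - f k) = int \<mu> \<longleftrightarrow> 2 * f k = k + \<mu>" if "k \<le> L" for k
    using lattice_path_le[OF assms(2), of k] that assms(3) by auto
  then show ?thesis
    unfolding avoids_def assms(1) set_path_sites by auto
qed

text \<open>A discrete intermediate value argument: the offset starts at 0 and moves by one per
  step.\<close>

lemma lattice_path_crosses:
  assumes g: "lattice_path g m n" and p: "p \<le> m + n" "p + \<mu> \<le> 2 * g p"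
  shows "\<exists>k\<le>p. 2 * g k = k + \<mu>"
proof -
  define k where "k = (LEAST k. k + \<mu> \<le> 2 * g k)"
  have k: "k + \<mu> \<le> 2 * g k" "k \<le> p"
    using LeastI[of "\<lambda>k. k + \<mu> \<le> 2 * g k" p] Least_le[of "\<lambda>k. k + \<mu> \<le> 2 * g k" p] p unfolding k_def by auto
  have "2 * g k \<le> k + \<mu>"
  proof (cases k)
    case 0
    then show ?thesis using g by (simp add: lattice_path_def)
  next
    case (Suc l)
    have "\<not> l + \<mu> \<le> 2 * g l"
      using not_less_Least[of l "\<lambda>k. k + \<mu> \<le> 2 * g k"] Suc unfolding k_def by simp
    moreover have "g (Suc l) \<le> Suc (g l)" using lattice_path_Suc[OF g, of l] Suc k p by auto
    ultimately show ?thesis using Suc by simp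
  qed
  then show ?thesis using k by auto
qed

text \<open>If the first geodesic hit the line at level \<open>p\<close>, the exchange would give a
  second maximizer for \<open>\<omega>2\<close> that differs from its geodesic at \<open>p\<close>,
  against injectivity of the weight. In the application \<open>\<omega>1\<close> is the
  point-to-point and \<open>\<omega>2\<close> the stationary environment.\<close>

lemma avoids_mono:
  assumes inj: "inj_on (path_weight \<omega>1) (half_space_paths (int m, int n))"
      "inj_on (path_weight \<omega>2) (half_space_paths (int m, int n))" and nm: "n \<le> m"
    and w: "\<And>i j. j < i \<Longrightarrow> \<omega>1 (int i, int j) \<le> \<omega>2 (int i, int j)"
      "\<And>i j. 1 \<le> j \<Longrightarrow> j \<le> i \<Longrightarrow> \<omega>2 (int i, int j) \<le> \<omega>1 (int i, int j)"
    and av: "avoids (int m, int n) (offset_line \<mu>) \<omega>2"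
  shows "avoids (int m, int n) (offset_line \<mu>) \<omega>1"
proof -
  let ?b = "(int m, int n)" and ?w = "\<lambda>\<omega> i j :: nat. \<omega> (int i, int j)"
  obtain f where f: "geodesic \<omega>1 ?b = path_sites f (m + n)" "heaviest (?w \<omega>1) f m n"
    using geodesicE[OF inj(1) nm] .
  obtain g where g: "geodesic \<omega>2 ?b = path_sites g (m + n)" "heaviest (?w \<omega>2) g m n"
    using geodesicE[OF inj(2) nm] .
  have half: "half_space_path f m n" "half_space_path g m n" using f(2) g(2) by (auto simp: heaviest_def)
  then have path: "lattice_path f m n" "lattice_path g m n" by (auto simp: half_space_path_def)
  have gav: "2 * g k \<noteq> k + \<mu>" if "k \<le> m + n" for k
    using av that avoids_path_sites[OF g(1) path(2) refl] by auto
  show ?thesis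
    unfolding avoids_path_sites[OF f(1) path(1) refl]
  proof (intro allI impI notI)
    fix p assume p: "p \<le> m + n" "2 * f p = p + \<mu>"
    have "\<not> p + \<mu> \<le> 2 * g p"
      using lattice_path_crosses[OF path(2) p(1)] gav p(1) by (meson le_trans)
    then have less: "g p < f p" using p by simp
    obtain h where h: "half_space_path h m n" "h p = f p"
        "path_sum (?w \<omega>2) g (m + n) \<le> path_sum (?w \<omega>2) h (m + n)"
      using exchange_excursion[OF f(2) half(2) order.refl _ _ p(1) less, of "?w \<omega>2"] w by blast
    have "path_weight \<omega>2 (path_sites h (m + n)) = path_weight \<omega>2 (path_sites g (m + n))"
      using h(1,3) g(2) path by (auto simp: path_weight_path_sites half_space_path_def heaviest_def intro: antisym)
    then have "path_sites h (m + n) = path_sites g (m + n)"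
      by (rule inj_onD[OF inj(2) _ path_sites_in_half_space_paths[OF h(1)] path_sites_in_half_space_paths[OF half(2)]])
    then have "path_sites h (m + n) ! p = path_sites g (m + n) ! p" by simp
    then have "h p = g p" using p(1) by (simp add: path_sites_def del: upt_Suc)
    then show False using less h(2) by simp
  qed
qed

section \<open>Laws of scaled weights, measurability, almost sure uniqueness\<close>

lemma distr_scale_exp_law:
  assumes "0 < c"
  shows "distr (exp_law 1) borel (\<lambda>x. c * x) = exp_law (1 / c)"
proof -
  let ?S = "\<lambda>x :: real. 0 + c * x"
  have "exp_law (1 / c) = density (density (distr lborel borel ?S) (\<lambda>_. ennreal \<bar>c\<bar>)) (\<lambda>x. ennreal (exponential_density (1 / c) x))"
    unfolding exp_law_def using assms by (subst lborel_real_affine[of c 0]) auto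
  also have "\<dots> = density (distr lborel borel ?S) (\<lambda>x. ennreal \<bar>c\<bar> * ennreal (exponential_density (1 / c) x))"
    by (rule density_density_eq) measurable
  also have "\<dots> = distr (density lborel (\<lambda>x. ennreal \<bar>c\<bar> * ennreal (exponential_density (1 / c) (?S x)))) borel ?S"
    by (rule density_distr) measurable
  also have "(\<lambda>x. ennreal \<bar>c\<bar> * ennreal (exponential_density (1 / c) (?S x))) = (\<lambda>x. ennreal (exponential_density 1 x))"
    using assms by (auto simp: fun_eq_iff exponential_density_def zero_less_mult_iff mult_less_0_iff simp flip: ennreal_mult)
  finally show ?thesis by (simp add: exp_law_def)
qed

text \<open>A zero multiplier gives the point mass at 0, so the vanishing bottom row of the
  point-to-point model is included.\<close>

lemma distr_scaled_exp_family:
  assumes X: "exp_family M X (\<lambda>_. 1) K" and c: "\<And>p. p \<in> K \<Longrightarrow> 0 \<le> c p"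
  shows "distr M (Pi\<^sub>M K (\<lambda>_. borel)) (\<lambda>\<omega>. \<lambda>p\<in>K. c p * X p \<omega>) =
    Pi\<^sub>M K (\<lambda>p. if c p = 0 then return borel 0 else exp_law (1 / c p))"
proof -
  interpret prob_space M using X by (simp add: exp_family_def)
  have ind: "indep_vars (\<lambda>_. borel) X K" using X by (simp add: exp_family_def)
  show ?thesis
  proof (rule distr_family)
    show "indep_vars (\<lambda>_. borel) (\<lambda>p \<omega>. c p * X p \<omega>) K"
      by (rule indep_vars_compose2[OF ind]) auto
    fix p assume p: "p \<in> K"
    have [measurable]: "X p \<in> borel_measurable M" by (rule exp_family_measurable[OF X p])
    have "distr M borel (\<lambda>\<omega>. c p * X p \<omega>) = distr (distr M borel (X p)) borel (\<lambda>x. c p * x)"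
      by (subst distr_distr) (auto simp: comp_def)
    also have "\<dots> = distr (exp_law 1) borel (\<lambda>x. c p * x)"
      using X p by (simp add: exp_family_def)
    also have "\<dots> = (if c p = 0 then return borel 0 else exp_law (1 / c p))"
      using distr_scale_exp_law[of "c p"] c[OF p] prob_space.distr_const[OF prob_space_exp_law[of 1], of "0::real" borel]
      by (auto simp: less_le)
    finally show "distr M borel (\<lambda>\<omega>. c p * X p \<omega>) = (if c p = 0 then return borel 0 else exp_law (1 / c p))" .
  qed
qed

abbreviation env_borel :: "(site \<Rightarrow> real) measure" where
  "env_borel \<equiv> Pi\<^sub>M half_space (\<lambda>_. borel)"

lemma measurable_path_weight:
  assumes "\<pi> \<in> half_space_paths b"
  shows "(\<lambda>\<omega>. path_weight \<omega> \<pi>) \<in> borel_measurable env_borel"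
  unfolding path_weight_def using assms
  by (intro borel_measurable_sum measurable_component_singleton) (auto simp: half_space_paths_def)

text \<open>The geodesic is a function of the set of maximizers, which takes finitely many values;
  the event is the finite union over the favourable ones, including those with several
  maximizers.\<close>

lemma sets_avoids:
  assumes "n \<le> m"
  shows "{\<omega> \<in> space env_borel. avoids (int m, int n) A \<omega>} \<in> sets env_borel"
proof -
  let ?b = "(int m, int n)" and ?N = "env_borel"
  let ?P = "half_space_paths ?b"
  have fin: "finite ?P" by (rule finite_half_space_paths)
  have lpp: "(\<lambda>\<omega>. lpp \<omega> ?b) \<in> borel_measurable ?N"
    unfolding lpp_def using fin by (intro borel_measurable_Max measurable_path_weight) auto
  have S: "{\<omega> \<in> space ?N. maximizers \<omega> ?b = S} \<in> sets ?N" if "S \<subseteq> ?P" for S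
  proof -
    have "{\<omega> \<in> space ?N. maximizers \<omega> ?b = S} =
      {\<omega> \<in> space ?N. \<forall>\<pi>\<in>?P. path_weight \<omega> \<pi> = lpp \<omega> ?b \<longleftrightarrow> \<pi> \<in> S}"
      using that by (auto simp: maximizers_def)
    also have "\<dots> \<in> sets ?N"
    proof (intro sets.sets_Collect_finite_All' fin)
      fix \<pi> assume "\<pi> \<in> ?P"
      from borel_measurable_eq[OF measurable_path_weight[OF this] lpp]
      show "{\<omega> \<in> space ?N. path_weight \<omega> \<pi> = lpp \<omega> ?b \<longleftrightarrow> \<pi> \<in> S} \<in> sets ?N"
        by (cases "\<pi> \<in> S") (auto intro: sets.sets_Collect_neg)
    qed (use half_space_paths_nonempty[OF assms] in auto)
    finally show ?thesis .
  qed
  have "{\<omega> \<in> space ?N. avoids ?b A \<omega>} =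
    (\<Union>S\<in>{S \<in> Pow ?P. set (THE \<pi>. \<pi> \<in> S) \<inter> A = {}}. {\<omega> \<in> space ?N. maximizers \<omega> ?b = S})"
  proof -
    have "geodesic \<omega> ?b = (THE \<pi>. \<pi> \<in> maximizers \<omega> ?b)" for \<omega>
      by (simp add: geodesic_def maximizers_def)
    moreover have "maximizers \<omega> ?b \<subseteq> ?P" for \<omega> by (auto simp: maximizers_def)
    ultimately show ?thesis by (auto simp: avoids_def)
  qed
  also have "\<dots> \<in> sets ?N"
    using S fin by (intro sets.finite_UN) auto
  finally show ?thesis .
qed

lemma (in prob_space) AE_indep_exp_neq:
  fixes V W :: "'a \<Rightarrow> real"
  assumes ind: "indep_var borel W borel V" and V: "distr M borel V = exp_law 1" and c: "c \<noteq> 0"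
  shows "AE \<omega> in M. c * V \<omega> \<noteq> W \<omega>"
proof -
  from ind have [measurable]: "W \<in> borel_measurable M" "V \<in> borel_measurable M"
    by (auto dest: indep_var_rv1 indep_var_rv2)
  define h :: "real \<times> real \<Rightarrow> ennreal" where "h = (\<lambda>z. indicator {z. c * snd z = fst z} z)"
  have [measurable]: "h \<in> borel_measurable (borel \<Otimes>\<^sub>M borel)" unfolding h_def by measurable
  have "emeasure M {\<omega> \<in> space M. c * V \<omega> = W \<omega>} = (\<integral>\<^sup>+\<omega>. indicator {\<omega> \<in> space M. c * V \<omega> = W \<omega>} \<omega> \<partial>M)"
    by (rule nn_integral_indicator[symmetric]) measurable
  also have "\<dots> = (\<integral>\<^sup>+\<omega>. h (W \<omega>, V \<omega>) \<partial>M)"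
    by (rule nn_integral_cong) (simp add: h_def indicator_def)
  also have "\<dots> = (\<integral>\<^sup>+\<omega>. \<integral>\<^sup>+v. h (W \<omega>, v) \<partial>exp_law 1 \<partial>M)"
    using nn_integral_indep_var[OF ind, of h] V by simp
  also have "\<dots> = (\<integral>\<^sup>+\<omega>. 0 \<partial>M)"
  proof (rule nn_integral_cong)
    fix \<omega>
    have "AE v in exp_law 1. v \<noteq> W \<omega> / c"
      unfolding exp_law_def using AE_lborel_singleton[of "W \<omega> / c"] by (subst AE_density) auto
    then have "AE v in exp_law 1. h (W \<omega>, v) = 0"
      by eventually_elim (use c in \<open>auto simp: h_def indicator_def field_simps\<close>)
    then show "(\<integral>\<^sup>+v. h (W \<omega>, v) \<partial>exp_law 1) = 0"
      by (subst nn_integral_0_iff_AE) auto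
  qed
  finally show ?thesis by (subst AE_iff_measurable[OF _ refl]) auto
qed

text \<open>At a level where two paths differ, the left one is off the bottom row and visits a site
  that the other never visits. The weight there is independent of the remaining ones and has a
  density, so a tie has probability 0. Choosing the left path matters because multipliers on the
  bottom row may vanish.\<close>

lemma AE_inj_path_weight:
  assumes X: "exp_family M X (\<lambda>_. 1) half_space" and c: "\<And>i j. 1 \<le> j \<Longrightarrow> j \<le> i \<Longrightarrow> c (i, j) \<noteq> 0"
  shows "AE \<omega> in M. inj_on (path_weight (\<lambda>p\<in>half_space. c p * X p \<omega>)) (half_space_paths (int m, int n))"
proof -
  interpret prob_space M using X by (simp add: exp_family_def)
  have ind: "indep_vars (\<lambda>_. borel) X half_space" using X by (simp add: exp_family_def)
  let ?P = "half_space_paths (int m, int n)"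
  let ?e = "\<lambda>\<omega>. \<lambda>p\<in>half_space. c p * X p \<omega>"
  have weight: "path_weight (?e \<omega>) \<pi> = (\<Sum>q\<in>set \<pi> - {(0, 0)}. c q * X q \<omega>)" if "\<pi> \<in> ?P" for \<pi> \<omega>
    unfolding path_weight_def by (rule sum.cong) (use that in \<open>auto simp: half_space_paths_def\<close>)
  have diff: "AE \<omega> in M. path_weight (?e \<omega>) \<pi> \<noteq> path_weight (?e \<omega>) \<pi>'"
    if \<pi>: "\<pi> \<in> ?P" "\<pi>' \<in> ?P" and p: "p \<in> set \<pi>" "p \<notin> set \<pi>'" "1 \<le> snd p" for \<pi> \<pi>' p
  proof -
    let ?r = "\<lambda>K \<omega>. restrict (\<lambda>q. X q \<omega>) K"
    let ?A = "set \<pi> - {(0, 0)} - {p}" and ?B = "set \<pi>' - {(0, 0)}"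
    have sub: "set \<pi> \<subseteq> half_space" "set \<pi>' \<subseteq> half_space" using \<pi> by (auto simp: half_space_paths_def)
    define W where "W = (\<lambda>\<omega>. (\<Sum>q\<in>?B. c q * X q \<omega>) - (\<Sum>q\<in>?A. c q * X q \<omega>))"
    define K where "K = ?A \<union> ?B"
    define fW where "fW = (\<lambda>y :: site \<Rightarrow> real. (\<Sum>q\<in>?B. c q * y q) - (\<Sum>q\<in>?A. c q * y q))"
    have fW: "fW \<in> borel_measurable (Pi\<^sub>M K (\<lambda>_. borel))"
      unfolding fW_def K_def
      by (intro borel_measurable_diff borel_measurable_sum borel_measurable_times borel_measurable_const measurable_component_singleton) auto
    have "indep_var borel (fW \<circ> ?r K) borel ((\<lambda>y. y p) \<circ> ?r {p})"
    proof (rule indep_var_compose[OF _ fW])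
      show "indep_var (Pi\<^sub>M K (\<lambda>_. borel)) (?r K) (Pi\<^sub>M {p} (\<lambda>_. borel)) (?r {p})"
        by (rule indep_var_restrict[OF ind]) (use p sub in \<open>auto simp: K_def\<close>)
    qed simp
    also have "fW \<circ> ?r K = W"
    proof
      fix \<omega>
      have "(\<Sum>q\<in>?B. c q * ?r K \<omega> q) = (\<Sum>q\<in>?B. c q * X q \<omega>)"
        "(\<Sum>q\<in>?A. c q * ?r K \<omega> q) = (\<Sum>q\<in>?A. c q * X q \<omega>)"
        by (rule sum.cong; simp add: K_def)+
      then show "(fW \<circ> ?r K) \<omega> = W \<omega>" by (simp add: fW_def W_def)
    qed
    also have "(\<lambda>y. y p) \<circ> ?r {p} = X p" by (simp add: comp_def)
    finally have iv: "indep_var borel W borel (X p)" .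
    have "distr M borel (X p) = exp_law 1" using X p sub by (auto simp: exp_family_def)
    moreover have "c p \<noteq> 0" using p sub c[of "snd p" "fst p"] by (auto simp: half_space_def)
    ultimately have "AE \<omega> in M. c p * X p \<omega> \<noteq> W \<omega>" by (rule AE_indep_exp_neq[OF iv])
    then show ?thesis
    proof eventually_elim
      case (elim \<omega>)
      have "(\<Sum>q\<in>set \<pi> - {(0, 0)}. c q * X q \<omega>) = c p * X p \<omega> + (\<Sum>q\<in>?A. c q * X q \<omega>)"
        using p by (intro sum.remove) auto
      then show ?case using elim by (simp add: weight[OF \<pi>(1)] weight[OF \<pi>(2)] W_def)
    qed
  qed
  have neq: "AE \<omega> in M. path_weight (?e \<omega>) \<pi> \<noteq> path_weight (?e \<omega>) \<pi>'"
    if \<pi>: "\<pi> \<in> ?P" "\<pi>' \<in> ?P" "\<pi> \<noteq> \<pi>'" for \<pi> \<pi>'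
  proof -
    obtain f where f: "half_space_path f m n" "\<pi> = path_sites f (m + n)" using \<pi>(1) by (rule half_space_pathsE)
    obtain g where g: "half_space_path g m n" "\<pi>' = path_sites g (m + n)" using \<pi>(2) by (rule half_space_pathsE)
    have lf: "lattice_path f m n" and lg: "lattice_path g m n" using f g by (auto simp: half_space_path_def)
    obtain k where k: "k \<le> m + n" "f k \<noteq> g k"
    proof (rule ccontr)
      assume "\<not> thesis"
      then have "f k = g k" if "k \<le> m + n" for k using that \<open>\<And>k. k \<le> m + n \<Longrightarrow> f k \<noteq> g k \<Longrightarrow> thesis\<close> by blast
      then have "\<pi> = \<pi>'" unfolding f(2) g(2) path_sites_def by (intro map_cong) auto
      then show False using \<pi>(3) by simp
    qed
    have site: "(int (a k), int (k - a k)) \<notin> set (path_sites b (m + n))"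
      if "lattice_path a m n" "lattice_path b m n" "a k \<noteq> b k" for a b
    proof
      assume "(int (a k), int (k - a k)) \<in> set (path_sites b (m + n))"
      then obtain l where l: "l \<le> m + n" "a k = b l" "k - a k = l - b l" by (auto simp: set_path_sites)
      have "a k \<le> k" "b l \<le> l" using lattice_path_le[OF that(1) k(1)] lattice_path_le[OF that(2) l(1)] by auto
      then have "k = l" using l by linarith
      then show False using l that(3) by simp
    qed
    have le: "f k \<le> k" "g k \<le> k" using lattice_path_le[OF lf k(1)] lattice_path_le[OF lg k(1)] by auto
    show ?thesis
    proof (cases "f k < g k")
      case True
      show ?thesis
        by (rule diff[OF \<pi>(1,2), of "(int (f k), int (k - f k))"])
           (use True le k site[OF lf lg] f(2) g(2) in \<open>auto simp: set_path_sites\<close>)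
    next
      case False
      have "AE \<omega> in M. path_weight (?e \<omega>) \<pi>' \<noteq> path_weight (?e \<omega>) \<pi>"
        by (rule diff[OF \<pi>(2,1), of "(int (g k), int (k - g k))"])
           (use False le k site[OF lg lf] f(2) g(2) in \<open>auto simp: set_path_sites\<close>)
      then show ?thesis by eventually_elim simp
    qed
  qed
  have "AE \<omega> in M. \<forall>\<pi>\<in>?P. \<forall>\<pi>'\<in>?P. \<pi> \<noteq> \<pi>' \<longrightarrow> path_weight (?e \<omega>) \<pi> \<noteq> path_weight (?e \<omega>) \<pi>'"
    using neq finite_half_space_paths[of m n] by (intro AE_finite_allI) auto
  then show ?thesis by eventually_elim (auto simp: inj_on_def)
qed

section \<open>The geodesic stays away from the line and from the diagonal\<close>

text \<open>The environment on the quadrant that dominates the half-space models off the diagonal.\<close>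

definition full_env :: "real \<Rightarrow> (site \<Rightarrow> real) \<Rightarrow> nat \<Rightarrow> nat \<Rightarrow> real" where
  "full_env \<delta> x i j = x (int i, int j) / (if j = 0 then 1/2 - 2 * \<delta> else 1)"

lemma exp_family_scaled:
  assumes X: "exp_family M X (\<lambda>_. 1) K" and f: "inj_on f L" "f ` L \<subseteq> K" and r: "\<And>l. l \<in> L \<Longrightarrow> 0 < r l"
  shows "exp_family M (\<lambda>l \<omega>. X (f l) \<omega> / r l) r L"
proof -
  have X': "exp_family M (\<lambda>l. X (f l)) (\<lambda>_. 1) L" by (rule exp_family_reindex[OF X f]) simp
  then interpret prob_space M by (simp add: exp_family_def)
  have "indep_vars (\<lambda>_. borel) (\<lambda>l. X (f l)) L" using X' by (simp add: exp_family_def)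
  then have "indep_vars (\<lambda>_. borel) (\<lambda>l \<omega>. X (f l) \<omega> / r l) L"
    by (rule indep_vars_compose2) auto
  moreover have "distr M borel (\<lambda>\<omega>. X (f l) \<omega> / r l) = exp_law (r l)" if "l \<in> L" for l
  proof -
    have [measurable]: "X (f l) \<in> borel_measurable M" by (rule exp_family_measurable[OF X' that])
    have "distr M borel (\<lambda>\<omega>. X (f l) \<omega> / r l) = distr (distr M borel (X (f l))) borel (\<lambda>x. (1 / r l) * x)"
      by (subst distr_distr) (auto simp: comp_def)
    also have "\<dots> = exp_law (r l)"
      using X' that r[OF that] distr_scale_exp_law[of "1 / r l"] by (auto simp: exp_family_def)
    finally show ?thesis .
  qed
  ultimately show ?thesis using r by (auto simp: exp_family_def prob_space_axioms)
qed

text \<open>Off \<open>Bad\<close>, the total passage time from \<open>(1, 0)\<close> exceeds 2 per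
  step, while a path through a forbidden site gains at most \<open>A\<close> before it and loses at
  least \<open>A\<close> after it. The field is indexed by all integer points because the reflected
  rectangles of the maximal inequality stick out of the quadrant.\<close>

lemma prob_no_crossing:
  fixes X :: "site \<Rightarrow> 'a \<Rightarrow> real" and y \<mu> q :: nat
  assumes X: "exp_family M X (\<lambda>_. 1) UNIV" and \<mu>: "10 \<le> \<mu>" "\<mu> \<le> y" and q: "q = \<mu> div 2"
  defines "env \<equiv> \<lambda>\<omega>. full_env (real \<mu> / (10 ^ 6 * real y)) (\<lambda>p. X p \<omega>)"
  shows "\<exists>Bad\<in>sets M. measure M Bad \<le> 400 * exp (- (real \<mu> ^ 3 / (10 ^ 17 * (real y)\<^sup>2))) \<and>
    (AE \<omega> in M. \<omega> \<notin> Bad \<longrightarrow> no_crossing (env \<omega>) (y + q) y \<mu> \<and> no_crossing (env \<omega>) (y + q) y 1)"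
proof -
  interpret prob_space M using X by (simp add: exp_family_def)
  have y0: "0 < real y" using \<mu> by simp
  \<comment> \<open>From offset \<open>\<mu> - 1\<close> a path must make \<open>d\<close> more up
    steps than right steps to reach \<open>(y + q, y)\<close>; from the diagonal, \<open>q\<close>
    more right steps than up steps. Since \<open>\<mu>\<close> is at least 10, both are at least
    \<open>2 / 5 * \<mu>\<close>.\<close>
  define d where "d = \<mu> - 1 - q"
  have dq: "5 \<le> q" "q \<le> \<mu>" "1 \<le> d" "d \<le> \<mu>" "2 * \<mu> \<le> 5 * d" "2 * \<mu> \<le> 5 * q" "\<mu> = d + q + 1"
    using \<mu>(1) q by (auto simp: d_def)
  define \<delta> where "\<delta> = real \<mu> / (10 ^ 6 * real y)"
  have \<delta>: "0 < \<delta>" "\<delta> \<le> 1 / 10 ^ 6"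
    using \<mu> y0 by (auto simp: \<delta>_def field_simps)
  \<comment> \<open>\<open>10^4\<close> makes \<open>A\<close> at most the parabolic loss
    \<open>s e * e\<close> for \<open>e\<close> at least \<open>2 / 5 * \<mu>\<close>. Then
    \<open>10^6\<close> in \<open>\<delta>\<close> keeps the gain from the bottom row, about
    \<open>48 * \<mu>^2 / (10^6 * y)\<close>, below \<open>A / 2\<close>. The tilt
    \<open>s e\<close> is the largest with \<open>216 * s e * y \<le> e\<close>.\<close>
  define A where "A = (real \<mu>)\<^sup>2 / (10 ^ 4 * real y)"
  define s where "s = (\<lambda>e. real e / (216 * real y))"
  have s: "0 < s e" "s e \<le> 1/12" if "2 * \<mu> \<le> 5 * e" "e \<le> \<mu>" for e
    using that \<mu> y0 by (auto simp: s_def field_simps)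
  \<comment> \<open>The smallest exponent is the one of the lower tail of the total,
    \<open>12 * \<delta>^3 * y = 12 * Q / 10^18\<close>; it dictates \<open>10^17\<close>.\<close>
  define E where "E = exp (- (real \<mu> ^ 3 / (10 ^ 17 * (real y)\<^sup>2)))"
  define Q where "Q = real \<mu> ^ 3 / (real y)\<^sup>2"
  have Q0: "0 \<le> Q" by (simp add: Q_def)
  have E_eq: "E = exp (- (Q / 10 ^ 17))" by (simp add: E_def Q_def)
  let ?f = "\<lambda>(i, j). (int (Suc i), int j)"
  define F0 where "F0 = (\<lambda>p \<omega>. X (?f p) \<omega> / (case p of (i, j) \<Rightarrow> if j = (0 :: nat) then 1/2 - 2 * \<delta> else 1))"
  have F0: "exp_family M F0 (\<lambda>(i, j). if j = 0 then 1/2 - 2 * \<delta> else 1) ({..y + q - 1} \<times> {..y})"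
    unfolding F0_def by (rule exp_family_scaled[OF X]) (use \<delta> in \<open>auto simp: inj_on_def split: prod.splits\<close>)
  define F1 where "F1 = (\<lambda>p \<omega>. X (?f p) \<omega> / (case p of (i, j) \<Rightarrow> if j = 0 \<or> j = y + 1 then 1/2 - 2 * \<delta> else 1))"
  have F1: "exp_family M F1 (\<lambda>(i, j). if j = 0 \<or> j = y + 1 then 1/2 - 2 * \<delta> else 1) ({..y + dx} \<times> {..y + 1})" for dx
    unfolding F1_def by (rule exp_family_scaled[OF X]) (use \<delta> in \<open>auto simp: inj_on_def split: prod.splits\<close>)
  define F2 where "F2 = (\<lambda>e (g :: nat \<times> nat \<Rightarrow> site) p \<omega>. X (g p) \<omega> / (case p of (i, j) \<Rightarrow> if j = 0 \<or> j = y + e then 1/2 - s e else 1))"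
  define T0 where "T0 = {\<omega> \<in> space M. passage (\<lambda>i j. F0 (i, j) \<omega>) (y + q - 1) y \<le> 2 * real (Suc (y + q - 1) + y) + 20 * \<delta>\<^sup>2 * real y}"
  define V1 where "V1 = (\<lambda>dx. {\<omega> \<in> space M. \<exists>a<y. 2 * real (dx + 1) + A + 4 * real a < passage (\<lambda>i j. F1 (i, j) \<omega>) (a + dx) (a + 1)})"
  define V2 where "V2 = (\<lambda>e g. {\<omega> \<in> space M. \<exists>a<y. 2 * real e - s e * real e + 4 * real a < passage (\<lambda>i j. F2 e g (i, j) \<omega>) a (a + e)})"
  have T0_sets: "T0 \<in> events"
    unfolding T0_def using measurable_exp_passage[OF F0] by (simp add: borel_measurable_iff_le)
  have ex_sets: "{\<omega> \<in> space M. \<exists>a<y. h a < Z a \<omega>} \<in> events"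
    if "\<And>a. a < y \<Longrightarrow> Z a \<in> borel_measurable M" for h :: "nat \<Rightarrow> real" and Z
  proof -
    have "{\<omega> \<in> space M. \<exists>a<y. h a < Z a \<omega>} = (\<Union>a\<in>{..<y}. {\<omega> \<in> space M. h a < Z a \<omega>})" by auto
    also have "\<dots> \<in> events" using that by (intro sets.finite_UN) (auto simp: borel_measurable_iff_greater)
    finally show ?thesis .
  qed
  have Xm: "X p \<in> borel_measurable M" for p by (rule exp_family_measurable[OF X]) simp
  have V_sets: "V1 dx \<in> events" "V2 e g \<in> events" for dx e g
    unfolding V1_def V2_def F1_def F2_def
    by (intro ex_sets measurable_passage borel_measurable_divide Xm borel_measurable_const)+
  have pT0: "prob T0 \<le> 3 * E"
  proof -
    have "prob T0 \<le> 3 * exp (- 12 * \<delta> ^ 3 * real y)"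
      unfolding T0_def by (rule prob_passage_le[OF F0]) (use \<delta> dq \<mu> in auto)
    also have "- 12 * \<delta> ^ 3 * real y = - (12 * (Q / 10 ^ 18))"
      using y0 by (simp add: \<delta>_def Q_def power_divide power2_eq_square power3_eq_cube)
    also have "3 * exp (- (12 * (Q / 10 ^ 18))) \<le> 3 * E" using Q0 by (simp add: E_eq)
    finally show ?thesis .
  qed
  have pV1: "prob (V1 dx) \<le> 16 * exp 1 * E" if "dx + 1 \<le> \<mu>" for dx
  proof -
    have "prob (V1 dx) \<le> 16 * exp (1 - 2 * \<delta> * A / 2)"
      unfolding V1_def
    proof (rule prob_diagonal_above[OF F1])
      have "216 * (2 * \<delta>)\<^sup>2 * real y + 24 * (2 * \<delta>) * real (dx + 1) \<le> 216 * (2 * \<delta>)\<^sup>2 * real y + 24 * (2 * \<delta>) * real \<mu>"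
        using \<delta> that by (intro add_left_mono mult_left_mono) auto
      also have "\<dots> = (864 / 10 ^ 12 + 48 / 10 ^ 6) * ((real \<mu>)\<^sup>2 / real y)"
        using y0 by (simp add: \<delta>_def power_divide power2_eq_square field_simps)
      also have "\<dots> \<le> (1 / 20000) * ((real \<mu>)\<^sup>2 / real y)"
        by (intro mult_right_mono) auto
      also have "\<dots> = A / 2" by (simp add: A_def)
      finally show "216 * (2 * \<delta>)\<^sup>2 * real y + 24 * (2 * \<delta>) * real (dx + 1) \<le> A / 2" .
    qed (use \<delta> in auto)
    also have "2 * \<delta> * A / 2 = Q / 10 ^ 10"
      using y0 by (simp add: \<delta>_def A_def Q_def power2_eq_square power3_eq_cube)
    also have "exp (1 - Q / 10 ^ 10) \<le> exp (1 - Q / 10 ^ 17)" using Q0 by simp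
    also have "\<dots> = exp 1 * E" by (simp only: E_eq mult_exp_exp diff_conv_add_uminus)
    finally show ?thesis by simp
  qed
  have pV2: "prob (V2 e g) \<le> 16 * exp 2 * E" if g: "inj g" and e: "2 * \<mu> \<le> 5 * e" "e \<le> \<mu>" for e g
  proof -
    have "exp_family M (F2 e g) (\<lambda>(i, j). if j = 0 \<or> j = y + e then 1/2 - s e else 1) ({..y} \<times> {..y + e})"
      unfolding F2_def
      by (rule exp_family_scaled[OF X]) (use g s[OF e] in \<open>auto simp: inj_on_def split: prod.splits\<close>)
    from prob_diagonal_below[OF this s[OF e]] e \<mu> y0
    have "prob (V2 e g) \<le> 16 * exp (2 - 3 * (s e)\<^sup>2 * real e)" by (simp add: V2_def s_def)
    also have "exp (2 - 3 * (s e)\<^sup>2 * real e) \<le> exp (2 - Q / 10 ^ 17)"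
    proof -
      have "(2 / 5 * real \<mu>) ^ 3 \<le> real e ^ 3" using e by (intro power_mono) auto
      then have "3 / 46656 * (8 / 125 * real \<mu> ^ 3) / (real y)\<^sup>2 \<le> 3 / 46656 * real e ^ 3 / (real y)\<^sup>2"
        by (intro divide_right_mono mult_left_mono) (auto simp: power_mult_distrib power_divide)
      also have "\<dots> = 3 * (s e)\<^sup>2 * real e"
        using y0 by (simp add: s_def power_divide power_mult_distrib power2_eq_square power3_eq_cube)
      finally have "(3 / 46656 * (8 / 125)) * Q \<le> 3 * (s e)\<^sup>2 * real e" by (simp add: Q_def)
      moreover have "1 / 10 ^ 17 * Q \<le> (3 / 46656 * (8 / 125)) * Q" using Q0 by (intro mult_right_mono) auto
      ultimately show ?thesis by simp
    qed
    also have "\<dots> = exp 2 * E" by (simp only: E_eq mult_exp_exp diff_conv_add_uminus)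
    finally show ?thesis by simp
  qed
  \<comment> \<open>Reflection at the end point \<open>(y + q, y)\<close>. After a visit to the
    diagonal the excess is horizontal, so \<open>g'\<close> also swaps the coordinates.\<close>
  define g where "g = (\<lambda>(i :: nat, j :: nat). (int (y + q) - int i, int y - int j))"
  define g' where "g' = (\<lambda>(i, j). g (j, i))"
  have inj: "inj g" "inj g'" by (auto simp: g_def g'_def inj_on_def)
  define Bad where "Bad = T0 \<union> (V1 (\<mu> - 1) \<union> (V1 0 \<union> (V2 d g \<union> V2 q g')))"
  have Bad_sets: "Bad \<in> events" unfolding Bad_def using T0_sets V_sets by blast
  have "prob Bad \<le> prob T0 + (prob (V1 (\<mu> - 1)) + (prob (V1 0) + (prob (V2 d g) + prob (V2 q g'))))"
    unfolding Bad_def using T0_sets V_sets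
    by (intro order.trans[OF measure_Un_le] add_mono order.refl sets.Un) auto
  also have "\<dots> \<le> 3 * E + (16 * exp 1 * E + (16 * exp 1 * E + (16 * exp 2 * E + 16 * exp 2 * E)))"
    using \<mu> dq by (intro add_mono pT0 pV1 pV2 inj) auto
  also have "\<dots> = (3 + 32 * exp 1 + 32 * exp 2) * E" by (simp add: algebra_simps)
  also have "\<dots> \<le> 400 * E"
  proof (intro mult_right_mono)
    have e1: "exp (1 :: real) \<le> 3" using exp_le by simp
    have "exp (2 :: real) = exp 1 * exp 1" by (simp add: mult_exp_exp)
    also have "\<dots> \<le> 3 * 3" using e1 by (intro mult_mono) auto
    finally show "3 + 32 * exp 1 + 32 * exp 2 \<le> (400 :: real)" using e1 by simp
  qed (simp add: E_def)
  finally have pBad: "prob Bad \<le> 400 * E" .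
  have good: "no_crossing (env \<omega>) (y + q) y \<mu> \<and> no_crossing (env \<omega>) (y + q) y 1"
    if nn: "\<And>p. 0 \<le> X p \<omega>" and \<omega>: "\<omega> \<in> space M" "\<omega> \<notin> Bad" for \<omega>
  proof -
    define B where "B = passage (\<lambda>i j. env \<omega> (Suc i) j)"
    define R where "R i j = passage (\<lambda>a b. env \<omega> (y + q - a) (y - b)) (y + q - i) (y - j)" for i j
    have env: "env \<omega> i j = X (int i, int j) \<omega> / (if j = 0 then 1/2 - 2 * \<delta> else 1)" for i j
      by (simp add: env_def full_env_def \<delta>_def)
    have T: "2 * real (y + q + y) < B (y + q - 1) y"
    proof -
      have "passage (\<lambda>i j. F0 (i, j) \<omega>) (y + q - 1) y = B (y + q - 1) y"
        unfolding B_def by (rule passage_cong) (simp add: F0_def env)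
      moreover have "Suc (y + q - 1) = y + q" using dq by simp
      moreover have "\<not> passage (\<lambda>i j. F0 (i, j) \<omega>) (y + q - 1) y \<le> 2 * real (Suc (y + q - 1) + y) + 20 * \<delta>\<^sup>2 * real y"
        using \<omega> by (simp add: Bad_def T0_def)
      ultimately have "2 * real (y + q + y) + 20 * \<delta>\<^sup>2 * real y < B (y + q - 1) y" by (simp only: not_le)
      moreover have "0 \<le> 20 * \<delta>\<^sup>2 * real y" by simp
      ultimately show ?thesis by linarith
    qed
    have B1: "B (a + dx) (a + 1) \<le> 2 * real (dx + 1) + A + 4 * real a" if "a < y" "dx = \<mu> - 1 \<or> dx = 0" for a dx
    proof -
      have "passage (\<lambda>i j. F1 (i, j) \<omega>) (a + dx) (a + 1) = B (a + dx) (a + 1)"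
        unfolding B_def by (rule passage_cong) (use that in \<open>auto simp: F1_def env\<close>)
      moreover have "\<omega> \<notin> V1 dx" using \<omega>(2) that(2) by (auto simp: Bad_def)
      then have "\<not> 2 * real (dx + 1) + A + 4 * real a < passage (\<lambda>i j. F1 (i, j) \<omega>) (a + dx) (a + 1)"
        using \<omega>(1) that(1) unfolding V1_def by blast
      ultimately show ?thesis by (simp only: not_less)
    qed
    \<comment> \<open>The last piece is kept off the bottom row, so its weights are unscaled, and
      the heavy rows of \<open>F2\<close> only enlarge them.\<close>
    have V2: "passage w a (a + e) \<le> 2 * real e - s e * real e + 4 * real a"
      if "\<omega> \<notin> V2 e g" "a < y" "2 * \<mu> \<le> 5 * e" "e \<le> \<mu>"
        and w: "\<And>i j. i \<le> a \<Longrightarrow> j \<le> a + e \<Longrightarrow> w i j = X (g (i, j)) \<omega>" for w a e g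
    proof -
      have "passage w a (a + e) \<le> passage (\<lambda>i j. F2 e g (i, j) \<omega>) a (a + e)"
      proof (rule passage_mono)
        fix i j assume "i \<le> a" "j \<le> a + e"
        then show "w i j \<le> F2 e g (i, j) \<omega>"
          using nn[of "g (i, j)"] s[OF that(3,4)] by (auto simp: w F2_def field_simps intro: mult_left_le)
      qed
      moreover have "\<not> 2 * real e - s e * real e + 4 * real a < passage (\<lambda>i j. F2 e g (i, j) \<omega>) a (a + e)"
        using \<omega>(1) that(1,2) unfolding V2_def by blast
      ultimately show ?thesis by (simp only: not_less order.trans)
    qed
    have R1: "R (y + q - a) (y - (a + d)) \<le> 2 * real d - s d * real d + 4 * real a" if "a + d < y" for a
    proof -
      have eq: "y + q - (y + q - a) = a" "y - (y - (a + d)) = a + d" using that by auto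
      show ?thesis unfolding R_def eq
        by (rule V2[of d g]) (use \<omega> that dq in \<open>auto simp: Bad_def env g_def of_nat_diff\<close>)
    qed
    have R2: "R (y - a) (y - a) \<le> 2 * real q - s q * real q + 4 * real a" if "a < y" for a
    proof -
      have eq: "y + q - (y - a) = a + q" "y - (y - a) = a" using that by auto
      show ?thesis unfolding R_def eq passage_transpose[symmetric, of _ "a + q" a]
        by (rule V2[of q g']) (use \<omega> that dq in \<open>auto simp: Bad_def env g_def g'_def of_nat_diff\<close>)
    qed
    have A_le: "A \<le> s e * real e" if "2 * \<mu> \<le> 5 * e" for e
    proof -
      have "(2 / 5 * real \<mu>)\<^sup>2 \<le> (real e)\<^sup>2" using that by (intro power_mono) auto
      then have le: "4 / 25 * (real \<mu>)\<^sup>2 / 216 \<le> (real e)\<^sup>2 / 216" by (simp add: power_mult_distrib power_divide)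
      have "(real \<mu>)\<^sup>2 / 10 ^ 4 \<le> 4 / 25 * (real \<mu>)\<^sup>2 / 216" by simp
      from order.trans[OF this le] have "(real \<mu>)\<^sup>2 / 10 ^ 4 / real y \<le> (real e)\<^sup>2 / 216 / real y"
        using y0 by (intro divide_right_mono) auto
      then show ?thesis by (simp add: A_def s_def power2_eq_square)
    qed
    \<comment> \<open>The linear parts of the two pieces do not exceed that of the total, and the
      allowance \<open>A\<close> of the first piece is paid by the parabolic loss \<open>u\<close>
      of the second.\<close>
    have sum: "b + r < t" if "b \<le> 2 * x + A + 4 * c" "r \<le> 2 * z - u + 4 * k" "A \<le> u" "2 * (x + z + 2 * c + 2 * k) \<le> t'" "t' < t"
      for b r t t' x c z u k :: real using that by argo
    show ?thesis
      unfolding no_crossing_def B_def[symmetric] R_def[symmetric]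
    proof (intro conjI allI impI)
      fix a assume a: "1 \<le> a \<and> a \<le> y \<and> a + \<mu> - 1 \<le> y + q"
      \<comment> \<open>Counted from \<open>(1, 0)\<close>, the site
        \<open>(a + \<mu> - 1, a)\<close> is \<open>(a - 1 + (\<mu> - 1), a - 1 + 1)\<close>; from
        it \<open>k\<close> right steps and \<open>k + d\<close> up steps lead to the end
        point.\<close>
      define k where "k = y + q - (a + \<mu> - 1)"
      have k: "k + d + a = y" "k + d < y" using a dq by (auto simp: k_def)
      have e1: "a + \<mu> - 2 = (a - 1) + (\<mu> - 1)" "a - 1 + 1 = a" "a - 1 < y" "\<mu> - 1 + 1 = \<mu>" using a \<mu> by auto
      have e2: "y + q - k = a + \<mu> - 1" "y - (k + d) = a" using a k by (auto simp: k_def)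
      show "B (a + \<mu> - 2) a + R (a + \<mu> - 1) a < B (y + q - 1) y"
      proof (rule sum[OF _ R1[OF k(2), unfolded e2] A_le[OF dq(5)] _ T])
        show "B (a + \<mu> - 2) a \<le> 2 * real \<mu> + A + 4 * real (a - 1)"
          using B1[OF e1(3), of "\<mu> - 1"] unfolding e1 by simp
        show "2 * (real \<mu> + real d + 2 * real (a - 1) + 2 * real k) \<le> 2 * real (y + q + y)"
          using dq(7) k(1) a by (simp add: of_nat_diff)
      qed
    next
      fix a assume "1 \<le> a \<and> a \<le> y \<and> a + 1 - 1 \<le> y + q"
      then have a: "1 \<le> a" "a \<le> y" and e: "a - 1 < y" "a - 1 + 0 = a + 1 - 2" "a - 1 + 1 = a" "y - a < y" "y - (y - a) = a + 1 - 1" by auto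
      show "B (a + 1 - 2) a + R (a + 1 - 1) a < B (y + q - 1) y"
      proof (rule sum[OF B1[OF e(1), of 0, unfolded e(2,3)] _ A_le[OF dq(6)] _ T])
        show "R (a + 1 - 1) a \<le> 2 * real q - s q * real q + 4 * real (y - a)"
          using R2[OF e(4), unfolded e(5)] by simp
        show "2 * (real (0 + 1) + real q + 2 * real (a - 1) + 2 * real (y - a)) \<le> 2 * real (y + q + y)"
          using a by (simp add: of_nat_diff)
      qed simp
    qed
  qed
  show ?thesis
  proof (intro bexI[OF _ Bad_sets] conjI)
    show "prob Bad \<le> 400 * exp (- (real \<mu> ^ 3 / (10 ^ 17 * (real y)\<^sup>2)))" using pBad by (simp add: E_def)
    have "AE \<omega> in M. \<forall>p\<in>UNIV. 0 \<le> X p \<omega>"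
      by (rule exp_family_AE_nonneg[OF X]) simp
    then show "AE \<omega> in M. \<omega> \<notin> Bad \<longrightarrow> no_crossing (env \<omega>) (y + q) y \<mu> \<and> no_crossing (env \<omega>) (y + q) y 1"
      using AE_space by eventually_elim (use good in blast)
  qed
qed

section \<open>Coupling of the models\<close>

text \<open>Multipliers for weights of rate 1: \<open>b\<close> is the mean on the bottom row, so
  \<open>1 / (1 - \<rho>)\<close> gives the stationary model and 0 the point-to-point model.\<close>

definition model_scale :: "real \<Rightarrow> real \<Rightarrow> site \<Rightarrow> real" where
  "model_scale b \<rho> = (\<lambda>(i, j). if (i, j) = (0, 0) then 0 else if i = j then 1 / \<rho> else if j = 0 then b else 1)"

definition model_env :: "real \<Rightarrow> real \<Rightarrow> (site \<Rightarrow> 'a \<Rightarrow> real) \<Rightarrow> 'a \<Rightarrow> site \<Rightarrow> real" where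
  "model_env b \<rho> X \<omega> = (\<lambda>p\<in>half_space. model_scale b \<rho> p * X p \<omega>)"

lemma exp_family_half_space: "exp_family M X (\<lambda>_. 1) UNIV \<Longrightarrow> exp_family M X (\<lambda>_. 1) half_space"
  by (rule exp_family_reindex[where f = "\<lambda>p. p"]) auto

lemma distr_model_env:
  assumes X: "exp_family M X (\<lambda>_. 1) UNIV" and "0 \<le> b" "0 < \<rho>"
  shows "distr M env_borel (model_env b \<rho> X) =
    Pi\<^sub>M half_space (\<lambda>p. if model_scale b \<rho> p = 0 then return borel 0 else exp_law (1 / model_scale b \<rho> p))"
  unfolding model_env_def
  by (rule distr_scaled_exp_family[OF exp_family_half_space[OF X]]) (use assms in \<open>auto simp: model_scale_def\<close>)

lemma stationary_model_eq_distr: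
  assumes X: "exp_family M X (\<lambda>_. 1) UNIV" and \<rho>: "0 < \<rho>" "\<rho> < 1"
  shows "stationary_model \<rho> = distr M env_borel (model_env (1 / (1 - \<rho>)) \<rho> X)"
  using \<rho> unfolding stationary_model_def
  by (subst distr_model_env[OF X]) (auto simp: model_scale_def stationary_law_def intro!: PiM_cong)

lemma point_to_point_model_eq_distr:
  assumes X: "exp_family M X (\<lambda>_. 1) UNIV" and \<rho>: "0 < \<rho>"
  shows "point_to_point_model \<rho> = distr M env_borel (model_env 0 \<rho> X)"
  using \<rho> unfolding point_to_point_model_def
  by (subst distr_model_env[OF X]) (auto simp: model_scale_def point_to_point_law_def intro!: PiM_cong)

lemma measurable_model_env:
  assumes X: "exp_family M X (\<lambda>_. 1) UNIV"
  shows "model_env b \<rho> X \<in> measurable M env_borel"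
  unfolding model_env_def
  by (intro measurable_restrict borel_measurable_times borel_measurable_const exp_family_measurable[OF X]) simp

lemma prob_avoids_distr:
  assumes X: "exp_family M X (\<lambda>_. 1) UNIV" and "n \<le> m"
  shows "\<P>(\<omega> in distr M env_borel (model_env b \<rho> X). avoids (int m, int n) A \<omega>) =
    \<P>(\<omega> in M. avoids (int m, int n) A (model_env b \<rho> X \<omega>))" (is ?eq)
    and "{\<omega> \<in> space M. avoids (int m, int n) A (model_env b \<rho> X \<omega>)} \<in> sets M" (is ?sets)
proof -
  note me = measurable_model_env[OF X, of b \<rho>] and av = sets_avoids[OF assms(2), of A]
  have eq: "model_env b \<rho> X -` {\<omega> \<in> space env_borel. avoids (int m, int n) A \<omega>} \<inter> space M =
      {\<omega> \<in> space M. avoids (int m, int n) A (model_env b \<rho> X \<omega>)}"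
    using measurable_space[OF me] by auto
  show ?eq unfolding space_distr eq[symmetric] by (rule measure_distr[OF me av])
  show ?sets unfolding eq[symmetric] by (rule measurable_sets[OF me av])
qed

lemma AE_inj_model_env:
  assumes X: "exp_family M X (\<lambda>_. 1) UNIV" and \<rho>: "0 < \<rho>"
  shows "AE \<omega> in M. inj_on (path_weight (model_env b \<rho> X \<omega>)) (half_space_paths (int m, int n))"
  unfolding model_env_def
  by (rule AE_inj_path_weight[OF exp_family_half_space[OF X]]) (use \<rho> in \<open>auto simp: model_scale_def\<close>)

abbreviation iid_field :: "(site \<Rightarrow> real) measure" where
  "iid_field \<equiv> Pi\<^sub>M UNIV (\<lambda>_. exp_law 1)"

lemma iid_field: "exp_family iid_field (\<lambda>p \<omega>. \<omega> p) (\<lambda>_. 1) UNIV"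
  by (rule exp_family_PiM[of UNIV "\<lambda>_. 1"]) auto

text \<open>Under the coupling the environments agree off the bottom row, where the stationary one
  is larger; so avoidance almost surely passes from the stationary geodesic to the other.\<close>

lemma point_to_point_avoids_ge:
  assumes \<rho>: "0 < \<rho>" "\<rho> < 1" and nm: "n \<le> m"
  shows "\<P>(\<omega> in stationary_model \<rho>. avoids (int m, int n) (offset_line \<mu>) \<omega>)
    \<le> \<P>(\<omega> in point_to_point_model \<rho>. avoids (int m, int n) (offset_line \<mu>) \<omega>)"
proof -
  note X = iid_field
  interpret prob_space iid_field using X by (simp add: exp_family_def)
  let ?S = "\<lambda>e. {\<omega> \<in> space iid_field. avoids (int m, int n) (offset_line \<mu>) (e \<omega>)}"
  let ?X = "\<lambda>p \<omega> :: site \<Rightarrow> real. \<omega> p"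
  let ?e = "model_env (1 / (1 - \<rho>)) \<rho> ?X" and ?e' = "model_env 0 \<rho> ?X"
  have "AE \<omega> in iid_field. \<omega> \<in> ?S ?e \<longrightarrow> \<omega> \<in> ?S ?e'"
    using AE_inj_model_env[OF X \<rho>(1), of "1 / (1 - \<rho>)" m n] AE_inj_model_env[OF X \<rho>(1), of 0 m n]
      exp_family_AE_nonneg[OF X countableI_type] AE_space
  proof eventually_elim
    case (elim \<omega>)
    have "avoids (int m, int n) (offset_line \<mu>) (?e' \<omega>)"
      if "avoids (int m, int n) (offset_line \<mu>) (?e \<omega>)"
    proof (rule avoids_mono[OF elim(2,1) nm _ _ that])
      fix i j :: nat
      show "?e' \<omega> (int i, int j) \<le> ?e \<omega> (int i, int j)" if "j < i"
        using that elim(3) \<rho> by (auto simp: model_env_def model_scale_def half_space_def)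
      show "?e \<omega> (int i, int j) \<le> ?e' \<omega> (int i, int j)" if "1 \<le> j" "j \<le> i"
        using that by (auto simp: model_env_def model_scale_def half_space_def)
    qed
    then show ?case using elim by simp
  qed
  then have "prob (?S ?e) \<le> prob (?S ?e')"
    by (rule finite_measure_mono_AE) (rule prob_avoids_distr(2)[OF X nm])
  then show ?thesis
    unfolding stationary_model_eq_distr[OF X \<rho>] point_to_point_model_eq_distr[OF X \<rho>(1)]
      prob_avoids_distr(1)[OF X nm] .
qed

text \<open>The bound on \<open>\<rho>\<close> says
  \<open>1/2 - 2 * \<delta> \<le> 1 - \<rho>\<close>, so the bottom row of the quadrant dominates
  the stationary one; on the diagonal the factor \<open>1 / \<rho>\<close> exceeds 1. The bound on
  \<open>m\<close> allows moving the end point right to the midpoint between diagonal and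
  line.\<close>

lemma stationary_avoids_ge:
  assumes \<rho>: "0 < \<rho>" "\<rho> < 1" and \<mu>: "10 \<le> \<mu>" "\<mu> \<le> n" and nm: "n \<le> m" "m \<le> n + \<mu> div 2"
    and \<rho>': "\<rho> \<le> 1/2 + 2 * (real \<mu> / (10 ^ 6 * real n))"
  shows "1 - 400 * exp (- (real \<mu> ^ 3 / (10 ^ 17 * (real n)\<^sup>2)))
    \<le> \<P>(\<omega> in stationary_model \<rho>. avoids (int m, int n) (offset_line \<mu>) \<omega>)"
proof -
  note X = iid_field
  interpret prob_space iid_field using X by (simp add: exp_family_def)
  let ?S = "\<lambda>e. {\<omega> \<in> space iid_field. avoids (int m, int n) (offset_line \<mu>) (e \<omega>)}"
  let ?X = "\<lambda>p \<omega> :: site \<Rightarrow> real. \<omega> p"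
  let ?e = "model_env (1 / (1 - \<rho>)) \<rho> ?X"
  define \<delta> where "\<delta> = real \<mu> / (10 ^ 6 * real n)"
  define q where "q = \<mu> div 2"
  have \<delta>: "0 < \<delta>" "\<delta> \<le> 1 / 10 ^ 6"
    using \<mu> by (auto simp: \<delta>_def field_simps)
  obtain Bad where Bad: "Bad \<in> events" "prob Bad \<le> 400 * exp (- (real \<mu> ^ 3 / (10 ^ 17 * (real n)\<^sup>2)))"
    and good: "AE \<omega> in iid_field. \<omega> \<notin> Bad \<longrightarrow>
      no_crossing (full_env \<delta> \<omega>) (n + q) n \<mu> \<and> no_crossing (full_env \<delta> \<omega>) (n + q) n 1"
    using prob_no_crossing[OF X \<mu> q_def] unfolding \<delta>_def by blast
  have "AE \<omega> in iid_field. \<omega> \<in> space iid_field - Bad \<longrightarrow> \<omega> \<in> ?S ?e"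
    using AE_inj_model_env[OF X \<rho>(1), of "1 / (1 - \<rho>)" m n] exp_family_AE_nonneg[OF X countableI_type] good AE_space
  proof eventually_elim
    case (elim \<omega>)
    show ?case
    proof (intro impI CollectI conjI)
      assume \<omega>: "\<omega> \<in> space iid_field - Bad"
      then show "\<omega> \<in> space iid_field" by simp
      from \<omega> elim(3) have nc: "no_crossing (full_env \<delta> \<omega>) (n + q) n \<mu>" "no_crossing (full_env \<delta> \<omega>) (n + q) n 1"
        by blast+
      have nn: "0 \<le> \<omega> p" for p using elim(2) by blast
      obtain f where f: "geodesic (?e \<omega>) (int m, int n) = path_sites f (m + n)"
          "heaviest (\<lambda>i j. ?e \<omega> (int i, int j)) f m n"
        using geodesicE[OF elim(1) nm(1)] .
      then have path: "lattice_path f m n" by (auto simp: heaviest_def half_space_path_def)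
      show "avoids (int m, int n) (offset_line \<mu>) (?e \<omega>)"
        unfolding avoids_path_sites[OF f(1) path refl]
      proof (intro allI impI no_hit[OF f(2), of "n + q" \<mu> "full_env \<delta> \<omega>"])
        show "m \<le> n + q" using nm by (simp add: q_def)
        show "n < n + q" "n + q + 1 < n + \<mu>" using \<mu> by (auto simp: q_def)
        fix i j :: nat
        show "0 \<le> full_env \<delta> \<omega> i j" using nn \<delta> by (auto simp: full_env_def)
        show "?e \<omega> (int i, int j) \<le> full_env \<delta> \<omega> i j" if "j < i"
        proof (cases "j = 0")
          case True
          have "1/2 - 2 * \<delta> \<le> 1 - \<rho>" "0 < 1/2 - 2 * \<delta>" using \<rho>' \<delta> by (auto simp: \<delta>_def)
          then have "\<omega> (int i, 0) / (1 - \<rho>) \<le> \<omega> (int i, 0) / (1/2 - 2 * \<delta>)"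
            using nn \<rho> by (intro divide_left_mono) auto
          then show ?thesis
            using that True by (auto simp: model_env_def model_scale_def half_space_def full_env_def)
        next
          case False
          then show ?thesis
            using that by (auto simp: model_env_def model_scale_def half_space_def full_env_def)
        qed
        show "full_env \<delta> \<omega> i j \<le> ?e \<omega> (int i, int j)" if "1 \<le> j" "j \<le> i"
          using that \<rho> nn[of "(int i, int j)"]
          by (auto simp: model_env_def model_scale_def half_space_def full_env_def field_simps intro: mult_left_le_one_le)
      qed (use nc in auto)
    qed
  qed
  then have "prob (space iid_field - Bad) \<le> prob (?S ?e)"
    by (rule finite_measure_mono_AE) (rule prob_avoids_distr(2)[OF X nm(1)])
  moreover have "prob (space iid_field - Bad) = 1 - prob Bad" by (rule prob_compl[OF Bad(1)])
  ultimately show ?thesis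
    using Bad(2)
    unfolding stationary_model_eq_distr[OF X \<rho>] prob_avoids_distr(1)[OF X nm(1)] by linarith
qed

section \<open>Scaling in N and choice of the constants\<close>

lemma eventually_small:
  fixes f :: "nat \<Rightarrow> real"
  assumes "f \<longlonglongrightarrow> 0" "0 < e"
  shows "\<forall>\<^sub>F N in sequentially. \<bar>c * f N\<bar> < e"
  using tendstoD[OF tendsto_mult_right_zero[OF assms(1), of c] assms(2)] by (simp add: dist_real_def)

theorem theorem5p2:
  fixes M\<^sub>1 \<kappa> :: real
  assumes "M\<^sub>1 \<ge> 0"
  shows "\<exists>C>0. \<exists>c>0. \<forall>A>0. \<forall>\<^sub>F N :: nat in sequentially. \<forall>M :: real.
    M \<ge> M\<^sub>1 + 9 \<and> M \<le> A * (real N powr (1 / 3) / ln (real N)) \<longrightarrow>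
      \<P>(\<omega> in point_to_point_model (critical_rho \<kappa> N). avoids (endpoint M\<^sub>1 N) (diagonal_line M N) \<omega>)
        \<ge> \<P>(\<omega> in stationary_model (critical_rho \<kappa> N). avoids (endpoint M\<^sub>1 N) (diagonal_line M N) \<omega>)
    \<and> \<P>(\<omega> in stationary_model (critical_rho \<kappa> N). avoids (endpoint M\<^sub>1 N) (diagonal_line M N) \<omega>)
        \<ge> 1 - C * exp (- c * (M - M\<^sub>1) ^ 3)"
proof -
  \<comment> \<open>The value comes from \<open>\<mu>^3 / (10^17 * n^2)\<close> with
    \<open>\<mu>\<close> at least \<open>M * T / 2\<close>, \<open>n\<close> at most
    \<open>N\<close> and \<open>T^3 = 4 * N^2\<close>, where \<open>T\<close> is
    \<open>(2 * N)\<close> to the power \<open>2/3\<close>.\<close>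
  define c :: real where "c = 1 / (2 * 10 ^ 17)"
  \<comment> \<open>From \<open>4 * M\<^sub>1 + 4\<close> on, the end point lies left of the
    midpoint between diagonal and line; from \<open>10^6 * \<bar>\<kappa>\<bar>\<close> on,
    \<open>2 * \<delta>\<close> dominates the shift of \<open>\<rho>\<close> from
    \<open>1/2\<close>. For smaller \<open>M\<close> the second summand of \<open>C\<close> makes
    the bound trivial.\<close>
  define M0 where "M0 = max (4 * M\<^sub>1 + 4) (10 ^ 6 * \<bar>\<kappa>\<bar>)"
  define C where "C = 400 + exp (c * M0 ^ 3)"
  have c: "0 < c" by (simp add: c_def)
  have C: "0 < C" by (simp add: C_def add_pos_pos)
  \<comment> \<open>With \<open>t\<close> and, below, \<open>u\<close> the cube roots of 2 and
    \<open>N\<close>, the fractional powers become monomials, for instance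
    \<open>T = t^2 * u^2\<close>.\<close>
  define t :: real where "t = 2 powr (1/3)"
  have t: "t ^ 3 = 2" "1 \<le> t"
    by (auto simp: t_def powr_powr simp flip: powr_realpow intro: ge_one_powr_ge_zero)
  let ?p = "\<lambda>model N M. \<P>(\<omega> in model (critical_rho \<kappa> N). avoids (endpoint M\<^sub>1 N) (diagonal_line M N) \<omega>)"
  \<comment> \<open>\<open>C\<close> and \<open>c\<close> are already fixed; only the threshold for
    \<open>N\<close> depends on \<open>A\<close>.\<close>
  have main: "\<forall>\<^sub>F N :: nat in sequentially. \<forall>M :: real. M \<ge> M\<^sub>1 + 9 \<and> M \<le> A * (real N powr (1 / 3) / ln (real N)) \<longrightarrow>
      ?p point_to_point_model N M \<ge> ?p stationary_model N M \<and>
      ?p stationary_model N M \<ge> 1 - C * exp (- c * (M - M\<^sub>1) ^ 3)" if A: "0 < A" for A :: real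
  proof -
    have p: "(\<lambda>N. real N powr (- 1 / 3)) \<longlonglongrightarrow> 0"
      by (intro tendsto_neg_powr filterlim_real_sequentially) simp
    have l: "(\<lambda>N. 1 / ln (real N)) \<longlonglongrightarrow> 0"
      by (intro tendsto_divide_0[OF tendsto_const] filterlim_at_top_imp_at_infinity
          filterlim_compose[OF ln_at_top filterlim_real_sequentially])
    have e1: "\<forall>\<^sub>F N in sequentially. \<bar>\<kappa> * 2 powr (- 4 / 3) * real N powr (- 1 / 3)\<bar> < 1/2"
      by (rule eventually_small[OF p]) simp
    have e2: "\<forall>\<^sub>F N in sequentially. \<bar>M\<^sub>1 * 2 powr (2/3) * real N powr (- 1 / 3)\<bar> < 1/4"
      by (rule eventually_small[OF p]) simp
    have e3: "\<forall>\<^sub>F N in sequentially. \<bar>A * 2 powr (2/3) * (1 / ln (real N))\<bar> < 1/2"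
      by (rule eventually_small[OF l]) simp
    have e4: "\<forall>\<^sub>F N :: nat in sequentially. 10 \<le> N" by (rule eventually_ge_at_top)
    show ?thesis
      using e1 e2 e3 e4
    proof eventually_elim
      case (elim N)
      define u where "u = real N powr (1/3)"
      have N: "10 \<le> real N" using elim(4) by simp
      have u: "u ^ 3 = real N" "1 \<le> u"
        using N by (auto simp: u_def powr_powr simp flip: powr_realpow intro!: ge_one_powr_ge_zero)
      have u0: "0 < u" and t0: "0 < t" using u t by auto
      define T where "T = (2 * real N) powr (2/3)"
      have powr23: "x powr (2/3) = (x powr (1/3))\<^sup>2" if "0 \<le> x" for x :: real
        using that by (cases "x = 0") (auto simp: powr_powr simp flip: powr_realpow)
      have T: "T = t\<^sup>2 * u\<^sup>2"
        using N by (simp add: T_def powr23 powr_mult t_def u_def power_mult_distrib)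
      have u_inv: "real N powr (- 1 / 3) = 1 / u"
        using N by (simp add: u_def powr_minus_divide)
      have t2: "2 powr (2/3) = t\<^sup>2" by (simp add: powr23 t_def)
      have t4: "2 powr (- 4 / 3) = 1 / (2 * t)"
      proof -
        have "(2 :: real) powr (- 4 / 3) = 2 powr (- 1) * 2 powr (- (1 / 3))"
          by (subst powr_add[symmetric]) simp
        also have "\<dots> = 1 / (2 * t)" unfolding t_def powr_minus_divide by simp
        finally show ?thesis .
      qed
      have T_N: "T * u = t\<^sup>2 * real N" by (simp add: T u(1)[symmetric] power2_eq_square power3_eq_cube)
      have T3: "T ^ 3 = 4 * (real N)\<^sup>2"
      proof -
        have "T ^ 3 = (t ^ 3)\<^sup>2 * (u ^ 3)\<^sup>2" by (simp add: T power_mult_distrib flip: power_mult)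
        then show ?thesis by (simp add: u t)
      qed
      have T2: "2 \<le> T"
      proof (rule power_le_imp_le_base)
        have "10\<^sup>2 \<le> (real N)\<^sup>2" using N by (intro power_mono) auto
        then show "2 ^ Suc 2 \<le> T ^ Suc 2" using T3 by (simp add: eval_nat_numeral)
        show "0 \<le> T" by (simp add: T)
      qed
      define \<rho> where "\<rho> = critical_rho \<kappa> N"
      have \<rho>_eq: "\<rho> = 1/2 + \<kappa> / (2 * t * u)"
        unfolding \<rho>_def critical_rho_def t4 u_inv by simp
      have \<rho>: "0 < \<rho>" "\<rho> < 1"
        using elim(1) by (auto simp: \<rho>_def critical_rho_def abs_less_iff)
      have M1T: "M\<^sub>1 * T \<le> real N / 4"
      proof -
        have "M\<^sub>1 * t\<^sup>2 / u \<le> 1/4" using elim(2) unfolding t2 u_inv abs_less_iff by simp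
        then have "M\<^sub>1 * t\<^sup>2 / u * real N \<le> 1/4 * real N" by (intro mult_right_mono) auto
        also have "M\<^sub>1 * t\<^sup>2 / u * real N = M\<^sub>1 * T"
          using u0 T_N by (simp add: field_simps)
        finally show ?thesis by simp
      qed
      define m where "m = nat \<lfloor>real N + M\<^sub>1 * T\<rfloor>"
      define n where "n = nat \<lfloor>real N - M\<^sub>1 * T\<rfloor>"
      have M1T0: "0 \<le> M\<^sub>1 * T" using assms T2 by simp
      have m: "int m = \<lfloor>real N + M\<^sub>1 * T\<rfloor>" using M1T0 by (simp add: m_def)
      have n: "int n = \<lfloor>real N - M\<^sub>1 * T\<rfloor>" using M1T N by (simp add: n_def)
      have m': "real m \<le> real N + M\<^sub>1 * T" using m by linarith
      have n': "real n \<le> real N - M\<^sub>1 * T" "real N - M\<^sub>1 * T - 1 < real n" using n by linarith+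
      have nm: "n \<le> m"
      proof -
        have "\<lfloor>real N - M\<^sub>1 * T\<rfloor> \<le> \<lfloor>real N + M\<^sub>1 * T\<rfloor>" using M1T0 by (intro floor_mono) auto
        then show ?thesis using m n by linarith
      qed
      have end_eq: "endpoint M\<^sub>1 N = (int m, int n)"
        unfolding endpoint_def T_def[symmetric] m n ..
      show ?case
      proof (intro allI impI)
        fix M assume M: "M \<ge> M\<^sub>1 + 9 \<and> M \<le> A * (real N powr (1 / 3) / ln (real N))"
        define \<mu> where "\<mu> = nat \<lfloor>M * T\<rfloor>"
        have M9: "9 \<le> M" using M assms by linarith
        have MT: "18 \<le> M * T" using mult_mono[of 9 M 2 T] M9 T2 by simp
        have \<mu>: "int \<mu> = \<lfloor>M * T\<rfloor>" using MT by (simp add: \<mu>_def)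
        have \<mu>': "real \<mu> \<le> M * T" "M * T - 1 < real \<mu>" using \<mu> by linarith+
        have line_eq: "diagonal_line M N = offset_line \<mu>"
          unfolding diagonal_line_def T_def[symmetric] \<mu> ..
        let ?q = "\<lambda>model. \<P>(\<omega> in model \<rho>. avoids (int m, int n) (offset_line \<mu>) \<omega>)"
        have 1: "?q stationary_model \<le> ?q point_to_point_model"
          by (rule point_to_point_avoids_ge[OF \<rho> nm])
        have "1 - C * exp (- c * (M - M\<^sub>1) ^ 3) \<le> ?q stationary_model"
        proof (cases "M < M0")
          case True
          have "(M - M\<^sub>1) ^ 3 \<le> M0 ^ 3" using True assms M9 M by (intro power_mono) auto
          then have "exp (- (c * M0 ^ 3)) \<le> exp (- c * (M - M\<^sub>1) ^ 3)" using c by simp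
          then have "exp (c * M0 ^ 3) * exp (- (c * M0 ^ 3)) \<le> C * exp (- c * (M - M\<^sub>1) ^ 3)"
            by (intro mult_mono) (auto simp: C_def)
          then have "1 - C * exp (- c * (M - M\<^sub>1) ^ 3) \<le> 0" by (simp add: mult_exp_exp)
          then show ?thesis using measure_nonneg order.trans by blast
        next
          case False
          then have M0: "4 * M\<^sub>1 + 4 \<le> M" "10 ^ 6 * \<bar>\<kappa>\<bar> \<le> M" by (auto simp: M0_def)
          have half: "M * T / 2 \<le> real \<mu>" using \<mu>' MT by linarith
          have \<mu>10: "10 \<le> \<mu>" using \<mu>' MT by linarith
          \<comment> \<open>The growth bound on \<open>M\<close> enters here: it makes
            \<open>M * T / N\<close> at most a constant over \<open>ln N\<close>, so eventually at
            most \<open>1/2\<close>, while \<open>n\<close> is close to \<open>3/4 * N\<close> or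
            larger.\<close>
          have \<mu>n: "\<mu> \<le> n"
          proof -
            have "M * T \<le> A * (u / ln (real N)) * T"
              using M T2 by (intro mult_right_mono) (auto simp: u_def)
            also have "\<dots> = A * t\<^sup>2 / ln (real N) * real N"
              using T_N by (simp add: field_simps)
            also have "\<dots> \<le> 1/2 * real N"
              using elim(3) unfolding abs_less_iff by (intro mult_right_mono) (auto simp: t2)
            finally have "M * T \<le> real N / 2" by simp
            then have "real \<mu> \<le> real n" using \<mu>' n' M1T N by linarith
            then show ?thesis by simp
          qed
          \<comment> \<open>The difference \<open>m - n\<close> is about
            \<open>2 * M\<^sub>1 * T\<close>; the summand 4 in \<open>M0\<close> absorbs all
            roundings because \<open>T\<close> is at least 2.\<close>
          have m_le: "m \<le> n + \<mu> div 2"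
          proof -
            have "(4 * M\<^sub>1 + 4) * T \<le> M * T" using M0 T2 by (intro mult_right_mono) auto
            then have "4 * (M\<^sub>1 * T) + 4 * T \<le> M * T" by (simp add: algebra_simps)
            then have "real m + 1 < real n + real \<mu> / 2 + 1" using m' n' \<mu>' T2 by linarith
            then show ?thesis by linarith
          qed
          have n_pos: "0 < real n" "real n \<le> real N" using n' M1T M1T0 N by linarith+
          have \<rho>': "\<rho> \<le> 1/2 + 2 * (real \<mu> / (10 ^ 6 * real n))"
          proof -
            have "\<kappa> / (2 * t * u) \<le> (M / 10 ^ 6) / (2 * t * u)"
              using M0 t0 u0 by (intro divide_right_mono) auto
            also have "\<dots> \<le> M * t\<^sup>2 / (10 ^ 6 * u)"
            proof -
              have "M * 1 \<le> M * (2 * t ^ 3)" using M9 t by (intro mult_left_mono) auto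
              then show ?thesis using t0 u0 by (simp add: field_simps power2_eq_square power3_eq_cube)
            qed
            also have "\<dots> = 2 * ((M * T / 2) / (10 ^ 6 * real N))"
            proof -
              have "t\<^sup>2 / u = T / real N" using T_N u0 N by (simp add: field_simps)
              then have "M / 10 ^ 6 * (t\<^sup>2 / u) = M / 10 ^ 6 * (T / real N)" by simp
              then show ?thesis by simp
            qed
            also have "\<dots> \<le> 2 * (real \<mu> / (10 ^ 6 * real n))"
              using half n_pos by (intro mult_left_mono frac_le) auto
            finally show ?thesis by (simp add: \<rho>_eq)
          qed
          have "1 - 400 * exp (- (real \<mu> ^ 3 / (10 ^ 17 * (real n)\<^sup>2))) \<le> ?q stationary_model"
            by (rule stationary_avoids_ge[OF \<rho> \<mu>10 \<mu>n nm m_le \<rho>'])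
          moreover have "400 * exp (- (real \<mu> ^ 3 / (10 ^ 17 * (real n)\<^sup>2))) \<le> C * exp (- c * (M - M\<^sub>1) ^ 3)"
          proof -
            have "(M * T / 2) ^ 3 / (10 ^ 17 * (real N)\<^sup>2) \<le> real \<mu> ^ 3 / (10 ^ 17 * (real n)\<^sup>2)"
              using half n_pos MT by (intro frac_le power_mono mult_left_mono) auto
            moreover have "(M * T / 2) ^ 3 / (10 ^ 17 * (real N)\<^sup>2) = c * M ^ 3"
              using N by (simp add: power_divide power_mult_distrib T3 c_def)
            moreover have "c * (M - M\<^sub>1) ^ 3 \<le> c * M ^ 3"
              using c assms M by (intro mult_left_mono power_mono) auto
            ultimately have "exp (- (real \<mu> ^ 3 / (10 ^ 17 * (real n)\<^sup>2))) \<le> exp (- c * (M - M\<^sub>1) ^ 3)" by simp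
            then show ?thesis by (intro mult_mono) (auto simp: C_def)
          qed
          ultimately show ?thesis by linarith
        qed
        with 1 show "?p point_to_point_model N M \<ge> ?p stationary_model N M \<and>
            ?p stationary_model N M \<ge> 1 - C * exp (- c * (M - M\<^sub>1) ^ 3)"
          unfolding end_eq line_eq \<rho>_def[symmetric] by blast
      qed
    qed
  qed
  show ?thesis
    by (intro exI[of _ C] conjI C exI[of _ c] c allI impI main)
qed

end
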